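(* Let $0<R<1$ and let $\phi,\psi\in L^\infty(\partial A)$. Suppose that either both $\overline{\phi}_C$ and $\overline{\phi}_{C_0}$ belong to $H^\infty+C$, or both $\psi_C$ and $\psi_{C_0}$ belong to $H^\infty+C$. If $T_\phi T_\psi=0$ on $H^2(\partial A)$, then $\phi=0$ or $\psi=0$ (almost everywhere on $\partial A$).
   Context: $A=\{z\in\mathbb{C}:R<|z|<1\}$, with boundary $\partial A=C\cup C_0$, where $C=\{|z|=1\}$ and $C_0=\{|z|=R\}$. $\sigma$ is the measure on $\partial A$ which is normalized angular Lebesgue measure $\frac{dt}{2\pi}$ on each of the two circles. $L^2(\partial A)=L^2(\partial A,\sigma)$ has inner product $$\langle f,g\rangle_{\partial A}=\frac1{2\pi}\int_0^{2\pi}f(e^{it})\overline{g(e^{it})}\,dt+\frac1{2\pi}\int_0^{2\pi}f(Re^{it})\overline{g(Re^{it})}\,dt,$$ and $L^\infty(\partial A)$ is the space of $\sigma$-essentially bounded functions. The Hardy space $H^2(\partial A)$ is the closure in $L^2(\partial A)$ of the rational functions with no poles in $\overline{A}$; equivalently, it has orthonormal basis $e_n(z)=\frac{1}{\sqrt{1+R^{2n}}}z^n$, $n\in\mathbb{Z}$. $P_R$ is the orthogonal projection of $L^2(\partial A)$ onto $H^2(\partial A)$, and for $\phi\in L^\infty(\partial A)$ the Toeplitz operator $T_\phi:H^2(\partial A)\to H^2(\partial A)$ is $T_\phi h=P_R(\phi h)$. Let $\mathbb{T}$ be the unit circle. To $\phi\in L^\infty(\partial A)$ are associated the functions $\phi_C,\phi_{C_0}\in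 L^\infty(\mathbb{T})$ defined by $\phi_C(z)=\phi(z)$ and $\phi_{C_0}(z)=\phi(R/z)$ for $z\in\mathbb{T}$; $\overline{\phi}_C$ and $\overline{\phi}_{C_0}$ are the functions so associated to the complex conjugate $\overline{\phi}$. Finally, $H^\infty+C=\{f+g: f\in H^\infty(\mathbb{T}),\ g\in C(\mathbb{T})\}$, where $H^\infty(\mathbb{T})$ is the space of functions in $L^\infty(\mathbb{T})$ whose Fourier coefficients of negative index vanish and $C(\mathbb{T})$ is the space of continuous functions on $\mathbb{T}$. *)

theory Defs
  imports "HOL-Probability.Probability" "HOL-Computational_Algebra.Polynomial"
begin

text \<open>
  Elements of Lebesgue and Hardy spaces are represented by functions rather than by
  almost-everywhere equivalence classes; equality of elements is equality \<^verbatim>\<open>AE\<close>.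
\<close>

definition L_infinity :: "'a measure \<Rightarrow> ('a \<Rightarrow> complex) set" where
  "L_infinity M = {f \<in> borel_measurable M. \<exists>B. AE z in M. norm (f z) \<le> B}"

definition L_two :: "'a measure \<Rightarrow> ('a \<Rightarrow> complex) set" where
  "L_two M = {f \<in> borel_measurable M. integrable M (\<lambda>z. (norm (f z))\<^sup>2)}"

definition L_two_inner :: "'a measure \<Rightarrow> ('a \<Rightarrow> complex) \<Rightarrow> ('a \<Rightarrow> complex) \<Rightarrow> complex" where
  "L_two_inner M f g = (LINT z|M. f z * cnj (g z))"

definition L_two_norm :: "'a measure \<Rightarrow> ('a \<Rightarrow> complex) \<Rightarrow> real" where
  "L_two_norm M f = sqrt (LINT z|M. (norm (f z))\<^sup>2)"

definition circle_measure :: "complex measure" where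
  "circle_measure =
     distr (uniform_measure lborel {0..2 * pi}) (restrict_space borel (sphere 0 1)) cis"

definition annulus :: "real \<Rightarrow> complex set" where
  "annulus R = {z. R < norm z \<and> norm z < 1}"

definition annulus_boundary :: "real \<Rightarrow> complex set" where
  "annulus_boundary R = sphere 0 1 \<union> sphere 0 R"

text \<open>
  The measure \<open>\<sigma>\<close>: normalized arc length on each of the circles of radius \<open>1\<close> and \<open>R\<close>
  (total mass \<open>2\<close>), as the image of counting measure on the two radii times
  normalized arc length on the unit circle.
\<close>

definition boundary_measure :: "real \<Rightarrow> complex measure" where
  "boundary_measure R =
     distr (count_space {1, R} \<Otimes>\<^sub>M circle_measure) (restrict_space borel (annulus_boundary R))
       (\<lambda>(r, z). of_real r * z)"

text \<open>The following facts confirm the explicit form of integration against \<open>\<sigma>\<close>.\<close>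

lemma measurable_cis_sphere:
  "cis \<in> uniform_measure lborel {0..2 * pi} \<rightarrow>\<^sub>M restrict_space borel (sphere 0 1)"
proof (rule measurable_restrict_space2)
  have "cis \<in> borel_measurable borel"
    by (intro borel_measurable_continuous_onI continuous_intros)
  then show "cis \<in> borel_measurable (uniform_measure lborel {0..2 * pi})" by simp
qed auto

lemma prob_space_circle_measure: "prob_space circle_measure"
  unfolding circle_measure_def
  by (rule prob_space.prob_space_distr[OF prob_space_uniform_measure measurable_cis_sphere]) auto

lemma space_circle_measure: "space circle_measure = sphere 0 1"
  by (simp add: circle_measure_def space_restrict_space)

lemma measurable_boundary_map:
  assumes "0 \<le> R"
  shows "(\<lambda>(r, z). of_real r * z) \<in> (count_space {1, R} \<Otimes>\<^sub>M circle_measure) \<rightarrow>\<^sub>M restrict_space borel (annulus_boundary R)"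
proof (rule measurable_restrict_space2)
  show "(\<lambda>(r, z). of_real r * z) \<in> space (count_space {1, R} \<Otimes>\<^sub>M circle_measure) \<rightarrow> annulus_boundary R"
    using assms by (auto simp: space_pair_measure space_circle_measure annulus_boundary_def norm_mult)
  have i: "(\<lambda>z::complex. z) \<in> circle_measure \<rightarrow>\<^sub>M borel"
    unfolding circle_measure_def by (simp add: measurable_restrict_space1)
  have r: "(\<lambda>r::real. complex_of_real r) \<in> count_space {1, R} \<rightarrow>\<^sub>M borel" by simp
  show "(\<lambda>(r, z). complex_of_real r * z) \<in> borel_measurable (count_space {1, R} \<Otimes>\<^sub>M circle_measure)"
    unfolding split_beta'
    by (intro borel_measurable_times measurable_compose[OF measurable_fst r] measurable_compose[OF measurable_snd i])
qed

lemma integral_boundary_measure: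
  fixes f :: "complex \<Rightarrow> complex"
  assumes R: "0 < R" "R < 1" and f: "integrable (boundary_measure R) f"
  shows "(LINT z|boundary_measure R. f z) =
           (LINT t:{0..2*pi}|lborel. f (cis t)) / (2*pi) + (LINT t:{0..2*pi}|lborel. f (of_real R * cis t)) / (2*pi)"
proof -
  interpret C: prob_space circle_measure by (rule prob_space_circle_measure)
  interpret K: sigma_finite_measure "count_space {1,R}" by (rule sigma_finite_measure_count_space_finite) simp
  interpret P: pair_sigma_finite "count_space {1,R}" circle_measure ..
  have m: "(\<lambda>(r, z). of_real r * z) \<in> (count_space {1, R} \<Otimes>\<^sub>M circle_measure) \<rightarrow>\<^sub>M restrict_space borel (annulus_boundary R)"
    using measurable_boundary_map R by simp
  have fm: "f \<in> borel_measurable (restrict_space borel (annulus_boundary R))"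
    using borel_measurable_integrable[OF f] by (simp add: boundary_measure_def)
  have i: "integrable (count_space {1, R} \<Otimes>\<^sub>M circle_measure) (\<lambda>(r, z). f (of_real r * z))"
    using f[unfolded boundary_measure_def] integrable_distr_eq[OF m fm] by (simp add: split_beta')
  have "(LINT z|boundary_measure R. f z) = (LINT x|(count_space {1, R} \<Otimes>\<^sub>M circle_measure). (case x of (r,z) \<Rightarrow> f (of_real r * z)))"
    unfolding boundary_measure_def integral_distr[OF m fm] by (simp add: split_beta')
  also have "\<dots> = (LINT r|count_space {1,R}. LINT z|circle_measure. f (of_real r * z))"
    using P.integral_fst[OF i] by simp
  also have "\<dots> = (LINT z|circle_measure. f z) + (LINT z|circle_measure. f (of_real R * z))"
    using R by (subst lebesgue_integral_count_space_finite) auto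
  finally have *: "(LINT z|boundary_measure R. f z) = (LINT z|circle_measure. f z) + (LINT z|circle_measure. f (of_real R * z))" .
  have c: "(LINT z|circle_measure. g z) = (LINT t:{0..2*pi}|lborel. g (cis t)) / (2*pi)"
    if g: "g \<in> borel_measurable (restrict_space borel (sphere 0 1))" for g :: "complex \<Rightarrow> complex"
  proof -
    have mg: "(\<lambda>t. g (cis t)) \<in> borel_measurable lborel"
      using measurable_compose[OF measurable_cis_sphere g] by simp
    have "(LINT z|circle_measure. g z) = (LINT t|uniform_measure lborel {0..2 * pi}. g (cis t))"
      unfolding circle_measure_def by (rule integral_distr[OF measurable_cis_sphere g])
    also have "uniform_measure lborel {0..2 * pi} = density lborel (\<lambda>t. ennreal (indicator {0..2*pi} t / (2*pi)))"
      unfolding uniform_measure_def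
      by (rule density_cong) (auto simp: divide_ennreal[symmetric] split: split_indicator)
    also have "(LINT t|\<dots>. g (cis t)) = (LINT t|lborel. (indicator {0..2*pi} t / (2*pi)) *\<^sub>R g (cis t))"
      by (rule integral_density) (use mg in auto)
    also have "\<dots> = (LINT t|lborel. (indicator {0..2*pi} t *\<^sub>R g (cis t)) / (2*pi))"
      by (rule Bochner_Integration.integral_cong) (auto simp: scaleR_conv_of_real)
    finally show ?thesis by (simp add: set_lebesgue_integral_def)
  qed
  have g1: "f \<in> borel_measurable (restrict_space borel (sphere 0 1))"
    by (rule measurable_restrict_mono[OF fm]) (auto simp: annulus_boundary_def)
  have g2: "(\<lambda>z. f (of_real R * z)) \<in> borel_measurable (restrict_space borel (sphere 0 1))"
    by (rule measurable_compose[OF _ fm], rule measurable_restrict_space3)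
       (use R in \<open>auto simp: annulus_boundary_def norm_mult\<close>)
  show ?thesis unfolding * c[OF g1] c[OF g2] ..
qed

definition rational_no_poles :: "complex set \<Rightarrow> (complex \<Rightarrow> complex) set" where
  "rational_no_poles K =
     {f. \<exists>p q. (\<forall>z\<in>K. poly q z \<noteq> 0) \<and> f = (\<lambda>z. poly p z / poly q z)}"

definition Hardy_two :: "real \<Rightarrow> (complex \<Rightarrow> complex) set" where
  "Hardy_two R =
     {f \<in> L_two (boundary_measure R).
        \<forall>\<epsilon>>0. \<exists>r \<in> rational_no_poles (closure (annulus R)).
          L_two_norm (boundary_measure R) (\<lambda>z. f z - r z) < \<epsilon>}"

text \<open>
  The orthogonal projection of \<open>f\<close> is determined only up to a null set; a representative is chosen.
\<close>

definition Hardy_projection :: "real \<Rightarrow> (complex \<Rightarrow> complex) \<Rightarrow> (complex \<Rightarrow> complex)" where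
  "Hardy_projection R f =
     (SOME g. g \<in> Hardy_two R \<and>
        (\<forall>h \<in> Hardy_two R. L_two_inner (boundary_measure R) (\<lambda>z. f z - g z) h = 0))"

definition Toeplitz :: "real \<Rightarrow> (complex \<Rightarrow> complex) \<Rightarrow> (complex \<Rightarrow> complex) \<Rightarrow> (complex \<Rightarrow> complex)" where
  "Toeplitz R \<phi> h = Hardy_projection R (\<lambda>z. \<phi> z * h z)"

text \<open>
  \<open>outer_part \<phi>\<close> and \<open>inner_part R \<phi>\<close> are \<open>\<phi>\<^sub>C\<close> and \<open>\<phi>\<^bsub>C0\<^esub>\<close>; only their values on the unit circle
  matter, since they are used only relative to \<^const>\<open>circle_measure\<close>.
\<close>

definition outer_part :: "(complex \<Rightarrow> complex) \<Rightarrow> (complex \<Rightarrow> complex)" where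
  "outer_part \<phi> = (\<lambda>z. \<phi> z)"

definition inner_part :: "real \<Rightarrow> (complex \<Rightarrow> complex) \<Rightarrow> (complex \<Rightarrow> complex)" where
  "inner_part R \<phi> = (\<lambda>z. \<phi> (of_real R / z))"

definition Fourier_coefficient :: "(complex \<Rightarrow> complex) \<Rightarrow> int \<Rightarrow> complex" where
  "Fourier_coefficient f n = L_two_inner circle_measure f (\<lambda>z. z powi n)"

definition H_infinity :: "(complex \<Rightarrow> complex) set" where
  "H_infinity = {f \<in> L_infinity circle_measure. \<forall>n<0. Fourier_coefficient f n = 0}"

definition H_infinity_plus_C :: "(complex \<Rightarrow> complex) set" where
  "H_infinity_plus_C =
     {u \<in> L_infinity circle_measure.
        \<exists>f g. f \<in> H_infinity \<and> continuous_on (sphere 0 1) g \<and>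
          (AE z in circle_measure. u z = f z + g z)}"

end

theory Submission
  imports Defs "HOL-Complex_Analysis.Complex_Analysis"
begin

text \<open>
  Write \<open>\<sigma>\<close> for the boundary measure, \<open>P\<close> for the Hardy projection, and let \<open>\<nu>\<close> be \<open>1\<close> on the outer and
  \<open>-1\<close> on the inner circle.  Suppose that \<open>T\<^sub>\<phi> T\<^sub>\<psi> = 0\<close> and that neither symbol is zero.

  The product \<open>\<phi>\<psi>\<close> vanishes almost everywhere (\<open>symbols_product_zero\<close>).  For large \<open>n\<close> the function \<open>z\<^sup>n\<psi>\<close>
  is small on the inner circle, and on the outer circle \<open>\<psi>\<close> is close to a trigonometric polynomial, so
  \<open>z\<^sup>n\<psi>\<close> is close to a Laurent polynomial and \<open>P(z\<^sup>n\<psi>)\<close> is close to \<open>z\<^sup>n\<psi>\<close>.  Hence the zero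
  \<open>\<langle>\<phi> P(\<psi>z\<^sup>n), z\<^sup>n z\<^sup>k\<rangle>\<close> tends to the integral of \<open>\<phi>\<psi>\<close> against the conjugate of \<open>z\<^sup>k\<close> over the outer circle, for
  every integer \<open>k\<close>.  The powers of \<open>R/z\<close> treat the inner circle in the same way.

  It follows that each symbol vanishes on a set of positive measure, because the other one does not vanish
  almost everywhere.  This is combined with a uniqueness theorem of F. and M. Riesz type
  (\<open>cauchy_class_uniqueness\<close>): a function in \<open>L\<^sup>2(\<sigma>)\<close> that is annihilated by all \<open>\<nu> z\<^sup>k d\<sigma>\<close>, and
  every Hardy function is one by Cauchy's theorem, must be zero if it vanishes on a set of positive measure.
  The passage from \<open>u\<close> to the conjugate of \<open>\<nu>u\<close> carries the orthogonal complement of the Hardy space into this class.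

  Put \<open>u = \<psi> - P\<psi>\<close>, which is orthogonal to the Hardy space.  So is \<open>\<phi>u\<close>, since \<open>\<phi>\<psi> = 0\<close> and \<open>T\<^sub>\<phi> T\<^sub>\<psi> 1 = 0\<close>.
  The conjugate of \<open>\<nu>\<phi>u\<close> lies in the class and vanishes where \<open>\<phi>\<close> does, so \<open>\<phi>u = 0\<close>.  Then \<open>u\<close> vanishes
  where \<open>\<phi>\<close> does not, so \<open>u = 0\<close>.  Thus \<open>\<psi> = P\<psi>\<close> is a Hardy function vanishing on a set of positive
  measure, and \<open>\<psi> = 0\<close>.

  The uniqueness theorem is proved by Helson's Hilbert space argument.  Given \<open>f\<close> in the class and
  \<open>\<rho> = sqrt R\<close>, the component \<open>q\<close> of \<open>f\<close> orthogonal to all \<open>(z\<^sup>N - \<rho>\<^sup>N) z\<^sup>k f\<close> is orthogonal to all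
  \<open>(z\<^sup>N - \<rho>\<^sup>N) z\<^sup>k q\<close>, so the moments of \<open>\<bar>q\<bar>\<^sup>2\<close> satisfy a geometric recursion and \<open>\<bar>q\<bar>\<^sup>2\<close> is real analytic on both
  circles.  As \<open>q\<close> vanishes where \<open>f\<close> does, \<open>q = 0\<close>.  Hence \<open>f\<close> is in the closed span of the
  \<open>(z\<^sup>N - \<rho>\<^sup>N) z\<^sup>k f\<close> and is annihilated by \<open>\<nu> z\<^sup>k / (z\<^sup>N - \<rho>\<^sup>N) d\<sigma>\<close> for all \<open>k\<close>; multiplying the kernel by \<open>z\<^sup>N\<close>
  and letting \<open>N\<close> tend to infinity shows that all Fourier coefficients of \<open>f\<close> on the outer circle are zero.
\<close>

section \<open>Square-integrable functions\<close>

lemma L_twoD: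
  assumes "f \<in> L_two M"
  shows "f \<in> borel_measurable M" "integrable M (\<lambda>z. (norm (f z))\<^sup>2)"
  using assms by (auto simp: L_two_def)

lemma L_two_zero: "(\<lambda>z. 0) \<in> L_two M"
  by (simp add: L_two_def)

lemma L_two_cnj: "f \<in> L_two M \<Longrightarrow> (\<lambda>z. cnj (f z)) \<in> L_two M"
  by (auto simp: L_two_def intro!: borel_measurable_continuous_on[OF continuous_on_cnj[OF continuous_on_id]])

lemma L_two_bounded_mult:
  assumes f: "f \<in> L_two M" and b: "b \<in> borel_measurable M" and B: "AE z in M. norm (b z) \<le> B"
  shows "(\<lambda>z. b z * f z) \<in> L_two M"
proof -
  note [measurable] = L_twoD(1)[OF f] b
  have "integrable M (\<lambda>z. B\<^sup>2 * (norm (f z))\<^sup>2)"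
    using L_twoD(2)[OF f] by simp
  then have "integrable M (\<lambda>z. (norm (b z * f z))\<^sup>2)"
  proof (rule Bochner_Integration.integrable_bound)
    show "AE z in M. norm ((norm (b z * f z))\<^sup>2) \<le> norm (B\<^sup>2 * (norm (f z))\<^sup>2)"
      using B by eventually_elim (auto simp: norm_mult power_mult_distrib intro!: mult_right_mono power_mono)
  qed measurable
  then show ?thesis by (simp add: L_two_def)
qed

lemma L_two_cmult: "f \<in> L_two M \<Longrightarrow> (\<lambda>z. c * f z) \<in> L_two M"
  by (rule L_two_bounded_mult[where B = "norm c"]) auto

lemma norm_add_square_le: "(norm (x + y))\<^sup>2 \<le> 2 * (norm x)\<^sup>2 + 2 * (norm y)\<^sup>2"
  for x y :: complex
  using sum_squares_bound[of "norm x" "norm y"] power_mono[OF norm_triangle_ineq[of x y], of 2]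
  by (simp add: power2_sum)

lemma L_two_add:
  assumes "f \<in> L_two M" "g \<in> L_two M"
  shows "(\<lambda>z. f z + g z) \<in> L_two M"
proof -
  note [measurable] = L_twoD(1)[OF assms(1)] L_twoD(1)[OF assms(2)]
  have "integrable M (\<lambda>z. 2 * (norm (f z))\<^sup>2 + 2 * (norm (g z))\<^sup>2)"
    using L_twoD(2)[OF assms(1)] L_twoD(2)[OF assms(2)] by simp
  then have "integrable M (\<lambda>z. (norm (f z + g z))\<^sup>2)"
  proof (rule Bochner_Integration.integrable_bound)
    show "AE z in M. norm ((norm (f z + g z))\<^sup>2) \<le> norm (2 * (norm (f z))\<^sup>2 + 2 * (norm (g z))\<^sup>2)"
      using norm_add_square_le by (auto simp: power_mult_distrib)
  qed measurable
  then show ?thesis by (simp add: L_two_def)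
qed

lemma L_two_diff:
  assumes "f \<in> L_two M" "g \<in> L_two M"
  shows "(\<lambda>z. f z - g z) \<in> L_two M"
  using L_two_add[OF assms(1) L_two_cmult[OF assms(2), of "-1"]] by simp

lemma integrable_L_two_mult:
  assumes "f \<in> L_two M" "g \<in> L_two M"
  shows "integrable M (\<lambda>z. f z * g z)"
proof -
  note [measurable] = L_twoD(1)[OF assms(1)] L_twoD(1)[OF assms(2)]
  have "integrable M (\<lambda>z. (norm (f z))\<^sup>2 + (norm (g z))\<^sup>2)"
    using L_twoD(2)[OF assms(1)] L_twoD(2)[OF assms(2)] by simp
  then show ?thesis
  proof (rule Bochner_Integration.integrable_bound)
    have "norm (f z * g z) \<le> norm ((norm (f z))\<^sup>2 + (norm (g z))\<^sup>2)" for z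
      using sum_squares_bound[of "norm (f z)" "norm (g z)"] mult_nonneg_nonneg[OF norm_ge_zero[of "f z"] norm_ge_zero[of "g z"]]
      unfolding norm_mult real_norm_def by linarith
    then show "AE z in M. norm (f z * g z) \<le> norm ((norm (f z))\<^sup>2 + (norm (g z))\<^sup>2)" by simp
  qed measurable
qed

lemma L_two_norm_nonneg: "0 \<le> L_two_norm M f"
  by (simp add: L_two_norm_def)

lemma L_two_norm_power2: "(L_two_norm M f)\<^sup>2 = (LINT z|M. (norm (f z))\<^sup>2)"
  by (simp add: L_two_norm_def)

lemma L_two_norm_commute: "L_two_norm M (\<lambda>z. f z - g z) = L_two_norm M (\<lambda>z. g z - f z)"
  by (simp add: L_two_norm_def norm_minus_commute)

lemma L_two_norm_eq_0:
  assumes "f \<in> L_two M" "L_two_norm M f = 0"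
  shows "AE z in M. f z = 0"
proof -
  have "(LINT z|M. (norm (f z))\<^sup>2) = 0"
    using assms(2) by (simp add: L_two_norm_def)
  then show ?thesis
    using integral_nonneg_eq_0_iff_AE[OF L_twoD(2)[OF assms(1)]] by simp
qed

lemma L_two_norm_zero_AE: "AE z in M. f z = 0 \<Longrightarrow> L_two_norm M f = 0"
  unfolding L_two_norm_def using integral_eq_zero_AE[of "\<lambda>z. (norm (f z))\<^sup>2" M]
  by (simp add: eventually_mono)

lemma integral_norm_mult_le:
  assumes f: "f \<in> L_two M" and g: "g \<in> L_two M"
  shows "(LINT z|M. norm (f z * g z)) \<le> L_two_norm M f * L_two_norm M g"
proof (cases "L_two_norm M f = 0 \<or> L_two_norm M g = 0")
  case True
  then have "AE z in M. norm (f z * g z) = 0"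
    using L_two_norm_eq_0[OF f] L_two_norm_eq_0[OF g] by (elim disjE) (force elim: eventually_mono)+
  then have "(LINT z|M. norm (f z * g z)) = 0"
    by (rule integral_eq_zero_AE)
  then show ?thesis by (simp add: L_two_norm_nonneg)
next
  case False
  define a b where "a = L_two_norm M f" and "b = L_two_norm M g"
  have ab: "a > 0" "b > 0"
    using False L_two_norm_nonneg[of M f] L_two_norm_nonneg[of M g] by (auto simp: a_def b_def)
  have i: "integrable M (\<lambda>z. (norm (f z))\<^sup>2 / (2 * a\<^sup>2) + (norm (g z))\<^sup>2 / (2 * b\<^sup>2))"
    using L_twoD(2)[OF f] L_twoD(2)[OF g] by simp
  have "norm (f z * g z) / (a * b) \<le> (norm (f z))\<^sup>2 / (2 * a\<^sup>2) + (norm (g z))\<^sup>2 / (2 * b\<^sup>2)" for z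
    using sum_squares_bound[of "norm (f z) / a" "norm (g z) / b"]
    by (simp add: norm_mult power_divide)
  then have "(LINT z|M. norm (f z * g z) / (a * b)) \<le> (LINT z|M. (norm (f z))\<^sup>2 / (2 * a\<^sup>2) + (norm (g z))\<^sup>2 / (2 * b\<^sup>2))"
    by (intro integral_mono i integrable_divide integrable_norm integrable_L_two_mult f g) auto
  also have "\<dots> = a\<^sup>2 / (2 * a\<^sup>2) + b\<^sup>2 / (2 * b\<^sup>2)"
    using L_twoD(2)[OF f] L_twoD(2)[OF g] by (simp add: a_def b_def L_two_norm_power2)
  also have "\<dots> = 1" using ab by simp
  finally show ?thesis using ab by (simp add: a_def b_def divide_simps)
qed

lemma L_two_Cauchy_Schwarz:
  assumes "f \<in> L_two M" "g \<in> L_two M"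
  shows "norm (LINT z|M. f z * g z) \<le> L_two_norm M f * L_two_norm M g"
  using integral_norm_bound[of M "\<lambda>z. f z * g z"] integral_norm_mult_le[OF assms] by linarith

lemma L_two_norm_triangle:
  assumes f: "f \<in> L_two M" and g: "g \<in> L_two M"
  shows "L_two_norm M (\<lambda>z. f z + g z) \<le> L_two_norm M f + L_two_norm M g"
proof (rule power2_le_imp_le)
  have i: "integrable M (\<lambda>z. (norm (f z))\<^sup>2 + (norm (g z))\<^sup>2 + 2 * norm (f z * g z))"
    using L_twoD(2)[OF f] L_twoD(2)[OF g] integrable_norm[OF integrable_L_two_mult[OF f g]] by simp
  have "(LINT z|M. (norm (f z + g z))\<^sup>2) \<le> (LINT z|M. (norm (f z))\<^sup>2 + (norm (g z))\<^sup>2 + 2 * norm (f z * g z))"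
  proof (rule integral_mono[OF L_twoD(2)[OF L_two_add[OF f g]] i])
    show "(norm (f z + g z))\<^sup>2 \<le> (norm (f z))\<^sup>2 + (norm (g z))\<^sup>2 + 2 * norm (f z * g z)" for z
      using power_mono[OF norm_triangle_ineq[of "f z" "g z"], of 2] by (simp add: power2_sum norm_mult)
  qed
  also have "\<dots> = (L_two_norm M f)\<^sup>2 + (L_two_norm M g)\<^sup>2 + 2 * (LINT z|M. norm (f z * g z))"
    using L_twoD(2)[OF f] L_twoD(2)[OF g] integrable_norm[OF integrable_L_two_mult[OF f g]]
    by (simp add: L_two_norm_power2)
  also have "\<dots> \<le> (L_two_norm M f + L_two_norm M g)\<^sup>2"
    using integral_norm_mult_le[OF f g] by (simp add: power2_sum)
  finally show "(L_two_norm M (\<lambda>z. f z + g z))\<^sup>2 \<le> (L_two_norm M f + L_two_norm M g)\<^sup>2"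
    by (simp add: L_two_norm_power2)
qed (simp add: L_two_norm_nonneg)

lemma L_two_norm_cmult: "L_two_norm M (\<lambda>z. c * f z) = norm c * L_two_norm M f"
  by (simp add: L_two_norm_def norm_mult power_mult_distrib real_sqrt_mult)

lemma L_two_norm_triangle_diff:
  assumes "f \<in> L_two M" "g \<in> L_two M" "h \<in> L_two M"
  shows "L_two_norm M (\<lambda>z. f z - h z) \<le> L_two_norm M (\<lambda>z. f z - g z) + L_two_norm M (\<lambda>z. g z - h z)"
  using L_two_norm_triangle[OF L_two_diff[OF assms(1,2)] L_two_diff[OF assms(2,3)]] by simp

lemma L_two_norm_le_mono:
  assumes "f \<in> borel_measurable M" "g \<in> L_two M" "AE z in M. norm (f z) \<le> norm (g z)"
  shows "f \<in> L_two M" "L_two_norm M f \<le> L_two_norm M g"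
proof -
  have ae: "AE z in M. (norm (f z))\<^sup>2 \<le> (norm (g z))\<^sup>2"
    using assms(3) by eventually_elim (auto intro: power_mono)
  have i: "integrable M (\<lambda>z. (norm (f z))\<^sup>2)"
    by (rule Bochner_Integration.integrable_bound[OF L_twoD(2)[OF assms(2)]]) (use assms(1) ae in auto)
  then show "f \<in> L_two M" using assms(1) by (simp add: L_two_def)
  show "L_two_norm M f \<le> L_two_norm M g"
    unfolding L_two_norm_def using integral_mono_AE[OF i L_twoD(2)[OF assms(2)] ae] by simp
qed

lemma L_infinityD:
  assumes "b \<in> L_infinity M"
  obtains B where "b \<in> borel_measurable M" "AE z in M. norm (b z) \<le> B"
  using assms by (auto simp: L_infinity_def)

lemma L_two_L_infinity_mult:
  assumes "b \<in> L_infinity M" "f \<in> L_two M"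
  shows "(\<lambda>z. b z * f z) \<in> L_two M"
  using assms by (auto simp: L_infinity_def intro: L_two_bounded_mult)

lemma (in finite_measure) L_two_const: "(\<lambda>z. c) \<in> L_two M"
  by (simp add: L_two_def)

lemma (in finite_measure) L_infinity_L_two: "b \<in> L_infinity M \<Longrightarrow> b \<in> L_two M"
  using L_two_L_infinity_mult[OF _ L_two_const[of 1]] by simp

subsection \<open>Riesz--Fischer\<close>

text \<open>
  On a finite measure space the \<open>L\<^sup>2\<close> norm dominates the \<open>L\<^sup>1\<close> norm, so a rapidly Cauchy sequence
  has integrable total variation and hence converges almost everywhere; Fatou's lemma turns
  this into convergence in norm.
\<close>

lemma (in finite_measure) L_two_complete:
  assumes g: "\<And>n. g n \<in> L_two M"
    and cauchy: "\<And>m n. n \<le> m \<Longrightarrow> L_two_norm M (\<lambda>z. g m z - g n z) \<le> C * (1/2) ^ n"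
  obtains l where "l \<in> L_two M" "\<And>n. L_two_norm M (\<lambda>z. l z - g n z) \<le> C * (1/2) ^ n"
proof -
  have [measurable]: "g n \<in> borel_measurable M" for n using L_twoD(1)[OF g] .
  define d where "d n z = g (Suc n) z - g n z" for n z
  have d2: "d n \<in> L_two M" for n unfolding d_def by (rule L_two_diff[OF g g])
  have dint: "integrable M (d n)" for n
    using integrable_L_two_mult[OF d2 L_two_const[of 1]] by simp
  define K where "K = L_two_norm M (\<lambda>z. 1)"
  have dle: "(LINT z|M. norm (d n z)) \<le> K * C * (1/2) ^ n" for n
  proof -
    have "(LINT z|M. norm (d n z)) \<le> L_two_norm M (d n) * K"
      using integral_norm_mult_le[OF d2 L_two_const[of 1]] by (simp add: K_def)
    also have "\<dots> \<le> (C * (1/2) ^ n) * K"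
      using cauchy[of n "Suc n"] by (intro mult_right_mono) (auto simp: d_def[abs_def] K_def L_two_norm_nonneg)
    finally show ?thesis by (simp add: mult_ac)
  qed
  have dmeas [measurable]: "d n \<in> borel_measurable M" for n using dint by auto
  have "(\<integral>\<^sup>+z. (\<Sum>n. ennreal (norm (d n z))) \<partial>M) = (\<Sum>n. \<integral>\<^sup>+z. ennreal (norm (d n z)) \<partial>M)"
    by (rule nn_integral_suminf) simp
  also have "\<dots> = (\<Sum>n. ennreal (LINT z|M. norm (d n z)))"
    by (intro arg_cong[where f = suminf] ext nn_integral_eq_integral integrable_norm dint) auto
  also have "\<dots> \<noteq> \<infinity>"
  proof -
    have "summable (\<lambda>n. LINT z|M. norm (d n z))"
      by (rule summable_comparison_test'[where g = "\<lambda>n. K * C * (1/2) ^ n" and N = 0])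
         (use dle in \<open>auto intro!: summable_mult summable_geometric\<close>)
    then show ?thesis
      by (simp add: ennreal_suminf_neq_top)
  qed
  finally have "AE z in M. (\<Sum>n. ennreal (norm (d n z))) \<noteq> \<infinity>"
    by (intro nn_integral_PInf_AE) auto
  then have "AE z in M. convergent (\<lambda>n. g n z)"
  proof eventually_elim
    case (elim z)
    then have "summable (\<lambda>n. d n z)"
      by (intro summable_norm_cancel[OF summable_suminf_not_top]) auto
    then have "convergent (\<lambda>n. \<Sum>k<n. d k z)"
      by (simp add: summable_iff_convergent)
    moreover have "(\<Sum>k<n. d k z) = g n z - g 0 z" for n
      by (simp add: d_def sum_lessThan_telescope[of "\<lambda>k. g k z"])
    ultimately have "convergent (\<lambda>n. (g n z - g 0 z) + g 0 z)"
      by (intro convergent_add convergent_const) simp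
    then show ?case by simp
  qed
  define l where "l z = lim (\<lambda>n. g n z)" for z
  have lim: "AE z in M. (\<lambda>n. g n z) \<longlonglongrightarrow> l z"
    using \<open>AE z in M. convergent _\<close> by eventually_elim (simp add: l_def convergent_LIMSEQ_iff)
  have [measurable]: "l \<in> borel_measurable M"
    unfolding l_def[abs_def] by measurable
  have fatou: "(\<integral>\<^sup>+z. ennreal ((norm (l z - g n z))\<^sup>2) \<partial>M) \<le> ennreal ((C * (1/2) ^ n)\<^sup>2)" for n
  proof -
    have "(\<integral>\<^sup>+z. ennreal ((norm (l z - g n z))\<^sup>2) \<partial>M)
        = (\<integral>\<^sup>+z. liminf (\<lambda>m. ennreal ((norm (g m z - g n z))\<^sup>2)) \<partial>M)"
    proof (rule nn_integral_cong_AE)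
      show "AE z in M. ennreal ((norm (l z - g n z))\<^sup>2) = liminf (\<lambda>m. ennreal ((norm (g m z - g n z))\<^sup>2))"
        using lim
      proof eventually_elim
        case (elim z)
        then have "(\<lambda>m. ennreal ((norm (g m z - g n z))\<^sup>2)) \<longlonglongrightarrow> ennreal ((norm (l z - g n z))\<^sup>2)"
          by (intro tendsto_intros)
        then show ?case by (intro lim_imp_Liminf[symmetric]) auto
      qed
    qed
    also have "\<dots> \<le> liminf (\<lambda>m. \<integral>\<^sup>+z. ennreal ((norm (g m z - g n z))\<^sup>2) \<partial>M)"
      by (rule nn_integral_liminf) auto
    also have "\<dots> \<le> ennreal ((C * (1/2) ^ n)\<^sup>2)"
    proof (rule Liminf_le)
      show "\<forall>\<^sub>F m in sequentially. (\<integral>\<^sup>+z. ennreal ((norm (g m z - g n z))\<^sup>2) \<partial>M) \<le> ennreal ((C * (1/2) ^ n)\<^sup>2)"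
        using eventually_ge_at_top[of n]
      proof eventually_elim
        case (elim m)
        have "(\<integral>\<^sup>+z. ennreal ((norm (g m z - g n z))\<^sup>2) \<partial>M) = ennreal ((L_two_norm M (\<lambda>z. g m z - g n z))\<^sup>2)"
          unfolding L_two_norm_power2
          by (intro nn_integral_eq_integral L_twoD(2)[OF L_two_diff[OF g g]]) auto
        also have "\<dots> \<le> ennreal ((C * (1/2) ^ n)\<^sup>2)"
          by (intro ennreal_leI power_mono cauchy elim L_two_norm_nonneg)
        finally show ?case .
      qed
    qed simp
    finally show ?thesis .
  qed
  have diff: "(\<lambda>z. l z - g n z) \<in> L_two M" for n
    unfolding L_two_def using le_less_trans[OF fatou[of n] ennreal_less_top]
    by (auto intro!: integrableI_bounded)
  have C: "0 \<le> C"
    using order_trans[OF L_two_norm_nonneg cauchy[of 0 0]] by simp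
  have "L_two_norm M (\<lambda>z. l z - g n z) \<le> C * (1/2) ^ n" for n
  proof (rule power2_le_imp_le)
    have "ennreal ((L_two_norm M (\<lambda>z. l z - g n z))\<^sup>2) \<le> ennreal ((C * (1/2) ^ n)\<^sup>2)"
      using fatou[of n] unfolding L_two_norm_power2
      by (subst (asm) nn_integral_eq_integral[OF L_twoD(2)[OF diff]]) auto
    then show "(L_two_norm M (\<lambda>z. l z - g n z))\<^sup>2 \<le> (C * (1/2) ^ n)\<^sup>2"
      by (simp add: ennreal_le_iff)
  qed (use C in auto)
  moreover have "l \<in> L_two M"
    using L_two_add[OF diff[of 0] g[of 0]] by simp
  ultimately show ?thesis using that by blast
qed

subsection \<open>Orthogonal projection\<close>

text \<open>
  Closedness is phrased for representatives: a function in \<open>L\<^sup>2\<close> that is approximable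
  from the subspace, in particular one that agrees almost everywhere with a member, belongs to it.
\<close>

definition closed_subspace :: "'a measure \<Rightarrow> ('a \<Rightarrow> complex) set \<Rightarrow> bool" where
  "closed_subspace M S \<longleftrightarrow> S \<subseteq> L_two M \<and> (\<lambda>z. 0) \<in> S \<and>
     (\<forall>f\<in>S. \<forall>g\<in>S. (\<lambda>z. f z + g z) \<in> S) \<and> (\<forall>f\<in>S. \<forall>c. (\<lambda>z. c * f z) \<in> S) \<and>
     (\<forall>f\<in>L_two M. (\<forall>e>0. \<exists>g\<in>S. L_two_norm M (\<lambda>z. f z - g z) < e) \<longrightarrow> f \<in> S)"

lemma closed_subspaceD:
  assumes "closed_subspace M S"
  shows "\<And>f. f \<in> S \<Longrightarrow> f \<in> L_two M" "(\<lambda>z. 0) \<in> S"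
    "\<And>f g. f \<in> S \<Longrightarrow> g \<in> S \<Longrightarrow> (\<lambda>z. f z + g z) \<in> S"
    "\<And>f c. f \<in> S \<Longrightarrow> (\<lambda>z. c * f z) \<in> S"
    "\<And>f. f \<in> L_two M \<Longrightarrow> (\<And>e. e > 0 \<Longrightarrow> \<exists>g\<in>S. L_two_norm M (\<lambda>z. f z - g z) < e) \<Longrightarrow> f \<in> S"
  using assms by (auto simp: closed_subspace_def)

lemma L_two_parallelogram:
  assumes "f \<in> L_two M" "g \<in> L_two M"
  shows "(L_two_norm M (\<lambda>z. f z - g z))\<^sup>2 + (L_two_norm M (\<lambda>z. f z + g z))\<^sup>2
    = 2 * (L_two_norm M f)\<^sup>2 + 2 * (L_two_norm M g)\<^sup>2"
proof -
  have "(norm (f z - g z))\<^sup>2 + (norm (f z + g z))\<^sup>2 = 2 * (norm (f z))\<^sup>2 + 2 * (norm (g z))\<^sup>2" for z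
    unfolding cmod_power2 by (simp add: power2_eq_square algebra_simps)
  then have "(LINT z|M. (norm (f z - g z))\<^sup>2 + (norm (f z + g z))\<^sup>2) = (LINT z|M. 2 * (norm (f z))\<^sup>2 + 2 * (norm (g z))\<^sup>2)"
    by simp
  then show ?thesis
    using L_twoD(2)[OF assms(1)] L_twoD(2)[OF assms(2)] L_twoD(2)[OF L_two_add[OF assms]] L_twoD(2)[OF L_two_diff[OF assms]]
    by (simp add: L_two_norm_power2)
qed

lemma L_two_norm_diff_cmult_power2:
  assumes "u \<in> L_two M" "h \<in> L_two M"
  shows "(L_two_norm M (\<lambda>z. u z - c * h z))\<^sup>2
    = (L_two_norm M u)\<^sup>2 - 2 * Re (cnj c * L_two_inner M u h) + (norm c)\<^sup>2 * (L_two_norm M h)\<^sup>2"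
proof -
  define r where "r z = Re (cnj c * (u z * cnj (h z)))" for z
  have i: "integrable M (\<lambda>z. u z * cnj (h z))"
    by (rule integrable_L_two_mult[OF assms(1) L_two_cnj[OF assms(2)]])
  then have ir: "integrable M r"
    unfolding r_def[abs_def] by (intro integrable_Re integrable_mult_right)
  have "(norm (u z - c * h z))\<^sup>2 = (norm (u z))\<^sup>2 - 2 * r z + (norm c)\<^sup>2 * (norm (h z))\<^sup>2" for z
    unfolding cmod_power2 r_def by (simp add: power2_eq_square algebra_simps)
  then have "(L_two_norm M (\<lambda>z. u z - c * h z))\<^sup>2
    = (LINT z|M. (norm (u z))\<^sup>2 - 2 * r z + (norm c)\<^sup>2 * (norm (h z))\<^sup>2)"
    by (simp add: L_two_norm_power2)
  also have "\<dots> = (LINT z|M. (norm (u z))\<^sup>2) - 2 * (LINT z|M. r z) + (norm c)\<^sup>2 * (LINT z|M. (norm (h z))\<^sup>2)"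
    using L_twoD(2)[OF assms(1)] L_twoD(2)[OF assms(2)] ir by simp
  also have "(LINT z|M. r z) = Re (LINT z|M. cnj c * (u z * cnj (h z)))"
    unfolding r_def by (rule integral_Re[OF integrable_mult_right[OF i]])
  also have "(LINT z|M. cnj c * (u z * cnj (h z))) = cnj c * L_two_inner M u h"
    unfolding L_two_inner_def by (rule integral_mult_right_zero)
  finally show ?thesis by (simp add: L_two_norm_power2)
qed

text \<open>
  The error of a best approximation \<open>g\<close> is orthogonal to the subspace, since otherwise moving
  from \<open>g\<close> a little in the direction of some \<open>h\<close> would decrease the distance.
\<close>

lemma best_approximation_orthogonal:
  assumes u: "u \<in> L_two M" and h: "h \<in> L_two M"
    and min: "\<And>c. L_two_norm M u \<le> L_two_norm M (\<lambda>z. u z - c * h z)"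
  shows "L_two_inner M u h = 0"
proof -
  define w where "w = L_two_inner M u h"
  define b where "b = (L_two_norm M h)\<^sup>2"
  \<comment> \<open>A step so small that the first-order gain exceeds the quadratic loss.\<close>
  define t where "t = 1 / (b + 1)"
  have b: "b \<ge> 0" by (simp add: b_def)
  have t: "t > 0" "t * b < 1" using b by (auto simp: t_def field_simps)
  have "(L_two_norm M u)\<^sup>2 \<le> (L_two_norm M (\<lambda>z. u z - (of_real t * w) * h z))\<^sup>2"
    by (intro power_mono min L_two_norm_nonneg)
  also have "\<dots> = (L_two_norm M u)\<^sup>2 - 2 * Re (cnj (of_real t * w) * w) + (norm (of_real t * w))\<^sup>2 * b"
    unfolding L_two_norm_diff_cmult_power2[OF u h] by (simp add: w_def b_def)
  also have "Re (cnj (of_real t * w) * w) = t * (norm w)\<^sup>2"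
    unfolding cmod_power2 by (simp add: power2_eq_square algebra_simps)
  also have "(norm (of_real t * w))\<^sup>2 * b = t * (t * b) * (norm w)\<^sup>2"
    using t by (simp add: norm_mult power2_eq_square)
  finally have "0 \<le> t * (norm w)\<^sup>2 * (t * b - 2)"
    by (simp add: algebra_simps)
  then have "(norm w)\<^sup>2 \<le> 0"
    using t by (auto simp: zero_le_mult_iff mult_le_0_iff)
  then show ?thesis by (simp add: w_def)
qed

text \<open>
  By the parallelogram law a minimizing sequence for the distance to \<open>S\<close> is Cauchy; its terms are
  chosen within \<open>1/4\<^sup>n\<close> of the minimal squared distance so that it is rapidly Cauchy.
\<close>

theorem (in finite_measure) orthogonal_projection_exists:
  assumes S: "closed_subspace M S" and f: "f \<in> L_two M"
  shows "\<exists>g\<in>S. \<forall>h\<in>S. L_two_inner M (\<lambda>z. f z - g z) h = 0"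
proof -
  note S2 = closed_subspaceD(1)[OF S]
  define D where "D g = L_two_norm M (\<lambda>z. f z - g z)" for g
  define d where "d = (INF g\<in>S. (D g)\<^sup>2)"
  have bdd: "bdd_below ((\<lambda>g. (D g)\<^sup>2) ` S)" by (rule bdd_belowI[of _ 0]) auto
  have dle: "d \<le> (D g)\<^sup>2" if "g \<in> S" for g
    unfolding d_def by (rule cINF_lower[OF bdd that])
  have "\<exists>g\<in>S. (D g)\<^sup>2 < d + (1/4) ^ n" for n :: nat
    using cINF_less_iff[OF _ bdd, of "d + (1/4) ^ n"] closed_subspaceD(2)[OF S] by (auto simp: d_def)
  then obtain g where g: "\<And>n. g n \<in> S" "\<And>n. (D (g n))\<^sup>2 < d + (1/4) ^ n" by metis
  have g2: "g n \<in> L_two M" for n using S2 g by auto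
  have "L_two_norm M (\<lambda>z. g m z - g n z) \<le> 2 * (1/2) ^ n" if "n \<le> m" for m n
  proof (rule power2_le_imp_le)
    have mid: "(\<lambda>z. (1/2) * (g n z + g m z)) \<in> S"
      by (intro closed_subspaceD(4)[OF S] closed_subspaceD(3)[OF S] g)
    have "(L_two_norm M (\<lambda>z. (f z - g n z) - (f z - g m z)))\<^sup>2
        + (L_two_norm M (\<lambda>z. (f z - g n z) + (f z - g m z)))\<^sup>2 = 2 * (D (g n))\<^sup>2 + 2 * (D (g m))\<^sup>2"
      unfolding D_def by (rule L_two_parallelogram[OF L_two_diff[OF f g2] L_two_diff[OF f g2]])
    moreover have "(\<lambda>z. (f z - g n z) + (f z - g m z)) = (\<lambda>z. 2 * (f z - (1/2) * (g n z + g m z)))"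
      by (auto simp: algebra_simps)
    then have "(L_two_norm M (\<lambda>z. (f z - g n z) + (f z - g m z)))\<^sup>2 = 4 * (D (\<lambda>z. (1/2) * (g n z + g m z)))\<^sup>2"
      by (simp only: L_two_norm_cmult D_def) (simp add: power_mult_distrib)
    moreover have "(D (g m))\<^sup>2 \<le> d + (1/4) ^ n"
      using g(2)[of m] power_decreasing[OF that, of "1/4::real"] by linarith
    ultimately have "(L_two_norm M (\<lambda>z. g m z - g n z))\<^sup>2 \<le> 4 * (1/4) ^ n"
      using g(2)[of n] dle[OF mid] by simp
    also have "\<dots> = (2 * (1/2) ^ n)\<^sup>2"
    proof -
      have "((1/2::real) ^ n)\<^sup>2 = (1/4) ^ n"
        by (simp add: power2_eq_square flip: power_mult_distrib)
      then show ?thesis by (simp add: power_mult_distrib)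
    qed
    finally show "(L_two_norm M (\<lambda>z. g m z - g n z))\<^sup>2 \<le> (2 * (1/2) ^ n)\<^sup>2" .
  qed simp
  from L_two_complete[OF g2 this] obtain l where l: "l \<in> L_two M"
    "\<And>n. L_two_norm M (\<lambda>z. l z - g n z) \<le> 2 * (1/2) ^ n" by blast
  have lim0: "(\<lambda>n. 2 * (1/2::real) ^ n) \<longlonglongrightarrow> 2 * 0"
    by (intro tendsto_mult tendsto_const LIMSEQ_realpow_zero) auto
  have lS: "l \<in> S"
  proof (rule closed_subspaceD(5)[OF S l(1)])
    fix e :: real assume "e > 0"
    then have "\<forall>\<^sub>F n in sequentially. 2 * (1/2::real) ^ n < e"
      using order_tendstoD(2)[OF lim0] by simp
    then obtain n where "2 * (1/2::real) ^ n < e" by (auto simp: eventually_sequentially)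
    then show "\<exists>g\<in>S. L_two_norm M (\<lambda>z. l z - g z) < e"
      using l(2)[of n] g(1)[of n] by (intro bexI[of _ "g n"]) auto
  qed
  have Dl: "D l \<le> sqrt d"
  proof (rule LIMSEQ_le_const)
    show "(\<lambda>n. sqrt (d + (1/4) ^ n) + 2 * (1/2::real) ^ n) \<longlonglongrightarrow> sqrt d"
    proof -
      have "(\<lambda>n. sqrt (d + (1/4) ^ n) + 2 * (1/2::real) ^ n) \<longlonglongrightarrow> sqrt (d + 0) + 2 * 0"
        by (intro tendsto_add lim0 tendsto_real_sqrt tendsto_const LIMSEQ_realpow_zero) auto
      then show ?thesis by simp
    qed
    show "\<exists>N. \<forall>n\<ge>N. D l \<le> sqrt (d + (1/4) ^ n) + 2 * (1/2) ^ n"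
    proof (intro exI allI impI)
      fix n
      have "D l \<le> D (g n) + L_two_norm M (\<lambda>z. g n z - l z)"
        unfolding D_def by (rule L_two_norm_triangle_diff[OF f g2 l(1)])
      moreover have "D (g n) \<le> sqrt (d + (1/4) ^ n)"
        using g(2)[of n] by (intro real_le_rsqrt) simp
      ultimately show "D l \<le> sqrt (d + (1/4) ^ n) + 2 * (1/2) ^ n"
        using l(2)[of n] by (simp add: L_two_norm_commute[of M "g n"])
    qed
  qed
  show ?thesis
  proof (intro bexI[OF _ lS] ballI)
    fix h assume h: "h \<in> S"
    show "L_two_inner M (\<lambda>z. f z - l z) h = 0"
    proof (rule best_approximation_orthogonal[OF L_two_diff[OF f l(1)] S2[OF h]])
      fix c
      have "(\<lambda>z. l z + c * h z) \<in> S"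
        by (intro closed_subspaceD(3,4)[OF S] lS h)
      then have "d \<le> (D (\<lambda>z. l z + c * h z))\<^sup>2" by (rule dle)
      then have "sqrt d \<le> D (\<lambda>z. l z + c * h z)"
        by (simp add: D_def L_two_norm_nonneg real_le_lsqrt)
      then show "L_two_norm M (\<lambda>z. f z - l z) \<le> L_two_norm M (\<lambda>z. f z - l z - c * h z)"
        using Dl by (simp add: D_def diff_diff_eq)
    qed
  qed
qed

text \<open>Two sources of closed subspaces: closures of linear sets, and annihilators.\<close>

lemma closed_subspace_closure:
  assumes V: "V \<subseteq> L_two M" "(\<lambda>z. 0) \<in> V"
    "\<And>f g. f \<in> V \<Longrightarrow> g \<in> V \<Longrightarrow> (\<lambda>z. f z + g z) \<in> V" "\<And>f c. f \<in> V \<Longrightarrow> (\<lambda>z. c * f z) \<in> V"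
  shows "closed_subspace M {f \<in> L_two M. \<forall>e>0. \<exists>v\<in>V. L_two_norm M (\<lambda>z. f z - v z) < e}"
  unfolding closed_subspace_def
proof (intro conjI ballI allI impI)
  let ?S = "{f \<in> L_two M. \<forall>e>0. \<exists>v\<in>V. L_two_norm M (\<lambda>z. f z - v z) < e}"
  show "?S \<subseteq> L_two M" by auto
  show "(\<lambda>z. 0) \<in> ?S"
    using V(2) by (auto simp: L_two_zero intro!: bexI[of _ "\<lambda>z. 0"] simp: L_two_norm_def)
  show "(\<lambda>z. f z + g z) \<in> ?S" if f: "f \<in> ?S" and g: "g \<in> ?S" for f g
  proof (intro CollectI conjI allI impI)
    show "(\<lambda>z. f z + g z) \<in> L_two M" using f g by (auto intro: L_two_add)
    fix e :: real assume "e > 0"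
    then have e2: "e/2 > 0" by simp
    obtain v where v: "v \<in> V" "L_two_norm M (\<lambda>z. f z - v z) < e/2"
      using f e2 by blast
    obtain w where w: "w \<in> V" "L_two_norm M (\<lambda>z. g z - w z) < e/2"
      using g e2 by blast
    have "L_two_norm M (\<lambda>z. (f z - v z) + (g z - w z)) \<le> L_two_norm M (\<lambda>z. f z - v z) + L_two_norm M (\<lambda>z. g z - w z)"
      using f g v w V(1) by (intro L_two_norm_triangle L_two_diff) auto
    then show "\<exists>v\<in>V. L_two_norm M (\<lambda>z. f z + g z - v z) < e"
      using v w V(3) by (intro bexI[of _ "\<lambda>z. v z + w z"]) (auto simp: algebra_simps)
  qed
  show "(\<lambda>z. c * f z) \<in> ?S" if f: "f \<in> ?S" for f c
  proof (intro CollectI conjI allI impI)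
    show "(\<lambda>z. c * f z) \<in> L_two M" using f by (auto intro: L_two_cmult)
    fix e :: real assume e: "e > 0"
    then have "e / (norm c + 1) > 0" by (simp add: add_nonneg_pos)
    then obtain v where v: "v \<in> V" "L_two_norm M (\<lambda>z. f z - v z) < e / (norm c + 1)"
      using f by auto
    have "L_two_norm M (\<lambda>z. c * (f z - v z)) = norm c * L_two_norm M (\<lambda>z. f z - v z)"
      by (rule L_two_norm_cmult)
    also have "\<dots> \<le> norm c * (e / (norm c + 1))"
      using v by (intro mult_left_mono) auto
    also have "\<dots> < e" using e by (simp add: field_simps add_pos_nonneg)
    finally show "\<exists>v\<in>V. L_two_norm M (\<lambda>z. c * f z - v z) < e"
      using v V(4) by (intro bexI[of _ "\<lambda>z. c * v z"]) (auto simp: algebra_simps)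
  qed
  show "f \<in> ?S" if f: "f \<in> L_two M" and ap: "\<forall>e>0. \<exists>g\<in>?S. L_two_norm M (\<lambda>z. f z - g z) < e" for f
  proof (intro CollectI conjI allI impI f)
    fix e :: real assume "e > 0"
    then have e2: "e / 2 > 0" by simp
    obtain g where g: "g \<in> ?S" "L_two_norm M (\<lambda>z. f z - g z) < e/2" using ap e2 by meson
    then obtain v where v: "v \<in> V" "L_two_norm M (\<lambda>z. g z - v z) < e/2" using e2 by blast
    have "L_two_norm M (\<lambda>z. f z - v z) \<le> L_two_norm M (\<lambda>z. f z - g z) + L_two_norm M (\<lambda>z. g z - v z)"
      using f g v V(1) by (intro L_two_norm_triangle_diff) auto
    then show "\<exists>v\<in>V. L_two_norm M (\<lambda>z. f z - v z) < e"
      using g v by (intro bexI[of _ v]) auto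
  qed
qed

lemma integral_mult_zero_if_approx:
  assumes f: "f \<in> L_two M" and u: "u \<in> L_two M"
    and ap: "\<And>e. e > 0 \<Longrightarrow> \<exists>g\<in>L_two M. (LINT z|M. g z * u z) = 0 \<and> L_two_norm M (\<lambda>z. f z - g z) < e"
  shows "(LINT z|M. f z * u z) = 0"
proof (rule ccontr)
  assume n: "(LINT z|M. f z * u z) \<noteq> 0"
  define k where "k = L_two_norm M u"
  have k: "k \<ge> 0" by (simp add: k_def L_two_norm_nonneg)
  define e where "e = norm (LINT z|M. f z * u z) / (k + 1)"
  have "e > 0" using n k by (simp add: e_def)
  from ap[OF this] obtain g where g: "g \<in> L_two M" "(LINT z|M. g z * u z) = 0" "L_two_norm M (\<lambda>z. f z - g z) < e"
    by blast
  have "norm (LINT z|M. (f z - g z) * u z) \<le> L_two_norm M (\<lambda>z. f z - g z) * k"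
    unfolding k_def by (rule L_two_Cauchy_Schwarz[OF L_two_diff[OF f g(1)] u])
  also have "\<dots> \<le> e * k" using g k by (intro mult_right_mono) auto
  also have "\<dots> < norm (LINT z|M. f z * u z)" using n k by (simp add: e_def field_simps)
  also have "(LINT z|M. f z * u z) = (LINT z|M. (f z - g z) * u z)"
    using g(2) by (simp add: left_diff_distrib integrable_L_two_mult f g(1) u)
  finally show False by simp
qed

lemma closed_subspace_annihilator:
  assumes U: "U \<subseteq> L_two M"
  shows "closed_subspace M {f \<in> L_two M. \<forall>u\<in>U. (LINT z|M. f z * u z) = 0}"
  unfolding closed_subspace_def
proof (intro conjI ballI allI impI)
  let ?S = "{f \<in> L_two M. \<forall>u\<in>U. (LINT z|M. f z * u z) = 0}"
  show "?S \<subseteq> L_two M" "(\<lambda>z. 0) \<in> ?S" by (auto simp: L_two_zero)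
  show "(\<lambda>z. f z + g z) \<in> ?S" if "f \<in> ?S" "g \<in> ?S" for f g
    using that U by (auto simp: distrib_right L_two_add integrable_L_two_mult subset_iff)
  show "(\<lambda>z. c * f z) \<in> ?S" if "f \<in> ?S" for f c
    using that by (auto simp: L_two_cmult mult.assoc)
  show "f \<in> ?S" if f: "f \<in> L_two M" and ap: "\<forall>e>0. \<exists>g\<in>?S. L_two_norm M (\<lambda>z. f z - g z) < e" for f
  proof (intro CollectI conjI ballI f)
    fix u assume u: "u \<in> U"
    show "(LINT z|M. f z * u z) = 0"
    proof (rule integral_mult_zero_if_approx[OF f])
      show "u \<in> L_two M" using u U by auto
      fix e :: real assume "e > 0"
      then show "\<exists>g\<in>L_two M. (LINT z|M. g z * u z) = 0 \<and> L_two_norm M (\<lambda>z. f z - g z) < e"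
        using ap u by blast
    qed
  qed
qed

section \<open>Fourier coefficients on the unit circle\<close>

interpretation circle: prob_space circle_measure
  by (rule prob_space_circle_measure)

lemma sets_circle_measure: "sets circle_measure = sets (restrict_space borel (sphere 0 1))"
  by (simp add: circle_measure_def)

lemma measurable_circle: "f \<in> borel_measurable borel \<Longrightarrow> f \<in> borel_measurable circle_measure"
  for f :: "complex \<Rightarrow> 'a :: topological_space"
  by (simp add: measurable_cong_sets[OF sets_circle_measure refl] measurable_restrict_space1)

lemma measurable_circle_continuous:
  "continuous_on (sphere 0 1) f \<Longrightarrow> f \<in> borel_measurable circle_measure"
  for f :: "complex \<Rightarrow> 'a :: topological_space"
  by (simp add: measurable_cong_sets[OF sets_circle_measure refl] borel_measurable_continuous_on_restrict)

lemma AE_circle_norm: "AE z in circle_measure. norm z = 1"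
  by (rule AE_I2) (simp add: space_circle_measure)

lemma measurable_powi [measurable]: "(\<lambda>z :: complex. z powi k) \<in> borel_measurable borel"
  by (cases "k \<ge> 0") (auto simp: power_int_def[abs_def])

lemma norm_powi_circle: "norm z = 1 \<Longrightarrow> norm (z powi k) = 1" for z :: complex
  by (simp add: norm_power_int)

lemma cnj_powi_circle:
  assumes "norm z = 1"
  shows "cnj (z powi k) = z powi (- k)"
proof -
  have "z * cnj z = 1" using assms by (simp add: complex_norm_square[symmetric])
  then have "inverse z = cnj z" by (rule inverse_unique)
  then show ?thesis by (simp add: power_int_minus flip: power_int_inverse)
qed

lemma Fourier_zero:
  "AE z in circle_measure. f z = 0 \<Longrightarrow> (LINT z|circle_measure. f z * z powi k) = 0"
  by (intro integral_eq_zero_AE) (auto elim: eventually_mono)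

lemma integrable_circle_bounded_mult:
  fixes f b :: "complex \<Rightarrow> complex"
  assumes f: "integrable circle_measure f" and b: "b \<in> borel_measurable circle_measure"
    and B: "\<And>z. norm z = 1 \<Longrightarrow> norm (b z) \<le> B"
  shows "integrable circle_measure (\<lambda>z. f z * b z)"
proof -
  note [measurable] = b borel_measurable_integrable[OF f]
  have "integrable circle_measure (\<lambda>z. B * norm (f z))" using f by simp
  then show ?thesis
  proof (rule Bochner_Integration.integrable_bound)
    show "AE z in circle_measure. norm (f z * b z) \<le> norm (B * norm (f z))"
      using AE_circle_norm
    proof eventually_elim
      case (elim z)
      have "norm (f z * b z) \<le> B * norm (f z)"
        using mult_right_mono[OF B[OF elim] norm_ge_zero[of "f z"]] by (simp add: norm_mult mult.commute)
      also have "\<dots> \<le> norm (B * norm (f z))" by simp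
      finally show ?case .
    qed
  qed measurable
qed

lemma integrable_circle_powi:
  "integrable circle_measure f \<Longrightarrow> integrable circle_measure (\<lambda>z. f z * z powi k)"
  for f :: "complex \<Rightarrow> complex"
  by (rule integrable_circle_bounded_mult[where B = 1])
     (auto intro!: measurable_circle simp: norm_powi_circle)

lemma integrable_circle_continuous_mult:
  fixes f b :: "complex \<Rightarrow> complex"
  assumes f: "integrable circle_measure f" and b: "continuous_on (sphere 0 1) b"
  shows "integrable circle_measure (\<lambda>z. f z * b z)"
proof -
  have "compact (b ` sphere 0 1)" by (intro compact_continuous_image b) auto
  then obtain B where "\<forall>z\<in>sphere 0 1. norm (b z) \<le> B"
    using compact_imp_bounded bounded_iff by (metis imageI)
  then show ?thesis
    by (intro integrable_circle_bounded_mult[OF f, where B = B] measurable_circle_continuous[OF b]) auto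
qed

lemma integral_circle_measure:
  fixes g :: "complex \<Rightarrow> complex"
  assumes g: "g \<in> borel_measurable circle_measure"
  shows "(LINT z|circle_measure. g z) = (LINT t|lborel. indicator {0..2*pi} t *\<^sub>R g (cis t)) / (2 * pi)"
proof -
  have g': "g \<in> borel_measurable (restrict_space borel (sphere 0 1))"
    using g by (simp add: measurable_cong_sets[OF sets_circle_measure refl])
  have mg: "(\<lambda>t. g (cis t)) \<in> borel_measurable lborel"
    using measurable_compose[OF measurable_cis_sphere g'] by simp
  have "(LINT z|circle_measure. g z) = (LINT t|uniform_measure lborel {0..2 * pi}. g (cis t))"
    unfolding circle_measure_def by (rule integral_distr[OF measurable_cis_sphere g'])
  also have "uniform_measure lborel {0..2 * pi} = density lborel (\<lambda>t. ennreal (indicator {0..2*pi} t / (2*pi)))"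
    unfolding uniform_measure_def
    by (rule density_cong) (auto simp: divide_ennreal[symmetric] split: split_indicator)
  also have "(LINT t|\<dots>. g (cis t)) = (LINT t|lborel. (indicator {0..2*pi} t / (2*pi)) *\<^sub>R g (cis t))"
    by (rule integral_density) (use mg in auto)
  also have "\<dots> = (LINT t|lborel. (indicator {0..2*pi} t *\<^sub>R g (cis t)) / (2*pi))"
    by (rule Bochner_Integration.integral_cong) (auto simp: scaleR_conv_of_real)
  finally show ?thesis by simp
qed

lemma cis_powi: "cis t powi k = cis (of_int k * t)"
  by (cases "k \<ge> 0") (auto simp: power_int_def Complex.DeMoivre cis_inverse)

lemma integral_circle_powi: "(LINT z|circle_measure. z powi k) = (if k = 0 then 1 else 0)"
proof (cases "k = 0")
  case True
  then show ?thesis using circle.prob_space by simp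
next
  case False
  have "((\<lambda>t. cis (of_int k * t) / (\<i> * of_int k)) has_vector_derivative cis (of_int k * t)) (at t within {0..2*pi})" for t
  proof -
    have "((\<lambda>t. exp (\<i> * of_int k * complex_of_real t) / (\<i> * of_int k)) has_vector_derivative exp (\<i> * of_int k * complex_of_real t)) (at t within {0..2*pi})"
      using False
      by (auto intro!: derivative_eq_intros has_vector_derivative_real_field simp: field_simps)
    then show ?thesis by (simp add: cis_conv_exp mult_ac)
  qed
  then have "(LINT t|lborel. indicator {0..2*pi} t *\<^sub>R cis (of_int k * t))
      = cis (of_int k * (2 * pi)) / (\<i> * of_int k) - cis (of_int k * 0) / (\<i> * of_int k)"
    by (intro integral_FTC_Icc) (auto intro!: continuous_intros)
  also have "cis (of_int k * (2 * pi)) = 1"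
    by (metis cis_multiple_2pi Ints_of_int mult.commute)
  finally show ?thesis
    using False by (subst integral_circle_measure) (auto simp: cis_powi intro!: measurable_circle)
qed

text \<open>The circle has no atoms, since each point has only countably many arguments.\<close>

lemma AE_circle_neq: "AE z in circle_measure. z \<noteq> x"
proof -
  have "countable {t. cis t = x}"
  proof (cases "\<exists>s. cis s = x")
    case True
    then obtain s where s: "cis s = x" by blast
    have "{t. cis t = x} \<subseteq> range (\<lambda>k::int. s + 2 * pi * of_int k)"
    proof
      fix t assume "t \<in> {t. cis t = x}"
      then have "sin t = sin s \<and> cos t = cos s"
        using s by (metis mem_Collect_eq cis.sel)
      then obtain k :: int where "t = s + 2 * pi * of_int k"
        by (auto simp: sin_cos_eq_iff)
      then show "t \<in> range (\<lambda>k::int. s + 2 * pi * of_int k)" by auto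
    qed
    then show ?thesis by (rule countable_subset) auto
  qed auto
  then have "AE t in lborel. t \<notin> {t. cis t = x}"
    by (intro AE_not_in countable_imp_null_set_lborel)
  then have "AE t in uniform_measure lborel {0..2*pi}. cis t \<noteq> x"
    by (intro AE_uniform_measureI) (auto elim: eventually_mono)
  moreover have "{z \<in> space (restrict_space borel (sphere 0 1)). z \<noteq> x} \<in> sets (restrict_space borel (sphere 0 1))"
    by (auto simp: sets_restrict_space space_restrict_space intro!: image_eqI[of _ _ "- {x}"])
  ultimately show ?thesis
    unfolding circle_measure_def by (subst AE_distr_iff[OF measurable_cis_sphere]) auto
qed

text \<open>
  Let all Fourier coefficients of \<open>f\<close> be zero.  The functions \<open>p\<close> for which this remains true of \<open>p f\<close>
  include all polynomials in \<open>Re z\<close> and \<open>Im z\<close>, because on the circle \<open>Re z = (z + 1/z)/2\<close> and \<open>Im z = (z - 1/z)/(2\<i>)\<close>;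
  by Stone--Weierstrass \<open>f\<close> is then orthogonal to all continuous functions, and by dominated convergence
  to the indicators of closed sets, which generate the Borel sets.
\<close>

lemma real_polynomial_mult_no_Fourier_coefficients:
  fixes f :: "complex \<Rightarrow> complex"
  assumes "real_polynomial_function p" "integrable circle_measure f" "\<And>k. (LINT z|circle_measure. f z * z powi k) = 0"
  shows "integrable circle_measure (\<lambda>z. f z * of_real (p z)) \<and>
    (\<forall>k. (LINT z|circle_measure. (f z * of_real (p z)) * z powi k) = 0)"
  using assms
proof (induction arbitrary: f rule: real_polynomial_function.induct)
  case (linear p)
  define a where "a = (of_real (p 1) - \<i> * of_real (p \<i>)) / 2"
  define b where "b = (of_real (p 1) + \<i> * of_real (p \<i>)) / 2"
  have p: "of_real (p z) = a * z powi 1 + b * z powi (-1)" if "norm z = 1" for z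
  proof -
    have "z = Re z *\<^sub>R 1 + Im z *\<^sub>R \<i>"
      by (simp add: complex_eq_iff)
    then have "p z = p (Re z *\<^sub>R 1 + Im z *\<^sub>R \<i>)" by (rule arg_cong)
    also have "\<dots> = Re z * p 1 + Im z * p \<i>"
      by (simp add: linear_simps[OF linear(1)])
    finally have pz: "p z = Re z * p 1 + Im z * p \<i>" .
    have "z * cnj z = 1" using that by (simp add: complex_norm_square[symmetric])
    then have inv: "z powi (-1) = cnj z" by (simp add: power_int_minus inverse_unique)
    show ?thesis
      unfolding pz a_def b_def inv power_int_1_right by (auto simp: complex_eq_iff field_simps)
  qed
  have i: "integrable circle_measure (\<lambda>z. f z * z powi k)" for k
    using linear by (intro integrable_circle_powi)
  have eq: "(f z * of_real (p z)) * z powi k = a * (f z * z powi (k + 1)) + b * (f z * z powi (k - 1))" if "norm z = 1" for z k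
  proof -
    have "z \<noteq> 0" using that by auto
    then show ?thesis unfolding p[OF that]
      by (simp add: power_int_add power_int_diff power_int_minus field_simps)
  qed
  have i2: "integrable circle_measure (\<lambda>z. f z * of_real (p z))"
    using linear by (intro integrable_circle_continuous_mult continuous_intros linear_continuous_on)
  have "(LINT z|circle_measure. (f z * of_real (p z)) * z powi k) = 0" for k
  proof -
    have "(LINT z|circle_measure. (f z * of_real (p z)) * z powi k)
        = (LINT z|circle_measure. a * (f z * z powi (k + 1)) + b * (f z * z powi (k - 1)))"
      by (rule Bochner_Integration.integral_cong) (auto simp: space_circle_measure eq)
    then show ?thesis using linear(3) i by simp
  qed
  then show ?case using i2 by auto
next
  case (const c)
  have "(f z * of_real c) * z powi k = of_real c * (f z * z powi k)" for z k by simp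
  then show ?case using const by (simp only:) auto
next
  case (add p q)
  then show ?case
    using integrable_circle_powi[of "\<lambda>z. f z * of_real (p z)"] integrable_circle_powi[of "\<lambda>z. f z * of_real (q z)"]
    by (simp add: distrib_left distrib_right)
next
  case (mult p q)
  have "integrable circle_measure (\<lambda>z. (f z * of_real (p z)) * of_real (q z)) \<and>
    (\<forall>k. (LINT z|circle_measure. ((f z * of_real (p z)) * of_real (q z)) * z powi k) = 0)"
    using mult.IH(1)[OF mult.prems] by (intro mult.IH(2)) auto
  then show ?case by (simp add: mult.assoc)
qed

lemma continuous_mult_no_mean:
  fixes f :: "complex \<Rightarrow> complex" and g :: "complex \<Rightarrow> real"
  assumes f: "integrable circle_measure f" "\<And>k. (LINT z|circle_measure. f z * z powi k) = 0"
    and g: "continuous_on (sphere 0 1) g"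
  shows "(LINT z|circle_measure. f z * of_real (g z)) = 0"
proof (rule ccontr)
  assume n: "(LINT z|circle_measure. f z * of_real (g z)) \<noteq> 0"
  define I where "I = (LINT z|circle_measure. norm (f z))"
  have I: "I \<ge> 0" by (simp add: I_def)
  define e where "e = norm (LINT z|circle_measure. f z * of_real (g z)) / (I + 1)"
  have e: "e > 0" using n I by (simp add: e_def)
  obtain p where p: "real_polynomial_function p" "\<And>z. z \<in> sphere 0 1 \<Longrightarrow> \<bar>g z - p z\<bar> < e"
    using Stone_Weierstrass_real_polynomial_function[OF compact_sphere g e] by metis
  have pf: "integrable circle_measure (\<lambda>z. f z * of_real (p z))" "(LINT z|circle_measure. f z * of_real (p z)) = 0"
    using real_polynomial_mult_no_Fourier_coefficients[OF p(1) f] by (auto dest: spec[of _ 0])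
  have ig: "integrable circle_measure (\<lambda>z. f z * of_real (g z))"
    by (intro integrable_circle_continuous_mult f continuous_intros g)
  have "(LINT z|circle_measure. f z * of_real (g z)) = (LINT z|circle_measure. f z * of_real (g z) - f z * of_real (p z))"
    using pf ig by simp
  also have "norm \<dots> \<le> (LINT z|circle_measure. e * norm (f z))"
  proof (rule Bochner_Integration.integral_norm_bound_integral)
    show "integrable circle_measure (\<lambda>z. f z * of_real (g z) - f z * of_real (p z))" "integrable circle_measure (\<lambda>z. e * norm (f z))"
      using ig pf f by auto
    show "norm (f z * of_real (g z) - f z * of_real (p z)) \<le> e * norm (f z)" if "z \<in> space circle_measure" for z
    proof -
      have "norm (f z * of_real (g z) - f z * of_real (p z)) = norm (f z) * \<bar>g z - p z\<bar>"
        by (simp flip: right_diff_distrib of_real_diff add: norm_mult)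
      also have "\<dots> \<le> norm (f z) * e"
        using p(2)[of z] that by (intro mult_left_mono) (auto simp: space_circle_measure)
      finally show ?thesis by (simp add: mult.commute)
    qed
  qed
  also have "(LINT z|circle_measure. e * norm (f z)) = e * I" by (simp add: I_def)
  also have "\<dots> < norm (LINT z|circle_measure. f z * of_real (g z))" using n I by (simp add: e_def field_simps)
  finally show False by simp
qed

theorem Fourier_uniqueness:
  fixes f :: "complex \<Rightarrow> complex"
  assumes f: "integrable circle_measure f" and 0: "\<And>k. (LINT z|circle_measure. f z * z powi k) = 0"
  shows "AE z in circle_measure. f z = 0"
proof (rule circle.density_zero[OF f])
  have ind: "integrable circle_measure (\<lambda>z. f z * of_real (indicator A z))" if "A \<in> sets borel" for A
    using that by (intro integrable_circle_bounded_mult[OF f, where B = 1])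
      (auto intro!: measurable_circle borel_measurable_of_real simp: indicator_def)
  have closed: "(LINT z|circle_measure. f z * of_real (indicator K z)) = 0" if K: "closed K" "K \<noteq> {}" for K
  proof -
    define g where "g n z = max 0 (1 - of_nat n * infdist z K)" for n :: nat and z :: complex
    have gc: "continuous_on A (g n)" for n A
      unfolding g_def by (intro continuous_intros)
    have lim: "(\<lambda>n. g n z) \<longlonglongrightarrow> indicator K z" for z
    proof (cases "z \<in> K")
      case True
      then show ?thesis by (simp add: g_def)
    next
      case False
      then have pos: "infdist z K > 0"
        using in_closed_iff_infdist_zero[OF K] infdist_nonneg[of z K] by (metis less_eq_real_def)
      obtain N where N: "1 / infdist z K < of_nat N" using reals_Archimedean2 by blast
      have "g n z = 0" if "n \<ge> N" for n
      proof -
        have "1 / infdist z K \<le> of_nat n" using N that by simp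
        then have "1 \<le> of_nat n * infdist z K" using pos by (simp add: field_simps)
        then show ?thesis by (simp add: g_def)
      qed
      then have "\<forall>\<^sub>F n in sequentially. g n z = 0" by (auto simp: eventually_sequentially)
      then show ?thesis using False by (simp add: tendsto_eventually)
    qed
    have "(\<lambda>n. LINT z|circle_measure. f z * of_real (g n z)) \<longlonglongrightarrow> (LINT z|circle_measure. f z * of_real (indicator K z))"
    proof (rule integral_dominated_convergence[where w = "\<lambda>z. norm (f z)"])
      show "AE z in circle_measure. (\<lambda>n. f z * of_real (g n z)) \<longlonglongrightarrow> f z * of_real (indicator K z)"
        by (intro AE_I2 tendsto_intros lim)
      show "AE z in circle_measure. norm (f z * of_real (g n z)) \<le> norm (f z)" for n
        by (intro AE_I2) (auto simp: g_def norm_mult infdist_nonneg intro!: mult_left_le)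
      show "(\<lambda>z. f z * of_real (g n z)) \<in> borel_measurable circle_measure" for n
        by (intro borel_measurable_times borel_measurable_integrable[OF f] measurable_circle_continuous continuous_intros gc)
      show "(\<lambda>z. f z * of_real (indicator K z)) \<in> borel_measurable circle_measure"
        using ind[of K] K by (auto intro: borel_measurable_integrable)
    qed (use f in auto)
    then show ?thesis
      using continuous_mult_no_mean[OF f 0 gc] LIMSEQ_unique[OF tendsto_const] by fastforce
  qed
  have borel: "(LINT z|circle_measure. f z * of_real (indicator A z)) = 0" if "A \<in> sets borel" for A
  proof -
    have "A \<in> sigma_sets UNIV (Collect closed)" using that by (simp add: borel_eq_closed)
    have "Int_stable (Collect (closed :: complex set \<Rightarrow> bool))" by (auto simp: Int_stable_def)
    moreover have "Collect closed \<subseteq> Pow (UNIV :: complex set)" by simp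
    ultimately show ?thesis
      using \<open>A \<in> sigma_sets UNIV (Collect closed)\<close>
    proof (induction rule: sigma_sets_induct_disjoint)
      case (basic A)
      then show ?case using closed[of A] by (cases "A = {}") auto
    next
      case empty
      then show ?case by simp
    next
      case (compl A)
      then have A: "A \<in> sets borel" by (simp add: borel_eq_closed)
      have "f z * of_real (indicator (UNIV - A) z) = f z * z powi 0 - f z * of_real (indicator A z)" for z
        by (auto simp: indicator_def)
      then show ?case using compl 0[of 0] f ind[OF A] by simp
    next
      case (union A)
      then have A: "A i \<in> sets borel" for i by (auto simp: borel_eq_closed)
      have conv: "(LINT z|circle_measure. f z * of_real (indicator X z)) = (LINT z:X \<inter> sphere 0 1|circle_measure. f z)" for X
        unfolding set_lebesgue_integral_def
        by (rule Bochner_Integration.integral_cong) (auto simp: space_circle_measure indicator_def)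
      have AS: "X \<inter> sphere 0 1 \<in> sets circle_measure" if "X \<in> sets borel" for X
        using that by (auto simp: sets_circle_measure sets_restrict_space)
      have "(LINT z:(\<Union>i. A i \<inter> sphere 0 1)|circle_measure. f z) = (\<Sum>i. (LINT z:(A i \<inter> sphere 0 1)|circle_measure. f z))"
        using A union(1) f unfolding set_integrable_def
        by (intro lebesgue_integral_countable_add AS)
           (auto simp: disjoint_family_on_def set_integrable_def intro!: integrable_mult_indicator AS sets.countable_UN)
      also have "\<dots> = 0"
        using union(3) by (simp add: conv)
      finally show ?case by (simp add: conv)
    qed
  qed
  fix A assume "A \<in> sets circle_measure"
  then obtain B where B: "B \<in> sets borel" "A = B \<inter> sphere 0 1"
    by (auto simp: sets_circle_measure sets_restrict_space)
  have "(LINT z|circle_measure. indicator A z *\<^sub>R f z) = (LINT z|circle_measure. f z * of_real (indicator B z))"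
    by (rule Bochner_Integration.integral_cong) (auto simp: space_circle_measure B indicator_def)
  then show "set_lebesgue_integral circle_measure A f = 0"
    using borel[OF B(1)] by (simp add: set_lebesgue_integral_def)
qed

section \<open>The boundary of the annulus\<close>

locale annulus_radius =
  fixes R :: real
  assumes R: "0 < R" "R < 1"
begin

abbreviation \<sigma> :: "complex measure" where "\<sigma> \<equiv> boundary_measure R"

lemma space_boundary: "space \<sigma> = annulus_boundary R"
  by (simp add: boundary_measure_def space_restrict_space)

lemma sets_boundary: "sets \<sigma> = sets (restrict_space borel (annulus_boundary R))"
  by (simp add: boundary_measure_def)

lemma measurable_boundary: "f \<in> borel_measurable borel \<Longrightarrow> f \<in> borel_measurable \<sigma>"
  for f :: "complex \<Rightarrow> 'a :: topological_space"
  by (simp add: measurable_cong_sets[OF sets_boundary refl] measurable_restrict_space1)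

lemma measurable_boundary_continuous:
  "continuous_on (annulus_boundary R) f \<Longrightarrow> f \<in> borel_measurable \<sigma>"
  for f :: "complex \<Rightarrow> 'a :: topological_space"
  by (simp add: measurable_cong_sets[OF sets_boundary refl] borel_measurable_continuous_on_restrict)

lemma annulus_boundary_norm: "z \<in> annulus_boundary R \<longleftrightarrow> norm z = 1 \<or> norm z = R"
  by (auto simp: annulus_boundary_def)

lemma measurable_id_outer: "(\<lambda>z. z) \<in> circle_measure \<rightarrow>\<^sub>M \<sigma>"
proof -
  have "(\<lambda>z. z) \<in> restrict_space borel (sphere (0::complex) 1) \<rightarrow>\<^sub>M restrict_space borel (annulus_boundary R)"
    by (rule measurable_restrict_space3) (auto simp: annulus_boundary_norm)
  then show ?thesis
    by (simp add: measurable_cong_sets[OF sets_circle_measure sets_boundary])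
qed

lemma measurable_scale_inner: "(\<lambda>z. of_real R * z) \<in> circle_measure \<rightarrow>\<^sub>M \<sigma>"
proof -
  have "(\<lambda>z. of_real R * z) \<in> restrict_space borel (sphere (0::complex) 1) \<rightarrow>\<^sub>M restrict_space borel (annulus_boundary R)"
    by (rule measurable_restrict_space3) (use R in \<open>auto simp: annulus_boundary_norm norm_mult\<close>)
  then show ?thesis
    by (simp add: measurable_cong_sets[OF sets_circle_measure sets_boundary])
qed

lemma measurable_outer: "f \<in> \<sigma> \<rightarrow>\<^sub>M N \<Longrightarrow> f \<in> circle_measure \<rightarrow>\<^sub>M N"
  by (rule measurable_compose[OF measurable_id_outer, of f N])

lemma measurable_inner: "f \<in> \<sigma> \<rightarrow>\<^sub>M N \<Longrightarrow> (\<lambda>z. f (of_real R * z)) \<in> circle_measure \<rightarrow>\<^sub>M N"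
  by (rule measurable_compose[OF measurable_scale_inner])

lemma nn_integral_boundary:
  assumes f: "f \<in> borel_measurable \<sigma>"
  shows "(\<integral>\<^sup>+z. f z \<partial>\<sigma>) = (\<integral>\<^sup>+z. f z \<partial>circle_measure) + (\<integral>\<^sup>+z. f (of_real R * z) \<partial>circle_measure)"
proof -
  have m: "(\<lambda>(r, z). of_real r * z) \<in> (count_space {1, R} \<Otimes>\<^sub>M circle_measure) \<rightarrow>\<^sub>M restrict_space borel (annulus_boundary R)"
    using measurable_boundary_map R by simp
  have f': "f \<in> borel_measurable (restrict_space borel (annulus_boundary R))"
    using f by (simp add: measurable_cong_sets[OF sets_boundary refl])
  have "(\<integral>\<^sup>+z. f z \<partial>\<sigma>) = (\<integral>\<^sup>+x. f (case x of (r, z) \<Rightarrow> of_real r * z) \<partial>(count_space {1, R} \<Otimes>\<^sub>M circle_measure))"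
    unfolding boundary_measure_def by (rule nn_integral_distr[OF m f[unfolded boundary_measure_def]])
  also have "\<dots> = (\<integral>\<^sup>+r. \<integral>\<^sup>+z. f (case (r, z) of (r, z) \<Rightarrow> of_real r * z) \<partial>circle_measure \<partial>count_space {1, R})"
    by (rule circle.nn_integral_fst[symmetric]) (rule measurable_compose[OF m f'])
  also have "\<dots> = (\<integral>\<^sup>+z. f z \<partial>circle_measure) + (\<integral>\<^sup>+z. f (of_real R * z) \<partial>circle_measure)"
    using R by (subst nn_integral_count_space_finite) auto
  finally show ?thesis .
qed

sublocale boundary: finite_measure \<sigma>
proof
  have "emeasure \<sigma> (space \<sigma>) = (\<integral>\<^sup>+z. 1 \<partial>\<sigma>)" by simp
  also have "\<dots> = 1 + 1"
    by (subst nn_integral_boundary) (auto simp: circle.emeasure_space_1)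
  finally show "emeasure \<sigma> (space \<sigma>) \<noteq> \<infinity>" by simp
qed

lemma integrable_boundary_iff:
  fixes f :: "complex \<Rightarrow> 'b :: {banach, second_countable_topology}"
  assumes f: "f \<in> borel_measurable \<sigma>"
  shows "integrable \<sigma> f \<longleftrightarrow> integrable circle_measure f \<and> integrable circle_measure (\<lambda>z. f (of_real R * z))"
proof -
  have "(\<integral>\<^sup>+z. ennreal (norm (f z)) \<partial>\<sigma>) = (\<integral>\<^sup>+z. ennreal (norm (f z)) \<partial>circle_measure) + (\<integral>\<^sup>+z. ennreal (norm (f (of_real R * z))) \<partial>circle_measure)"
    using f by (intro nn_integral_boundary) auto
  then show ?thesis
    using f measurable_outer[OF f] measurable_inner[OF f] by (simp add: integrable_iff_bounded)
qed

lemma integral_boundary: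
  fixes f :: "complex \<Rightarrow> complex"
  assumes f: "integrable \<sigma> f"
  shows "(LINT z|\<sigma>. f z) = (LINT z|circle_measure. f z) + (LINT z|circle_measure. f (of_real R * z))"
proof -
  have fm: "f \<in> borel_measurable \<sigma>" using f by auto
  show ?thesis
    unfolding integral_circle_measure[OF measurable_outer[OF fm]] integral_circle_measure[OF measurable_inner[OF fm]]
    using integral_boundary_measure[OF R f] by (simp add: set_lebesgue_integral_def)
qed

lemma AE_boundary_iff:
  assumes P: "Measurable.pred \<sigma> P"
  shows "(AE z in \<sigma>. P z) \<longleftrightarrow> (AE z in circle_measure. P z) \<and> (AE z in circle_measure. P (of_real R * z))"
proof -
  define g :: "complex \<Rightarrow> ennreal" where "g z = (if P z then 0 else 1)" for z
  have g: "g \<in> borel_measurable \<sigma>" unfolding g_def using P by measurable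
  have ae: "(AE z in M. P (h z)) \<longleftrightarrow> (\<integral>\<^sup>+z. g (h z) \<partial>M) = 0" if "(\<lambda>z. g (h z)) \<in> borel_measurable M" for M :: "complex measure" and h
    using that by (subst nn_integral_0_iff_AE) (auto simp: g_def)
  show ?thesis
    using ae[of "\<lambda>z. z" \<sigma>] ae[of "\<lambda>z. z" circle_measure] ae[of "\<lambda>z. of_real R * z" circle_measure]
      g measurable_outer[OF g] measurable_inner[OF g] nn_integral_boundary[OF g] by simp
qed

lemma AE_boundaryD:
  assumes "AE z in \<sigma>. P z"
  shows "AE z in circle_measure. P z" "AE z in circle_measure. P (of_real R * z)"
proof -
  obtain N where N: "N \<in> null_sets \<sigma>" "{z \<in> space \<sigma>. \<not> P z} \<subseteq> N"
    using assms by (auto simp: eventually_ae_filter)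
  have "Measurable.pred \<sigma> (\<lambda>z. z \<notin> N)" using N(1) by (intro pred_intros_logic pred_sets1) auto
  moreover have "AE z in \<sigma>. z \<notin> N" using N(1) by (rule AE_not_in)
  ultimately have "(AE z in circle_measure. z \<notin> N) \<and> (AE z in circle_measure. of_real R * z \<notin> N)"
    by (simp add: AE_boundary_iff)
  then have a: "AE z in circle_measure. z \<notin> N" "AE z in circle_measure. of_real R * z \<notin> N" by auto
  have P: "P z" if "z \<notin> N" "norm z = 1 \<or> norm z = R" for z
    using that N(2) by (auto simp: space_boundary annulus_boundary_norm)
  show "AE z in circle_measure. P z"
    using a(1) AE_circle_norm by eventually_elim (simp add: P)
  show "AE z in circle_measure. P (of_real R * z)"
    using a(2) AE_circle_norm by eventually_elim (use R in \<open>simp add: P norm_mult\<close>)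
qed

lemma integrable_boundaryD:
  fixes f :: "complex \<Rightarrow> complex"
  assumes "integrable \<sigma> f"
  shows "integrable circle_measure f" "integrable circle_measure (\<lambda>z. f (of_real R * z))"
  using integrable_boundary_iff[of f] assms by auto

lemma L_two_integrable: "f \<in> L_two \<sigma> \<Longrightarrow> integrable \<sigma> f"
  using integrable_L_two_mult[OF _ boundary.L_two_const[of 1], of f] by simp

lemma AE_boundary_zero_iff:
  fixes f :: "complex \<Rightarrow> complex"
  assumes "f \<in> borel_measurable \<sigma>"
  shows "(AE z in \<sigma>. f z = 0) \<longleftrightarrow> (AE z in circle_measure. f z = 0) \<and> (AE z in circle_measure. f (of_real R * z) = 0)"
proof (rule AE_boundary_iff)
  note [measurable] = assms
  show "Measurable.pred \<sigma> (\<lambda>z. f z = 0)" by measurable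
qed

lemma continuous_on_boundary_L_infinity:
  assumes "continuous_on (annulus_boundary R) f"
  shows "f \<in> L_infinity \<sigma>"
proof -
  have "compact (f ` annulus_boundary R)"
    using assms by (intro compact_continuous_image) (auto simp: annulus_boundary_def)
  then obtain B where "\<forall>z\<in>annulus_boundary R. norm (f z) \<le> B"
    using compact_imp_bounded bounded_iff by (metis imageI)
  then have "AE z in \<sigma>. norm (f z) \<le> B"
    by (intro AE_I2) (auto simp: space_boundary)
  then show ?thesis using measurable_boundary_continuous[OF assms] by (auto simp: L_infinity_def)
qed

lemma nonzero_boundary: "z \<in> annulus_boundary R \<Longrightarrow> z \<noteq> 0"
  using R by (auto simp: annulus_boundary_norm)

lemma powi_L_infinity: "(\<lambda>z. z powi k) \<in> L_infinity \<sigma>"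
  using nonzero_boundary by (intro continuous_on_boundary_L_infinity continuous_intros) auto

subsection \<open>The orthogonal complement of the Hardy space\<close>

text \<open>
  The function \<open>orientation\<close> records that the inner circle is traversed clockwise as part of the
  oriented boundary of the annulus: the measure \<open>z orientation(z) d\<sigma>(z)\<close> is \<open>dz / (2\<pi>\<i>)\<close>
  on that boundary.  The class below consists of the functions annihilated by the measures
  \<open>z\<^sup>k dz\<close> with integral \<open>k\<close>.  It contains the Hardy space by Cauchy's theorem.
\<close>

definition orientation :: "complex \<Rightarrow> complex" where
  "orientation z = (if norm z = 1 then 1 else - 1)"

definition cauchy_class :: "(complex \<Rightarrow> complex) set" where
  "cauchy_class = {f \<in> L_two \<sigma>. \<forall>k::int. (LINT z|\<sigma>. f z * (orientation z * z powi k)) = 0}"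

lemma orientation_simps [simp]:
  "orientation z * orientation z = 1" "cnj (orientation z) = orientation z" "norm (orientation z) = 1"
  by (auto simp: orientation_def)

lemma orientation_L_infinity: "orientation \<in> L_infinity \<sigma>"
proof -
  have "orientation \<in> borel_measurable borel"
    unfolding orientation_def[abs_def] by measurable
  then show ?thesis
    by (auto simp: L_infinity_def intro!: measurable_boundary exI[of _ 1])
qed

lemma L_infinity_mult:
  assumes "a \<in> L_infinity M" "b \<in> L_infinity M"
  shows "(\<lambda>z. a z * b z) \<in> L_infinity M"
proof -
  obtain A where A: "a \<in> borel_measurable M" "AE z in M. norm (a z) \<le> A"
    using assms by (auto elim: L_infinityD)
  obtain B where B: "b \<in> borel_measurable M" "AE z in M. norm (b z) \<le> B"
    using assms by (auto elim: L_infinityD)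
  have "AE z in M. norm (a z * b z) \<le> \<bar>A\<bar> * \<bar>B\<bar>"
    using A(2) B(2) by eventually_elim (auto simp: norm_mult intro!: mult_mono)
  then show ?thesis using A(1) B(1) by (auto simp: L_infinity_def)
qed

lemma orientation_powi_L_infinity: "(\<lambda>z. orientation z * z powi k) \<in> L_infinity \<sigma>"
  by (rule L_infinity_mult[OF orientation_L_infinity powi_L_infinity])

lemma closed_subspace_cauchy_class: "closed_subspace \<sigma> cauchy_class"
proof -
  have "cauchy_class = {f \<in> L_two \<sigma>. \<forall>u\<in>range (\<lambda>(k::int) z. orientation z * z powi k). (LINT z|\<sigma>. f z * u z) = 0}"
    by (auto simp: cauchy_class_def)
  then show ?thesis
    using closed_subspace_annihilator[of "range (\<lambda>(k::int) z. orientation z * z powi k)"]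
      boundary.L_infinity_L_two[OF orientation_powi_L_infinity] by auto
qed

lemma integral_boundary_orientation:
  assumes f: "integrable \<sigma> f"
  shows "(LINT z|\<sigma>. f z * (orientation z * z powi k))
    = (LINT z|circle_measure. f z * z powi k) - of_real R powi k * (LINT z|circle_measure. f (of_real R * z) * z powi k)"
proof -
  note [measurable] = borel_measurable_integrable[OF f]
  obtain B where B: "(\<lambda>z. orientation z * z powi k) \<in> borel_measurable \<sigma>"
    "AE z in \<sigma>. norm (orientation z * z powi k) \<le> B"
    using L_infinityD[OF orientation_powi_L_infinity[of k]] .
  have "integrable \<sigma> (\<lambda>z. B * norm (f z))" using f by simp
  then have "integrable \<sigma> (\<lambda>z. f z * (orientation z * z powi k))"
  proof (rule Bochner_Integration.integrable_bound)
    show "AE z in \<sigma>. norm (f z * (orientation z * z powi k)) \<le> norm (B * norm (f z))"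
      using B(2)
    proof eventually_elim
      case (elim z)
      have "norm (f z * (orientation z * z powi k)) \<le> B * norm (f z)"
        using mult_right_mono[OF elim norm_ge_zero[of "f z"]] by (simp add: norm_mult mult.commute)
      also have "\<dots> \<le> norm (B * norm (f z))" by simp
      finally show ?case .
    qed
  qed (use B in measurable)
  then have "(LINT z|\<sigma>. f z * (orientation z * z powi k))
    = (LINT z|circle_measure. f z * (orientation z * z powi k))
    + (LINT z|circle_measure. f (of_real R * z) * (orientation (of_real R * z) * (of_real R * z) powi k))"
    by (rule integral_boundary)
  also have "(LINT z|circle_measure. f z * (orientation z * z powi k)) = (LINT z|circle_measure. f z * z powi k)"
    by (rule Bochner_Integration.integral_cong) (auto simp: space_circle_measure orientation_def)
  also have "(LINT z|circle_measure. f (of_real R * z) * (orientation (of_real R * z) * (of_real R * z) powi k))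
    = (LINT z|circle_measure. (- (of_real R powi k)) * (f (of_real R * z) * z powi k))"
    using R by (intro Bochner_Integration.integral_cong)
      (auto simp: space_circle_measure orientation_def norm_mult power_int_mult_distrib)
  finally show ?thesis by simp
qed

lemma cauchy_class_iff:
  "f \<in> cauchy_class \<longleftrightarrow> f \<in> L_two \<sigma> \<and>
    (\<forall>k. (LINT z|circle_measure. f z * z powi k) = of_real R powi k * (LINT z|circle_measure. f (of_real R * z) * z powi k))"
  by (auto simp: cauchy_class_def integral_boundary_orientation L_two_integrable)

text \<open>
  The coefficients on one circle determine those on the other, so an element vanishing on one
  of the circles vanishes on both.
\<close>

lemma cauchy_class_zero_one_circle:
  assumes f: "f \<in> cauchy_class"
    and z: "(AE z in circle_measure. f z = 0) \<or> (AE z in circle_measure. f (of_real R * z) = 0)"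
  shows "AE z in \<sigma>. f z = 0"
proof -
  have f2: "f \<in> L_two \<sigma>" and
    c: "\<And>k. (LINT z|circle_measure. f z * z powi k) = of_real R powi k * (LINT z|circle_measure. f (of_real R * z) * z powi k)"
    using f by (auto simp: cauchy_class_iff)
  note i = integrable_boundaryD[OF L_two_integrable[OF f2]]
  have "(AE z in circle_measure. f z = 0) \<and> (AE z in circle_measure. f (of_real R * z) = 0)"
    using z
  proof
    assume a: "AE z in circle_measure. f z = 0"
    then have "AE z in circle_measure. f (of_real R * z) = 0"
      using c Fourier_zero[OF a] R by (intro Fourier_uniqueness i) (simp add: power_int_eq_0_iff)
    with a show ?thesis by simp
  next
    assume a: "AE z in circle_measure. f (of_real R * z) = 0"
    then have "AE z in circle_measure. f z = 0"
      using c Fourier_zero[OF a] by (intro Fourier_uniqueness i) simp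
    with a show ?thesis by simp
  qed
  then show ?thesis using AE_boundary_zero_iff[OF L_twoD(1)[OF f2]] by simp
qed

lemma contour_integral_circle_measure:
  assumes \<rho>: "0 < \<rho>" and f: "continuous_on (sphere 0 \<rho>) f"
  shows "contour_integral (circlepath 0 \<rho>) f = 2 * pi * \<i> * of_real \<rho> * (LINT z|circle_measure. f (of_real \<rho> * z) * z)"
proof -
  let ?g = "\<lambda>z. f (of_real \<rho> * z) * z"
  have c: "continuous_on (sphere 0 1) ?g"
    using \<rho> by (intro continuous_intros continuous_on_compose2[OF f]) (auto simp: norm_mult)
  have "continuous_on {0..2*pi} (\<lambda>t. ?g (cis t))"
    by (rule continuous_on_compose2[OF c, of _ cis]) (auto intro!: continuous_intros)
  then have si: "set_integrable lborel {0..2*pi} (\<lambda>t. ?g (cis t))"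
    by (rule borel_integrable_atLeastAtMost')
  have "contour_integral (circlepath 0 \<rho>) f = integral {0..2*pi} (\<lambda>t. f (0 + of_real \<rho> * cis t) * of_real \<rho> * \<i> * cis t)"
    unfolding circlepath_def by (rule contour_integral_part_circlepath_eq) simp
  also have "\<dots> = integral {0..2*pi} (\<lambda>t. (\<i> * of_real \<rho>) * ?g (cis t))"
    by (simp add: mult_ac)
  also have "\<dots> = \<i> * of_real \<rho> * integral {0..2*pi} (\<lambda>t. ?g (cis t))"
    by (rule integral_mult_right)
  also have "integral {0..2*pi} (\<lambda>t. ?g (cis t)) = (LINT t:{0..2*pi}|lborel. ?g (cis t))"
    using set_borel_integral_eq_integral(2)[OF si] by simp
  also have "\<dots> = 2 * pi * (LINT z|circle_measure. ?g z)"
    by (subst integral_circle_measure[OF measurable_circle_continuous[OF c]]) (simp add: set_lebesgue_integral_def)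
  finally show ?thesis by simp
qed

lemma closed_annulus_subset_closure:
  assumes "R \<le> norm z" "norm z \<le> 1"
  shows "z \<in> closure (annulus R)"
proof -
  have z: "z \<noteq> 0" using assms R by auto
  have "(\<lambda>t. of_real t * sgn z) ` closure {R<..<1} \<subseteq> closure ((\<lambda>t. of_real t * sgn z) ` {R<..<1})"
    by (intro image_closure_subset continuous_intros closed_closure closure_subset)
  also have "\<dots> \<subseteq> closure (annulus R)"
    using z R by (intro closure_mono) (auto simp: annulus_def norm_mult norm_sgn)
  finally have "of_real (norm z) * sgn z \<in> closure (annulus R)"
    using assms R by (auto simp: image_subset_iff)
  moreover have "of_real (norm z) * sgn z = z"
    using z by (simp add: sgn_div_norm scaleR_conv_of_real)
  ultimately show ?thesis by simp
qed

lemma rational_continuous: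
  assumes "r \<in> rational_no_poles (closure (annulus R))"
  shows "continuous_on (annulus_boundary R) r"
proof -
  obtain p q where pq: "\<forall>z\<in>closure (annulus R). poly q z \<noteq> 0" "r = (\<lambda>z. poly p z / poly q z)"
    using assms by (auto simp: rational_no_poles_def)
  have "poly q z \<noteq> 0" if "z \<in> annulus_boundary R" for z
    using that pq closed_annulus_subset_closure R by (auto simp: annulus_boundary_norm)
  then show ?thesis unfolding pq(2) by (intro continuous_intros) auto
qed

lemma rational_L_two:
  "r \<in> rational_no_poles (closure (annulus R)) \<Longrightarrow> r \<in> L_two \<sigma>"
  by (intro boundary.L_infinity_L_two continuous_on_boundary_L_infinity rational_continuous)

text \<open>
  The two boundary circles are homotopic through the concentric circles between them, on which
  the rational function has no poles.
\<close>

lemma rational_cauchy_class: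
  assumes r: "r \<in> rational_no_poles (closure (annulus R))"
  shows "r \<in> cauchy_class"
  unfolding cauchy_class_iff
proof (intro conjI allI)
  show "r \<in> L_two \<sigma>" by (rule rational_L_two[OF r])
  fix k :: int
  obtain p q where pq: "\<forall>z\<in>closure (annulus R). poly q z \<noteq> 0" "r = (\<lambda>z. poly p z / poly q z)"
    using r by (auto simp: rational_no_poles_def)
  define S where "S = - {z. poly q z * z = 0}"
  have "closed {z. poly q z * z = 0}"
    by (intro closed_Collect_eq continuous_intros)
  then have S: "open S" unfolding S_def by (rule open_Compl)
  have inS: "z \<in> S" if "R \<le> norm z" "norm z \<le> 1" for z
    using pq(1) closed_annulus_subset_closure[OF that] that R by (auto simp: S_def)
  define f where "f z = r z * z powi (k - 1)" for z
  have hol: "f holomorphic_on S"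
    unfolding f_def pq(2) S_def by (intro holomorphic_intros) auto
  have cont: "continuous_on (sphere 0 \<rho>) f" if "R \<le> \<rho>" "\<rho> \<le> 1" for \<rho>
    by (rule continuous_on_subset[OF holomorphic_on_imp_continuous_on[OF hol]]) (use inS that in auto)
  have "homotopic_loops S (circlepath 0 1) (circlepath 0 R)"
  proof (rule homotopic_loops_linear)
    fix t :: real
    let ?e = "exp (2 * of_real pi * \<i> * of_real t) :: complex"
    show "closed_segment (circlepath 0 1 t) (circlepath 0 R t) \<subseteq> S"
    proof
      fix w assume "w \<in> closed_segment (circlepath 0 1 t) (circlepath 0 R t)"
      then obtain u where u: "0 \<le> u" "u \<le> 1" "w = (1 - u) *\<^sub>R ?e + u *\<^sub>R (of_real R * ?e)"
        by (auto simp: closed_segment_def circlepath)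
      have "w = of_real ((1 - u) + u * R) * ?e"
        unfolding u(3) by (simp add: scaleR_conv_of_real algebra_simps)
      then have "norm w = \<bar>(1 - u) + u * R\<bar>"
        by (simp only: norm_mult norm_of_real) (simp add: norm_exp_eq_Re)
      moreover have "R \<le> (1 - u) + u * R"
        using mult_nonneg_nonneg[of "1 - u" "1 - R"] u R by (simp add: algebra_simps)
      moreover have "(1 - u) + u * R \<le> 1"
        using mult_left_mono[of R 1 u] u R by simp
      ultimately show "w \<in> S" using R by (intro inS) auto
    qed
  qed auto
  then have "contour_integral (circlepath 0 1) f = contour_integral (circlepath 0 R) f"
    by (rule Cauchy_theorem_homotopic_loops[OF _ S hol]) auto
  then have eq: "(LINT z|circle_measure. f z * z) = of_real R * (LINT z|circle_measure. f (of_real R * z) * z)"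
    using contour_integral_circle_measure[OF _ cont, of 1] contour_integral_circle_measure[OF _ cont, of R] R by simp
  have shift: "z powi (k - 1) * z = z powi k" if "z \<noteq> 0" for z :: complex
    using that by (simp add: power_int_diff)
  have e1: "(LINT z|circle_measure. f z * z) = (LINT z|circle_measure. r z * z powi k)"
  proof (rule Bochner_Integration.integral_cong[OF refl])
    fix z assume "z \<in> space circle_measure"
    then have "z \<noteq> 0" by (auto simp: space_circle_measure)
    then show "f z * z = r z * z powi k"
      by (simp add: f_def mult.assoc shift)
  qed
  have e2: "(LINT z|circle_measure. f (of_real R * z) * z)
    = (LINT z|circle_measure. of_real R powi (k - 1) * (r (of_real R * z) * z powi k))"
  proof (rule Bochner_Integration.integral_cong[OF refl])
    fix z assume "z \<in> space circle_measure"
    then have "z \<noteq> 0" by (auto simp: space_circle_measure)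
    then show "f (of_real R * z) * z = of_real R powi (k - 1) * (r (of_real R * z) * z powi k)"
      by (simp add: f_def power_int_mult_distrib shift[OF \<open>z \<noteq> 0\<close>, symmetric] mult_ac)
  qed
  have e3: "of_real R * of_real R powi (k - 1) = (of_real R powi k :: complex)"
    using R shift[of "of_real R"] by (metis mult.commute of_real_eq_0_iff less_irrefl)
  show "(LINT z|circle_measure. r z * z powi k)
    = of_real R powi k * (LINT z|circle_measure. r (of_real R * z) * z powi k)"
    unfolding e1[symmetric] eq e2 integral_mult_right_zero e3[symmetric] by (rule mult.assoc[symmetric])
qed

lemma Hardy_two_subset_cauchy_class: "Hardy_two R \<subseteq> cauchy_class"
proof
  fix f assume f: "f \<in> Hardy_two R"
  show "f \<in> cauchy_class"
  proof (rule closed_subspaceD(5)[OF closed_subspace_cauchy_class])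
    show "f \<in> L_two \<sigma>" using f by (simp add: Hardy_two_def)
    fix e :: real assume "e > 0"
    then show "\<exists>g\<in>cauchy_class. L_two_norm \<sigma> (\<lambda>z. f z - g z) < e"
      using f rational_cauchy_class by (force simp: Hardy_two_def)
  qed
qed

text \<open>
  Sums of quotients of polynomials are quotients of polynomials only where no denominator vanishes,
  hence the passage to functions that are rational on the boundary.
\<close>

lemma closed_subspace_Hardy_two: "closed_subspace \<sigma> (Hardy_two R)"
proof -
  let ?K = "closure (annulus R)"
  define V where "V = {f \<in> L_two \<sigma>. \<exists>r\<in>rational_no_poles ?K. \<forall>z\<in>annulus_boundary R. f z = r z}"
  have K: "z \<in> ?K" if "z \<in> annulus_boundary R" for z
    using that closed_annulus_subset_closure[of z] R by (auto simp: annulus_boundary_norm)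
  have norm_cong: "L_two_norm \<sigma> (\<lambda>z. f z - v z) = L_two_norm \<sigma> (\<lambda>z. f z - r z)" if "\<forall>z\<in>annulus_boundary R. v z = r z" for f v r
    unfolding L_two_norm_def using that
    by (intro arg_cong[where f = sqrt] Bochner_Integration.integral_cong) (auto simp: space_boundary)
  have "Hardy_two R = {f \<in> L_two \<sigma>. \<forall>e>0. \<exists>v\<in>V. L_two_norm \<sigma> (\<lambda>z. f z - v z) < e}"
  proof (intro equalityI subsetI CollectI conjI allI impI)
    fix f and e :: real assume f: "f \<in> Hardy_two R" and "e > 0"
    then obtain r where "r \<in> rational_no_poles ?K" "L_two_norm \<sigma> (\<lambda>z. f z - r z) < e"
      by (auto simp: Hardy_two_def)
    then show "\<exists>v\<in>V. L_two_norm \<sigma> (\<lambda>z. f z - v z) < e"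
      using rational_L_two by (auto simp: V_def)
  next
    fix f assume f: "f \<in> {f \<in> L_two \<sigma>. \<forall>e>0. \<exists>v\<in>V. L_two_norm \<sigma> (\<lambda>z. f z - v z) < e}"
    show "f \<in> Hardy_two R"
      unfolding Hardy_two_def
    proof (intro CollectI conjI allI impI)
      fix e :: real assume "e > 0"
      then obtain v where v: "v \<in> V" "L_two_norm \<sigma> (\<lambda>z. f z - v z) < e" using f by auto
      then obtain r where r: "r \<in> rational_no_poles ?K" "\<forall>z\<in>annulus_boundary R. v z = r z" by (auto simp: V_def)
      show "\<exists>r\<in>rational_no_poles ?K. L_two_norm \<sigma> (\<lambda>z. f z - r z) < e"
        using r(1) v(2) norm_cong[OF r(2)] by auto
    qed (use f in auto)
  qed (auto simp: Hardy_two_def)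
  also have "closed_subspace \<sigma> \<dots>"
  proof (rule closed_subspace_closure)
    show "V \<subseteq> L_two \<sigma>" by (auto simp: V_def)
    have "(\<lambda>z. 0) \<in> rational_no_poles ?K"
      unfolding rational_no_poles_def by (intro CollectI exI[of _ 0] exI[of _ 1]) simp
    then show "(\<lambda>z. 0) \<in> V" by (auto simp: V_def L_two_zero)
  next
    fix f g assume "f \<in> V" "g \<in> V"
    then obtain p q p' q' where f: "f \<in> L_two \<sigma>" "\<forall>z\<in>?K. poly q z \<noteq> 0" "\<forall>z\<in>annulus_boundary R. f z = poly p z / poly q z"
      and g: "g \<in> L_two \<sigma>" "\<forall>z\<in>?K. poly q' z \<noteq> 0" "\<forall>z\<in>annulus_boundary R. g z = poly p' z / poly q' z"
      by (auto simp: V_def rational_no_poles_def)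
    have "(\<lambda>z. poly (p * q' + p' * q) z / poly (q * q') z) \<in> rational_no_poles ?K"
      unfolding rational_no_poles_def using f(2) g(2)
      by (intro CollectI exI[of _ "p * q' + p' * q"] exI[of _ "q * q'"]) simp
    moreover have "\<forall>z\<in>annulus_boundary R. f z + g z = poly (p * q' + p' * q) z / poly (q * q') z"
    proof
      fix z assume z: "z \<in> annulus_boundary R"
      then have "poly q z \<noteq> 0" "poly q' z \<noteq> 0" using f(2) g(2) K by auto
      then show "f z + g z = poly (p * q' + p' * q) z / poly (q * q') z"
        using f(3) g(3) z by (simp add: add_frac_eq)
    qed
    ultimately show "(\<lambda>z. f z + g z) \<in> V"
      unfolding V_def using L_two_add[OF f(1) g(1)] by (intro CollectI conjI bexI)
  next
    fix f c assume "f \<in> V"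
    then obtain p q where f: "f \<in> L_two \<sigma>" "\<forall>z\<in>?K. poly q z \<noteq> 0" "\<forall>z\<in>annulus_boundary R. f z = poly p z / poly q z"
      by (auto simp: V_def rational_no_poles_def)
    have "(\<lambda>z. poly (smult c p) z / poly q z) \<in> rational_no_poles ?K"
      unfolding rational_no_poles_def using f(2) by blast
    moreover have "\<forall>z\<in>annulus_boundary R. c * f z = poly (smult c p) z / poly q z"
      using f(3) by auto
    ultimately show "(\<lambda>z. c * f z) \<in> V"
      unfolding V_def using L_two_cmult[OF f(1), of c] by (intro CollectI conjI bexI)
  qed
  finally show ?thesis .
qed

lemma rational_Hardy_two: "r \<in> rational_no_poles (closure (annulus R)) \<Longrightarrow> r \<in> Hardy_two R"
  using rational_L_two by (force simp: Hardy_two_def L_two_norm_def)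

lemma powi_Hardy_two: "(\<lambda>z. z powi k) \<in> Hardy_two R"
proof (rule rational_Hardy_two)
  have "closure (annulus R) \<subseteq> - ball 0 R"
    by (rule closure_minimal) (auto simp: annulus_def)
  then have n0: "z \<noteq> 0" if "z \<in> closure (annulus R)" for z using that R by auto
  show "(\<lambda>z. z powi k) \<in> rational_no_poles (closure (annulus R))"
    unfolding rational_no_poles_def
  proof (intro CollectI)
    show "\<exists>p q. (\<forall>z\<in>closure (annulus R). poly q z \<noteq> 0) \<and> (\<lambda>z. z powi k) = (\<lambda>z. poly p z / poly q z)"
    proof (cases "k \<ge> 0")
      case True
      then show ?thesis
        by (intro exI[of _ "monom 1 (nat k)"] exI[of _ 1]) (auto simp: poly_monom power_int_def)
    next
      case False
      then show ?thesis using n0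
        by (intro exI[of _ 1] exI[of _ "monom 1 (nat (- k))"]) (auto simp: poly_monom power_int_def field_simps)
    qed
  qed
qed

lemma Hardy_two_cong:
  assumes h: "h \<in> Hardy_two R" and f: "continuous_on (annulus_boundary R) f"
    and eq: "\<And>z. z \<in> annulus_boundary R \<Longrightarrow> f z = h z"
  shows "f \<in> Hardy_two R"
proof (rule closed_subspaceD(5)[OF closed_subspace_Hardy_two])
  show "f \<in> L_two \<sigma>"
    by (intro boundary.L_infinity_L_two continuous_on_boundary_L_infinity f)
  fix e :: real assume "e > 0"
  moreover have "L_two_norm \<sigma> (\<lambda>z. f z - h z) = 0"
    by (intro L_two_norm_zero_AE AE_I2) (simp add: space_boundary eq)
  ultimately show "\<exists>g\<in>Hardy_two R. L_two_norm \<sigma> (\<lambda>z. f z - g z) < e"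
    using h by (intro bexI[of _ h]) simp_all
qed

text \<open>What remains of the choice operator in the definition of the projection and of the Toeplitz operator.\<close>

lemma Hardy_projection_props:
  assumes "f \<in> L_two \<sigma>"
  shows "Hardy_projection R f \<in> Hardy_two R"
    "\<And>h. h \<in> Hardy_two R \<Longrightarrow> L_two_inner \<sigma> (\<lambda>z. f z - Hardy_projection R f z) h = 0"
proof -
  have "\<exists>g. g \<in> Hardy_two R \<and> (\<forall>h\<in>Hardy_two R. L_two_inner \<sigma> (\<lambda>z. f z - g z) h = 0)"
    using boundary.orthogonal_projection_exists[OF closed_subspace_Hardy_two assms] by blast
  from someI_ex[OF this]
  show "Hardy_projection R f \<in> Hardy_two R"
    "\<And>h. h \<in> Hardy_two R \<Longrightarrow> L_two_inner \<sigma> (\<lambda>z. f z - Hardy_projection R f z) h = 0"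
    unfolding Hardy_projection_def by auto
qed

end

section \<open>Functions on the circle with exponentially decaying coefficients\<close>

lemma summable_decaying:
  fixes a :: "nat \<Rightarrow> complex"
  assumes a: "\<And>n. norm (a n) \<le> C * \<theta> ^ n" and \<theta>: "0 < \<theta>" and w: "norm w < 1 / \<theta>"
  shows "summable (\<lambda>n. norm (a n * w ^ n))"
proof (rule summable_comparison_test')
  show "summable (\<lambda>n. C * (\<theta> * norm w) ^ n)"
    using w \<theta> by (intro summable_mult summable_geometric) (auto simp: field_simps)
  show "norm (norm (a n * w ^ n)) \<le> C * (\<theta> * norm w) ^ n" for n
    using mult_right_mono[OF a[of n], of "norm w ^ n"]
    by (simp add: norm_mult norm_power power_mult_distrib)
qed

lemma
  fixes a :: "nat \<Rightarrow> complex" and e :: "nat \<Rightarrow> int"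
  assumes a: "\<And>n. norm (a n) \<le> C * \<theta> ^ n" and \<theta>: "0 < \<theta>" "\<theta> < 1"
  shows integrable_circle_powi_series: "integrable circle_measure (\<lambda>z. \<Sum>n. a n * z powi e n)"
    and sums_integral_circle_powi:
      "(\<lambda>n. if e n = 0 then a n else 0) sums (LINT z|circle_measure. (\<Sum>n. a n * z powi e n))"
proof -
  have sa: "summable (\<lambda>n. norm (a n))"
    using summable_decaying[of a C \<theta> 1] a \<theta> by simp
  have i: "integrable circle_measure (\<lambda>z. a n * z powi e n)" for n
    using integrable_circle_powi[of "\<lambda>z. a n"] by simp
  have ae: "AE z in circle_measure. summable (\<lambda>n. norm (a n * z powi e n))"
    using AE_circle_norm by eventually_elim (simp add: norm_mult norm_powi_circle sa)
  have "(LINT z|circle_measure. norm (a n * z powi e n)) = (LINT z|circle_measure. norm (a n))" for n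
    by (rule Bochner_Integration.integral_cong) (auto simp: space_circle_measure norm_mult norm_powi_circle)
  then have s: "summable (\<lambda>n. LINT z|circle_measure. norm (a n * z powi e n))"
    using sa circle.prob_space by simp
  show "integrable circle_measure (\<lambda>z. \<Sum>n. a n * z powi e n)"
    by (rule integrable_suminf[OF i ae s])
  have "(LINT z|circle_measure. a n * z powi e n) = (if e n = 0 then a n else 0)" for n
    by (simp add: integral_circle_powi)
  with sums_integral[OF i ae s]
  show "(\<lambda>n. if e n = 0 then a n else 0) sums (LINT z|circle_measure. (\<Sum>n. a n * z powi e n))"
    by simp
qed

text \<open>
  Exponential decay of the coefficients makes the Fourier series a Laurent series that converges
  in an annulus around the circle.  Its sum is holomorphic there and agrees with the function almost
  everywhere; zeros on a set of positive measure accumulate, so it is identically zero.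
\<close>

theorem decaying_coefficients_zero:
  fixes g :: "complex \<Rightarrow> complex"
  assumes g: "integrable circle_measure g"
    and decay: "\<And>k. norm (LINT z|circle_measure. g z * z powi k) \<le> C * \<theta> ^ nat \<bar>k\<bar>"
    and \<theta>: "0 < \<theta>" "\<theta> < 1"
    and zeros: "\<not> (AE z in circle_measure. g z \<noteq> 0)"
  shows "AE z in circle_measure. g z = 0"
proof -
  define c where "c n = (LINT z|circle_measure. g z * z powi (- int n))" for n
  define d where "d n = (LINT z|circle_measure. g z * z powi (int n + 1))" for n
  have C: "C \<ge> 0" using order_trans[OF norm_ge_zero decay[of 0]] by simp
  have c: "norm (c n) \<le> C * \<theta> ^ n" for n
    using decay[of "- int n"] by (simp add: c_def)
  have d: "norm (d n) \<le> C * \<theta> ^ n" for n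
  proof -
    have "norm (d n) \<le> C * \<theta> ^ Suc n"
      using decay[of "int n + 1"] by (simp add: d_def nat_add_distrib)
    also have "\<dots> \<le> C * \<theta> ^ n"
      using \<theta> C by (intro mult_left_mono power_decreasing) auto
    finally show ?thesis .
  qed
  define F where "F a w = (\<Sum>n. a n * w ^ n)" for a :: "nat \<Rightarrow> complex" and w
  have Fsums: "(\<lambda>n. a n * w ^ n) sums F a w" if "\<And>n. norm (a n) \<le> C * \<theta> ^ n" "norm w < 1 / \<theta>" for a w
    unfolding F_def using that \<theta> by (intro summable_sums summable_norm_cancel[OF summable_decaying]) auto
  have Fhol: "F a holomorphic_on ball 0 (1 / \<theta>)" if "\<And>n. norm (a n) \<le> C * \<theta> ^ n" for a
    using Fsums[OF that] by (intro power_series_holomorphic[where a = a]) auto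
  define S where "S = {z :: complex. \<theta> < norm (z - 0) \<and> norm (z - 0) < 1 / \<theta>}"
  define G where "G z = F c z + inverse z * F d (inverse z)" for z
  have S0: "z \<noteq> 0" if "z \<in> S" for z using that \<theta> by (auto simp: S_def)
  have Sinv: "inverse z \<in> ball 0 (1 / \<theta>)" if "z \<in> S" for z
    using that \<theta> S0[OF that] by (auto simp: S_def norm_divide field_simps)
  have Gh1: "F c holomorphic_on S"
    by (rule holomorphic_on_subset[OF Fhol[of c]]) (auto simp: S_def c)
  have "(F d \<circ> inverse) holomorphic_on S"
    by (rule holomorphic_on_compose_gen[OF _ Fhol[of d]])
       (use S0 Sinv d in \<open>auto intro!: holomorphic_intros\<close>)
  then have Gh2: "(\<lambda>z. F d (inverse z)) holomorphic_on S" by (simp add: o_def)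
  have Ghol: "G holomorphic_on S"
    unfolding G_def using S0 by (intro holomorphic_intros Gh1 Gh2) auto
  have circS: "sphere 0 1 \<subseteq> S" using \<theta> by (auto simp: S_def)
  have Gcont: "continuous_on (sphere 0 1) G"
    by (rule continuous_on_subset[OF holomorphic_on_imp_continuous_on[OF Ghol] circS])
  have Gint: "integrable circle_measure G"
    using integrable_circle_continuous_mult[OF _ Gcont, of "\<lambda>z. 1"] by simp
  have Gcoef: "(LINT z|circle_measure. G z * z powi k) = (LINT z|circle_measure. g z * z powi k)" for k
  proof -
    have eq: "G z * z powi k = (\<Sum>n. c n * z powi (int n + k)) + (\<Sum>n. d n * z powi (k - 1 - int n))" if z: "norm z = 1" for z
    proof -
      have z0: "z \<noteq> 0" using z by auto
      have "(\<Sum>n. c n * z powi (int n + k)) = (\<Sum>n. (c n * z ^ n) * z powi k)"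
        using z0 by (simp add: power_int_add mult.assoc)
      also have "\<dots> = F c z * z powi k"
        unfolding F_def using Fsums[of c z] c z \<theta> by (intro suminf_mult2[symmetric]) (auto simp: sums_iff)
      finally have e1: "(\<Sum>n. c n * z powi (int n + k)) = F c z * z powi k" .
      have "d n * z powi (k - 1 - int n) = (d n * inverse z ^ n) * (inverse z * z powi k)" for n
        using z0 by (simp add: power_int_diff power_int_add field_simps)
      then have "(\<Sum>n. d n * z powi (k - 1 - int n)) = (\<Sum>n. (d n * inverse z ^ n) * (inverse z * z powi k))"
        by (simp only:)
      also have "\<dots> = F d (inverse z) * (inverse z * z powi k)"
        unfolding F_def using Fsums[of d "inverse z"] d z \<theta>
        by (intro suminf_mult2[symmetric]) (auto simp: sums_iff norm_inverse)
      finally show ?thesis unfolding e1 G_def by (simp add: algebra_simps)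
    qed
    have s1: "(\<lambda>n. if int n + k = 0 then c n else 0) sums (LINT z|circle_measure. (\<Sum>n. c n * z powi (int n + k)))"
      by (rule sums_integral_circle_powi[OF c \<theta>])
    have s2: "(\<lambda>n. if k - 1 - int n = 0 then d n else 0) sums (LINT z|circle_measure. (\<Sum>n. d n * z powi (k - 1 - int n)))"
      by (rule sums_integral_circle_powi[OF d \<theta>])
    have "(LINT z|circle_measure. G z * z powi k)
        = (LINT z|circle_measure. (\<Sum>n. c n * z powi (int n + k)) + (\<Sum>n. d n * z powi (k - 1 - int n)))"
      by (rule Bochner_Integration.integral_cong) (auto simp: space_circle_measure eq)
    also have "\<dots> = (LINT z|circle_measure. (\<Sum>n. c n * z powi (int n + k))) + (LINT z|circle_measure. (\<Sum>n. d n * z powi (k - 1 - int n)))"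
      by (rule Bochner_Integration.integral_add[OF integrable_circle_powi_series[OF c \<theta>] integrable_circle_powi_series[OF d \<theta>]])
    also have "\<dots> = (LINT z|circle_measure. g z * z powi k)"
    proof (cases "k \<le> 0")
      case True
      then have "(\<lambda>n. if int n + k = 0 then c n else 0) = (\<lambda>n. if n = nat (- k) then c n else 0)"
        and "(\<lambda>n. if k - 1 - int n = 0 then d n else 0) = (\<lambda>n. 0)"
        by (auto simp: fun_eq_iff)
      then have "(LINT z|circle_measure. (\<Sum>n. c n * z powi (int n + k))) = c (nat (- k))"
        "(LINT z|circle_measure. (\<Sum>n. d n * z powi (k - 1 - int n))) = 0"
        using sums_unique2[OF s1] sums_unique2[OF s2] sums_single[of "nat (- k)" c] sums_zero by auto
      then show ?thesis using True by (simp add: c_def)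
    next
      case False
      then have "(\<lambda>n. if int n + k = 0 then c n else 0) = (\<lambda>n. 0)"
        and "(\<lambda>n. if k - 1 - int n = 0 then d n else 0) = (\<lambda>n. if n = nat (k - 1) then d n else 0)"
        by (auto simp: fun_eq_iff)
      then have "(LINT z|circle_measure. (\<Sum>n. c n * z powi (int n + k))) = 0"
        "(LINT z|circle_measure. (\<Sum>n. d n * z powi (k - 1 - int n))) = d (nat (k - 1))"
        using sums_unique2[OF s1] sums_unique2[OF s2] sums_single[of "nat (k - 1)" d] sums_zero by auto
      then show ?thesis using False by (simp add: d_def)
    qed
    finally show ?thesis .
  qed
  have "AE z in circle_measure. g z - G z = 0"
  proof (rule Fourier_uniqueness)
    show "integrable circle_measure (\<lambda>z. g z - G z)" using g Gint by simp
    show "(LINT z|circle_measure. (g z - G z) * z powi k) = 0" for k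
      using integrable_circle_powi[OF g] integrable_circle_powi[OF Gint] Gcoef
      by (simp add: left_diff_distrib)
  qed
  then have gG: "AE z in circle_measure. g z = G z" by simp
  define Z where "Z = {z \<in> sphere 0 1. G z = 0}"
  have "infinite Z"
  proof
    assume "finite Z"
    then have "AE z in circle_measure. \<forall>x\<in>Z. z \<noteq> x"
      by (intro AE_finite_allI AE_circle_neq)
    then have "AE z in circle_measure. g z \<noteq> 0"
      using gG AE_circle_norm by eventually_elim (auto simp: Z_def)
    then show False using zeros by simp
  qed
  moreover have "Z \<subseteq> sphere 0 1" by (auto simp: Z_def)
  ultimately obtain \<xi> where \<xi>: "\<xi> \<in> sphere 0 1" "\<xi> islimpt Z"
    using Heine_Borel_imp_Bolzano_Weierstrass[OF compact_sphere] by blast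
  have G0: "G w = 0" if "norm w = 1" for w
  proof (rule analytic_continuation[OF Ghol])
    show "open S" unfolding S_def
      by (intro open_Collect_conj open_Collect_less continuous_intros)
    show "connected S" unfolding S_def by (rule connected_annulus) simp
    show "Z \<subseteq> S" "\<xi> \<in> S" "w \<in> S" using circS \<xi> that by (auto simp: Z_def)
    show "\<xi> islimpt Z" by (rule \<xi>)
    show "G z = 0" if "z \<in> Z" for z using that by (simp add: Z_def)
  qed
  show ?thesis
    using gG AE_circle_norm by eventually_elim (simp add: G0)
qed

section \<open>Uniqueness on the annulus\<close>

context annulus_radius
begin

text \<open>
  In terms of the coefficients \<open>A\<^sub>k\<close>, \<open>B\<^sub>k\<close> of \<open>w\<close> on the two circles the moment condition makes
  \<open>A\<^sub>k + R\<^sup>k B\<^sub>k\<close> of order \<open>\<rho>\<^sup>k\<close> for \<open>k\<close> tending to \<open>\<plusminus>\<infinity>\<close>.  As \<open>R < \<rho> < 1\<close>, the behaviour at \<open>+\<infinity>\<close>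
  controls \<open>A\<close>, that at \<open>-\<infinity>\<close> controls \<open>B\<close>, and reality of \<open>w\<close> gives the other sign.
  The choice \<open>\<rho> = sqrt R\<close> makes both rates equal.
\<close>

lemma geometric_moments_zero:
  fixes w :: "complex \<Rightarrow> complex" and N :: nat
  assumes w: "integrable \<sigma> w" and real: "\<And>z. cnj (w z) = w z"
    and N: "N > 0"
    and mom: "\<And>k. (LINT z|\<sigma>. w z * z powi (k + int N)) = of_real (sqrt R) ^ N * (LINT z|\<sigma>. w z * z powi k)"
    and zeros: "\<not> (AE z in \<sigma>. w z \<noteq> 0)"
  shows "(AE z in circle_measure. w z = 0) \<or> (AE z in circle_measure. w (of_real R * z) = 0)"
proof -
  define \<rho> where "\<rho> = sqrt R"
  have \<rho>: "0 < \<rho>" "\<rho> < 1" "\<rho> * \<rho> = R" using R by (auto simp: \<rho>_def)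
  have R\<rho>: "R \<le> \<rho>" using \<rho> mult_left_le[of \<rho> \<rho>] by simp
  note wi = integrable_boundaryD[OF w]
  define A where "A k = (LINT z|circle_measure. w z * z powi k)" for k
  define B where "B k = (LINT z|circle_measure. w (of_real R * z) * z powi k)" for k
  define D where "D k = (LINT z|\<sigma>. w z * z powi k)" for k
  have wk: "integrable \<sigma> (\<lambda>z. w z * z powi k)" for k
  proof (subst integrable_boundary_iff)
    show "(\<lambda>z. w z * z powi k) \<in> borel_measurable \<sigma>"
      by (intro borel_measurable_times borel_measurable_integrable[OF w] measurable_boundary measurable_powi)
    have "integrable circle_measure (\<lambda>z. of_real R powi k * (w (of_real R * z) * z powi k))"
      by (intro integrable_mult_right integrable_circle_powi wi)
    then show "integrable circle_measure (\<lambda>z. w z * z powi k) \<and> integrable circle_measure (\<lambda>z. w (of_real R * z) * (of_real R * z) powi k)"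
      using integrable_circle_powi[OF wi(1)] by (simp add: power_int_mult_distrib mult_ac)
  qed
  have D: "D k = A k + of_real R powi k * B k" for k
  proof -
    have "D k = A k + (LINT z|circle_measure. w (of_real R * z) * (of_real R * z) powi k)"
      unfolding D_def A_def by (rule integral_boundary[OF wk])
    also have "(LINT z|circle_measure. w (of_real R * z) * (of_real R * z) powi k)
        = (LINT z|circle_measure. of_real R powi k * (w (of_real R * z) * z powi k))"
      by (simp add: power_int_mult_distrib mult_ac)
    finally show ?thesis by (simp add: B_def)
  qed
  have bound: "norm (LINT z|circle_measure. h z * z powi k) \<le> (LINT z|circle_measure. norm (h z))"
    if "integrable circle_measure h" for h and k
  proof -
    have "norm (LINT z|circle_measure. h z * z powi k) \<le> (LINT z|circle_measure. norm (h z * z powi k))"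
      by (rule integral_norm_bound)
    also have "\<dots> = (LINT z|circle_measure. norm (h z))"
      by (rule Bochner_Integration.integral_cong) (auto simp: space_circle_measure norm_mult norm_powi_circle)
    finally show ?thesis .
  qed
  define c where "c = (LINT z|circle_measure. norm (w z)) + (LINT z|circle_measure. norm (w (of_real R * z)))"
  have A: "norm (A k) \<le> c" and B: "norm (B k) \<le> c" for k
    using bound[OF wi(1), of k] bound[OF wi(2), of k] by (auto simp: A_def B_def c_def add_increasing add_increasing2)
  have c: "c \<ge> 0" by (simp add: c_def)
  have iter: "D (r + int N * j) = of_real \<rho> powi (int N * j) * D r" for r j
  proof (induction j rule: int_induct[where k = 0])
    case (step1 i)
    have "D (r + int N * (i + 1)) = D ((r + int N * i) + int N)" by (simp add: algebra_simps)
    also have "\<dots> = of_real \<rho> ^ N * D (r + int N * i)"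
      unfolding D_def \<rho>_def by (rule mom)
    finally show ?case using step1 \<rho> by (simp add: distrib_left power_int_add)
  next
    case (step2 i)
    have "D (r + int N * i) = D ((r + int N * (i - 1)) + int N)" by (simp add: algebra_simps)
    also have "\<dots> = of_real \<rho> ^ N * D (r + int N * (i - 1))"
      unfolding D_def \<rho>_def by (rule mom)
    finally have "of_real \<rho> powi (int N * i) * D r = of_real \<rho> ^ N * D (r + int N * (i - 1))"
      using step2 by simp
    then show ?case using \<rho> by (simp add: right_diff_distrib power_int_diff field_simps)
  qed simp
  define C where "C = 2 * c * \<rho> powi (- int N) + c"
  \<comment> \<open>Reduction modulo \<open>N\<close> to exponents in \<open>{0..<N}\<close>, where \<open>\<bar>z\<^sup>k\<bar> \<le> 1\<close> on both circles.\<close>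
  have Dle: "norm (D k) \<le> 2 * c * \<rho> powi (- int N) * \<rho> powi k" for k
  proof -
    have "D k = D (k mod int N + int N * (k div int N))" by simp
    also have "norm \<dots> = \<rho> powi (int N * (k div int N)) * norm (D (k mod int N))"
      unfolding iter using \<rho> by (simp add: norm_mult norm_power_int)
    also have "\<dots> \<le> \<rho> powi (k - int N) * (2 * c)"
    proof (rule mult_mono)
      have "k - int N \<le> int N * (k div int N)"
        using N pos_mod_bound[of "int N" k] mult_div_mod_eq[of "int N" k] by linarith
      then show "\<rho> powi (int N * (k div int N)) \<le> \<rho> powi (k - int N)"
        using \<rho> by (intro power_int_decreasing) auto
      have "k mod int N \<ge> 0" using N by simp
      then have "norm (of_real R powi (k mod int N) * B (k mod int N)) \<le> 1 * c"
        unfolding norm_mult using R B by (intro mult_mono) (auto simp: norm_power_int norm_power power_int_def power_le_one)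
      then show "norm (D (k mod int N)) \<le> 2 * c"
        unfolding D using norm_triangle_ineq[of "A (k mod int N)" "of_real R powi (k mod int N) * B (k mod int N)"] A[of "k mod int N"] by linarith
    qed (use \<rho> c in auto)
    finally show ?thesis using \<rho> by (simp add: power_int_diff power_int_minus field_simps)
  qed
  have conj: "norm (LINT z|circle_measure. h z * z powi (- k)) = norm (LINT z|circle_measure. h z * z powi k)"
    if "\<And>z. cnj (h z) = h z" for h and k
  proof -
    have "cnj (LINT z|circle_measure. h z * z powi k) = (LINT z|circle_measure. cnj (h z * z powi k))"
      by (rule Bochner_Integration.integral_cnj[symmetric])
    also have "\<dots> = (LINT z|circle_measure. h z * z powi (- k))"
    proof (rule Bochner_Integration.integral_cong[OF refl])
      fix z assume "z \<in> space circle_measure"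
      then show "cnj (h z * z powi k) = h z * z powi (- k)"
        unfolding complex_cnj_mult that by (simp only: space_circle_measure mem_sphere_0 cnj_powi_circle)
    qed
    finally show ?thesis by (metis complex_mod_cnj)
  qed
  have pR: "R ^ n \<le> \<rho> ^ n" for n using R R\<rho> by (intro power_mono) auto
  have Adec: "norm (A k) \<le> C * \<rho> ^ nat \<bar>k\<bar>" for k
  proof -
    have pos: "norm (A (int n)) \<le> C * \<rho> ^ n" for n
    proof -
      have "norm (A (int n)) \<le> norm (D (int n)) + norm (of_real R powi int n * B (int n))"
        using norm_triangle_ineq4[of "D (int n)" "of_real R powi int n * B (int n)"] by (simp add: D)
      also have "norm (of_real R powi int n * B (int n)) \<le> \<rho> ^ n * c"
        unfolding norm_mult using R B pR \<rho> by (intro mult_mono) (auto simp: norm_power)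
      also have "norm (D (int n)) \<le> 2 * c * \<rho> powi (- int N) * \<rho> ^ n"
        using Dle[of "int n"] by simp
      finally show ?thesis by (simp add: C_def algebra_simps)
    qed
    show ?thesis
    proof (cases "k \<ge> 0")
      case True
      then show ?thesis using pos[of "nat k"] by simp
    next
      case False
      then show ?thesis using pos[of "nat (- k)"] conj[of w k, OF real] by (simp add: A_def)
    qed
  qed
  have Bdec: "norm (B k) \<le> C * \<rho> ^ nat \<bar>k\<bar>" for k
  proof -
    have neg: "norm (B (- int n)) \<le> C * \<rho> ^ n" for n
    proof -
      have "B (- int n) = of_real R ^ n * (D (- int n) - A (- int n))"
        using R by (simp add: D power_int_minus)
      then have "norm (B (- int n)) = R ^ n * norm (D (- int n) - A (- int n))"
        using R by (simp add: norm_mult norm_power)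
      also have "\<dots> \<le> R ^ n * (2 * c * \<rho> powi (- int N) * \<rho> powi (- int n) + c)"
        using norm_triangle_ineq4[of "D (- int n)" "A (- int n)"] Dle[of "- int n"] A[of "- int n"] R
        by (intro mult_left_mono) auto
      also have "\<dots> = 2 * c * \<rho> powi (- int N) * (R ^ n * \<rho> powi (- int n)) + c * R ^ n"
        by (simp add: algebra_simps)
      also have "R ^ n * \<rho> powi (- int n) = \<rho> ^ n"
        using \<rho> by (simp add: power_int_minus power_mult_distrib flip: \<rho>(3))
      also have "2 * c * \<rho> powi (- int N) * \<rho> ^ n + c * R ^ n \<le> C * \<rho> ^ n"
        using mult_left_mono[OF pR c, of n] by (simp add: C_def algebra_simps)
      finally show ?thesis .
    qed
    show ?thesis
    proof (cases "k \<le> 0")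
      case True
      then show ?thesis using neg[of "nat (- k)"] by simp
    next
      case False
      then show ?thesis using neg[of "nat k"] conj[of "\<lambda>z. w (of_real R * z)" k, OF real] by (simp add: B_def)
    qed
  qed
  have "Measurable.pred \<sigma> (\<lambda>z. w z \<noteq> 0)"
    using borel_measurable_integrable[OF w] by measurable
  then have "\<not> (AE z in circle_measure. w z \<noteq> 0) \<or> \<not> (AE z in circle_measure. w (of_real R * z) \<noteq> 0)"
    using zeros AE_boundary_iff by blast
  then show ?thesis
    using decaying_coefficients_zero[OF wi(1) Adec[unfolded A_def] \<rho>(1,2)]
      decaying_coefficients_zero[OF wi(2) Bdec[unfolded B_def] \<rho>(1,2)] by blast
qed

lemma integrable_L_two_L_infinity: "b \<in> L_infinity \<sigma> \<Longrightarrow> f \<in> L_two \<sigma> \<Longrightarrow> integrable \<sigma> (\<lambda>z. f z * b z)"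
  using L_two_integrable[OF L_two_L_infinity_mult, of b f] by (simp add: mult.commute)

text \<open>
  Helson's argument.  Let \<open>q\<close> be the component of \<open>f\<close> orthogonal to all \<open>(z\<^sup>N - \<rho>\<^sup>N) z\<^sup>k f\<close>, with
  \<open>\<rho> = sqrt R\<close>.  The annihilator description of the closed span of these functions makes it
  evident that \<open>q\<close> stays in the Cauchy class, vanishes where \<open>f\<close> does, and is orthogonal to all
  \<open>(z\<^sup>N - \<rho>\<^sup>N) z\<^sup>k q\<close>.  The last property is a recursion for the moments of \<open>\<bar>q\<bar>\<^sup>2\<close>, which forces
  \<open>q = 0\<close>.  So \<open>f\<close> lies in the closed span itself.
\<close>

lemma zeros_imp_in_closed_span:
  assumes f: "f \<in> cauchy_class" and zeros: "\<not> (AE z in \<sigma>. f z \<noteq> 0)" and N: "N > 0"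
    and u: "u \<in> L_two \<sigma>"
    and ann: "\<And>k::int. (LINT z|\<sigma>. f z * ((z ^ N - of_real (sqrt R) ^ N) * z powi k * u z)) = 0"
  shows "(LINT z|\<sigma>. f z * u z) = 0"
proof -
  define \<rho> :: complex where "\<rho> = of_real (sqrt R) ^ N"
  define b where "b k z = (z ^ N - \<rho>) * z powi k" for k and z :: complex
  define U where "U = {u \<in> L_two \<sigma>. \<forall>k::int. (LINT z|\<sigma>. f z * (b k z * u z)) = 0}"
  define M where "M = {g \<in> L_two \<sigma>. \<forall>u\<in>U. (LINT z|\<sigma>. g z * u z) = 0}"
  have f2: "f \<in> L_two \<sigma>" using f by (simp add: cauchy_class_def)
  have b_Linf: "b k \<in> L_infinity \<sigma>" for k
    unfolding b_def using nonzero_boundary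
    by (intro continuous_on_boundary_L_infinity continuous_intros) auto
  have b_eq: "b k z = z powi (k + int N) - \<rho> * z powi k" if "z \<in> annulus_boundary R" for k z
    using nonzero_boundary[OF that] by (simp add: b_def power_int_add algebra_simps)
  have b_mult: "b j z * b k z = b (j + k + int N) z - \<rho> * b (j + k) z" if "z \<in> annulus_boundary R" for j k z
    using nonzero_boundary[OF that] by (simp add: b_def power_int_add algebra_simps)
  have U2: "U \<subseteq> L_two \<sigma>" by (auto simp: U_def)
  have M: "closed_subspace \<sigma> M"
    unfolding M_def by (rule closed_subspace_annihilator[OF U2])
  obtain g where g: "g \<in> M" and orth: "\<And>h. h \<in> M \<Longrightarrow> L_two_inner \<sigma> (\<lambda>z. f z - g z) h = 0"
    using boundary.orthogonal_projection_exists[OF M f2] by blast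
  have g2: "g \<in> L_two \<sigma>" using g by (simp add: M_def)
  define q where "q z = f z - g z" for z
  have q2: "q \<in> L_two \<sigma>" unfolding q_def by (rule L_two_diff[OF f2 g2])
  note prod = L_two_L_infinity_mult
  have bu: "integrable \<sigma> (\<lambda>z. h z * (b k z * u z))" if "h \<in> L_two \<sigma>" "u \<in> L_two \<sigma>" for h u k
    by (rule integrable_L_two_mult[OF that(1) prod[OF b_Linf that(2)]])

  \<comment> \<open>The functions that define the Cauchy class belong to \<open>U\<close>.\<close>
  have M_cauchy: "h \<in> cauchy_class" if h: "h \<in> M" for h
  proof -
    have "(\<lambda>z. orientation z * z powi k) \<in> U" for k
      unfolding U_def
    proof (intro CollectI conjI allI)
      show "(\<lambda>z. orientation z * z powi k) \<in> L_two \<sigma>"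
        by (rule boundary.L_infinity_L_two[OF orientation_powi_L_infinity])
      fix j
      have "(LINT z|\<sigma>. f z * (b j z * (orientation z * z powi k)))
        = (LINT z|\<sigma>. f z * (orientation z * z powi (j + int N + k)) - \<rho> * (f z * (orientation z * z powi (j + k))))"
        using nonzero_boundary
        by (intro Bochner_Integration.integral_cong) (auto simp: space_boundary b_eq power_int_add algebra_simps)
      also have "\<dots> = 0"
        using f integrable_L_two_L_infinity[OF orientation_powi_L_infinity f2] by (simp add: cauchy_class_def)
      finally show "(LINT z|\<sigma>. f z * (b j z * (orientation z * z powi k))) = 0" .
    qed
    then show ?thesis using h by (simp add: M_def cauchy_class_def)
  qed
  have q_cauchy: "q \<in> cauchy_class"
    using closed_subspaceD(3)[OF closed_subspace_cauchy_class f
        closed_subspaceD(4)[OF closed_subspace_cauchy_class M_cauchy[OF g], of "- 1"]]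
    by (simp add: q_def[abs_def])

  \<comment> \<open>A function supported on the zero set of \<open>f\<close> belongs to \<open>U\<close>; the choice below gives \<open>\<integral>\<bar>v\<bar>\<^sup>2 = 0\<close>.\<close>
  have g_zero: "AE z in \<sigma>. f z = 0 \<longrightarrow> g z = 0"
  proof -
    define v where "v z = (if f z = 0 then 1 else 0) * cnj (g z)" for z
    note [measurable] = L_twoD(1)[OF f2]
    have v: "v \<in> L_two \<sigma>"
      unfolding v_def by (rule L_two_bounded_mult[OF L_two_cnj[OF g2], where B = 1]) auto
    have "(\<lambda>z. f z * (b k z * v z)) = (\<lambda>z. 0)" for k by (simp add: v_def fun_eq_iff)
    then have "v \<in> U" using v unfolding U_def by (simp del: mult_eq_0_iff)
    then have "(LINT z|\<sigma>. g z * v z) = 0" using g by (simp add: M_def)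
    moreover have "g z * v z = of_real ((norm (v z))\<^sup>2)" for z
      by (simp add: v_def complex_norm_square[symmetric])
    ultimately have "(LINT z|\<sigma>. (norm (v z))\<^sup>2) = 0"
      by (simp flip: of_real_power)
    then have "AE z in \<sigma>. v z = 0"
      using integral_nonneg_eq_0_iff_AE[OF L_twoD(2)[OF v]] by simp
    then show ?thesis by eventually_elim (auto simp: v_def)
  qed

  \<comment> \<open>Multiplication by \<open>b k\<close> preserves \<open>U\<close>, because \<open>b j * b k\<close> is a combination of two other \<open>b i\<close>.\<close>
  have bq: "(\<lambda>z. b k z * q z) \<in> M" for k
    unfolding M_def
  proof (intro CollectI conjI ballI)
    show "(\<lambda>z. b k z * q z) \<in> L_two \<sigma>" by (rule prod[OF b_Linf q2])
    fix u assume u: "u \<in> U"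
    then have u2: "u \<in> L_two \<sigma>" using U2 by auto
    have "(\<lambda>z. b k z * u z) \<in> U"
      unfolding U_def
    proof (intro CollectI conjI allI)
      show "(\<lambda>z. b k z * u z) \<in> L_two \<sigma>" by (rule prod[OF b_Linf u2])
      fix j
      have "(LINT z|\<sigma>. f z * (b j z * (b k z * u z)))
          = (LINT z|\<sigma>. f z * (b (j + k + int N) z * u z) - \<rho> * (f z * (b (j + k) z * u z)))"
        by (intro Bochner_Integration.integral_cong) (auto simp: space_boundary b_mult left_diff_distrib right_diff_distrib mult.left_commute simp flip: mult.assoc[of "b j _" "b k _"])
      also have "\<dots> = 0"
        using u bu[OF f2 u2] by (simp add: U_def)
      finally show "(LINT z|\<sigma>. f z * (b j z * (b k z * u z))) = 0" .
    qed
    then have "(LINT z|\<sigma>. g z * (b k z * u z)) = 0" using g by (simp add: M_def)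
    moreover have "(LINT z|\<sigma>. f z * (b k z * u z)) = 0" using u by (simp add: U_def)
    moreover have "b k z * q z * u z = f z * (b k z * u z) - g z * (b k z * u z)" for z
      by (simp add: q_def algebra_simps)
    ultimately show "(LINT z|\<sigma>. b k z * q z * u z) = 0"
      using bu[OF f2 u2] bu[OF g2 u2] by simp
  qed

  define w where "w z = q z * cnj (q z)" for z
  have wint: "integrable \<sigma> w"
    unfolding w_def by (rule integrable_L_two_mult[OF q2 L_two_cnj[OF q2]])
  have wk: "integrable \<sigma> (\<lambda>z. w z * z powi k)" for k
    using integrable_L_two_mult[OF q2 prod[OF powi_L_infinity[of k] L_two_cnj[OF q2]]]
    by (simp add: w_def mult_ac)
  have wb: "(LINT z|\<sigma>. w z * b k z) = 0" for k
  proof -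
    have "cnj (LINT z|\<sigma>. q z * cnj (b k z * q z)) = 0"
      using orth[OF bq] by (simp add: L_two_inner_def q_def)
    then have "(LINT z|\<sigma>. cnj (q z * cnj (b k z * q z))) = 0"
      by (subst Bochner_Integration.integral_cnj)
    then show ?thesis by (simp add: w_def mult_ac)
  qed
  have "(AE z in circle_measure. w z = 0) \<or> (AE z in circle_measure. w (of_real R * z) = 0)"
  proof (rule geometric_moments_zero[OF wint _ N])
    show "cnj (w z) = w z" for z by (simp add: w_def)
    fix k
    have "(LINT z|\<sigma>. w z * b k z) = (LINT z|\<sigma>. w z * z powi (k + int N) - \<rho> * (w z * z powi k))"
      by (intro Bochner_Integration.integral_cong) (auto simp: space_boundary b_eq algebra_simps)
    then show "(LINT z|\<sigma>. w z * z powi (k + int N)) = of_real (sqrt R) ^ N * (LINT z|\<sigma>. w z * z powi k)"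
      using wb[of k] wk by (simp add: \<rho>_def)
  next
    show "\<not> (AE z in \<sigma>. w z \<noteq> 0)"
    proof
      assume "AE z in \<sigma>. w z \<noteq> 0"
      with g_zero have "AE z in \<sigma>. f z \<noteq> 0"
        by eventually_elim (auto simp: w_def q_def)
      then show False using zeros by simp
    qed
  qed
  then have "AE z in \<sigma>. q z = 0"
    by (intro cauchy_class_zero_one_circle[OF q_cauchy]) (simp add: w_def)
  then have "AE z in \<sigma>. f z * u z = g z * u z"
    by eventually_elim (simp add: q_def)
  then have "(LINT z|\<sigma>. f z * u z) = (LINT z|\<sigma>. g z * u z)"
    using integrable_L_two_mult[OF f2 u] integrable_L_two_mult[OF g2 u]
    by (intro integral_cong_AE) auto
  also have "\<dots> = 0"
    using g u ann by (simp add: M_def U_def b_def \<rho>_def)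
  finally show ?thesis .
qed

text \<open>
  Membership in the closed span for every \<open>N\<close> means \<open>\<integral> f orientation z\<^sup>k / (z\<^sup>N - \<rho>\<^sup>N) d\<sigma> = 0\<close>.
  Multiplied by \<open>z\<^sup>N\<close>, the kernel \<open>z\<^sup>N / (z\<^sup>N - \<rho>\<^sup>N)\<close> tends to \<open>1\<close> on the outer circle and to
  \<open>0\<close> on the inner one, so all coefficients of \<open>f\<close> on the outer circle vanish.
\<close>

theorem cauchy_class_uniqueness:
  assumes f: "f \<in> cauchy_class" and zeros: "\<not> (AE z in \<sigma>. f z \<noteq> 0)"
  shows "AE z in \<sigma>. f z = 0"
proof -
  define \<rho> where "\<rho> = sqrt R"
  have \<rho>: "0 < \<rho>" "\<rho> < 1" "\<rho> * \<rho> = R" using R by (auto simp: \<rho>_def)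
  have f2: "f \<in> L_two \<sigma>" using f by (simp add: cauchy_class_def)
  note fi = integrable_boundaryD[OF L_two_integrable[OF f2]]
  have small: "norm (x ^ N) \<le> \<rho>" if "norm x = \<rho>" "N > 0" for x :: complex and N
    using that \<rho> power_decreasing[of 1 N \<rho>] by (simp add: norm_power)
  have away: "norm (1 - x ^ N) \<ge> 1 - \<rho>" if "norm x = \<rho>" "N > 0" for x :: complex and N
    using small[OF that] norm_triangle_ineq2[of 1 "x ^ N"] by simp
  \<comment> \<open>Since \<open>\<rho>\<^sup>2 = R\<close>, the kernel is a function of \<open>x\<^sup>N\<close> with \<open>\<bar>x\<bar> = \<rho>\<close> on either circle.\<close>
  define \<kappa> where "\<kappa> N z = z ^ N / (z ^ N - of_real \<rho> ^ N)" for N and z :: complex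
  have outer: "\<kappa> N z = 1 / (1 - (of_real \<rho> / z) ^ N)" if "norm z = 1" for N z
  proof -
    have "z \<noteq> 0" using that by auto
    then show ?thesis by (simp add: \<kappa>_def power_divide divide_simps)
  qed
  have inner: "\<kappa> N (of_real R * z) = - ((of_real \<rho> * z) ^ N) / (1 - (of_real \<rho> * z) ^ N)" for N z
  proof -
    have "\<kappa> N (of_real R * z) = (of_real \<rho> ^ N * (of_real \<rho> * z) ^ N) / (of_real \<rho> ^ N * ((of_real \<rho> * z) ^ N - 1))"
      unfolding \<kappa>_def by (simp add: power_mult_distrib algebra_simps flip: \<rho>(3))
    also have "\<dots> = (of_real \<rho> * z) ^ N / ((of_real \<rho> * z) ^ N - 1)"
      using \<rho> by (intro mult_divide_mult_cancel_left) auto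
    also have "\<dots> = - ((of_real \<rho> * z) ^ N) / (1 - (of_real \<rho> * z) ^ N)"
      by (metis minus_diff_eq minus_divide_divide)
    finally show ?thesis .
  qed
  have denom: "z ^ N - of_real \<rho> ^ N \<noteq> 0" if "z \<in> annulus_boundary R" "N > 0" for z N
  proof
    assume "z ^ N - of_real \<rho> ^ N = 0"
    then have "norm z ^ N = \<rho> ^ N" using \<rho> by (metis eq_iff_diff_eq_0 norm_of_real norm_power abs_of_pos)
    then have "norm z = \<rho>" using \<rho> that(2) by (metis power_eq_imp_eq_base norm_ge_zero less_imp_le)
    then show False using that(1) \<rho> by (auto simp: annulus_boundary_norm)
  qed
  have \<kappa>_Linf: "\<kappa> N \<in> L_infinity \<sigma>" if "N > 0" for N
    unfolding \<kappa>_def using denom[OF _ that]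
    by (intro continuous_on_boundary_L_infinity continuous_intros) auto
  have zero: "(LINT z|circle_measure. f z * \<kappa> N z * z powi k)
      = of_real R powi k * (LINT z|circle_measure. f (of_real R * z) * \<kappa> N (of_real R * z) * z powi k)" if N: "N > 0" for N k
  proof -
    define u where "u z = \<kappa> N z * (orientation z * z powi k)" for z
    have u: "u \<in> L_infinity \<sigma>"
      unfolding u_def by (intro L_infinity_mult \<kappa>_Linf N orientation_powi_L_infinity)
    have "(LINT z|\<sigma>. f z * u z) = 0"
    proof (rule zeros_imp_in_closed_span[OF f zeros N])
      show "u \<in> L_two \<sigma>" by (rule boundary.L_infinity_L_two[OF u])
      fix j
      have "(LINT z|\<sigma>. f z * ((z ^ N - of_real (sqrt R) ^ N) * z powi j * u z))
        = (LINT z|\<sigma>. f z * (orientation z * z powi (j + int N + k)))"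
      proof (rule Bochner_Integration.integral_cong[OF refl])
        fix z assume "z \<in> space \<sigma>"
        then have z: "z \<in> annulus_boundary R" by (simp add: space_boundary)
        have "(z ^ N - of_real (sqrt R) ^ N) * \<kappa> N z = z ^ N"
          using denom[OF z N] by (simp add: \<kappa>_def \<rho>_def)
        then have "(z ^ N - of_real (sqrt R) ^ N) * z powi j * u z = z ^ N * (z powi j * (orientation z * z powi k))"
          unfolding u_def by (metis mult.assoc mult.left_commute)
        also have "\<dots> = orientation z * z powi (j + int N + k)"
          using nonzero_boundary[OF z] by (simp add: power_int_add)
        finally show "f z * ((z ^ N - of_real (sqrt R) ^ N) * z powi j * u z) = f z * (orientation z * z powi (j + int N + k))"
          by simp
      qed
      then show "(LINT z|\<sigma>. f z * ((z ^ N - of_real (sqrt R) ^ N) * z powi j * u z)) = 0"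
        using f by (simp add: cauchy_class_def)
    qed
    then show ?thesis
      using integral_boundary_orientation[OF integrable_L_two_L_infinity[OF \<kappa>_Linf[OF N] f2], of k]
      by (simp add: u_def mult.assoc)
  qed
  have bound: "norm (1 / (1 - x ^ N)) \<le> 1 / (1 - \<rho>)" "norm (- (x ^ N) / (1 - x ^ N)) \<le> 1 / (1 - \<rho>)"
    if "norm x = \<rho>" "N > 0" for x :: complex and N
    using away[OF that] small[OF that] \<rho> by (auto simp: norm_divide intro!: frac_le)
  have pow0: "(\<lambda>n. x ^ Suc n) \<longlonglongrightarrow> 0" if "norm x = \<rho>" for x :: complex
    using that \<rho> by (intro LIMSEQ_Suc LIMSEQ_power_zero) simp
  have lim_outer: "(\<lambda>n. LINT z|circle_measure. f z * \<kappa> (Suc n) z * z powi k) \<longlonglongrightarrow> (LINT z|circle_measure. f z * z powi k)" for k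
  proof (rule integral_dominated_convergence[where w = "\<lambda>z. norm (f z) * (1 / (1 - \<rho>))"])
    show "AE z in circle_measure. (\<lambda>n. f z * \<kappa> (Suc n) z * z powi k) \<longlonglongrightarrow> f z * z powi k"
      using AE_circle_norm
    proof eventually_elim
      case (elim z)
      have "(\<lambda>n. 1 / (1 - (of_real \<rho> / z) ^ Suc n)) \<longlonglongrightarrow> 1 / (1 - 0)"
        by (intro tendsto_intros pow0) (use elim \<rho> in \<open>auto simp: norm_divide\<close>)
      then have "(\<lambda>n. f z * \<kappa> (Suc n) z * z powi k) \<longlonglongrightarrow> f z * (1 / (1 - 0)) * z powi k"
        unfolding outer[OF elim] by (intro tendsto_mult tendsto_const)
      then show ?case by simp
    qed
    show "AE z in circle_measure. norm (f z * \<kappa> (Suc n) z * z powi k) \<le> norm (f z) * (1 / (1 - \<rho>))" for n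
      using AE_circle_norm
    proof eventually_elim
      case (elim z)
      have "norm (\<kappa> (Suc n) z) \<le> 1 / (1 - \<rho>)"
        unfolding outer[OF elim] using elim \<rho> by (intro bound) (auto simp: norm_divide)
      then show ?case
        using elim by (simp only: norm_mult norm_powi_circle mult_1_right) (intro mult_left_mono; simp)
    qed
    show "(\<lambda>z. f z * \<kappa> (Suc n) z * z powi k) \<in> borel_measurable circle_measure" for n
      using integrable_circle_powi[OF integrable_boundaryD(1)[OF integrable_L_two_L_infinity[OF \<kappa>_Linf f2]], of "Suc n" k] by auto
    show "(\<lambda>z. f z * z powi k) \<in> borel_measurable circle_measure"
      using integrable_circle_powi[OF fi(1)] by auto
  qed (use fi in auto)
  have lim_inner: "(\<lambda>n. LINT z|circle_measure. f (of_real R * z) * \<kappa> (Suc n) (of_real R * z) * z powi k) \<longlonglongrightarrow> (LINT z|circle_measure. 0)" for k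
  proof (rule integral_dominated_convergence[where w = "\<lambda>z. norm (f (of_real R * z)) * (1 / (1 - \<rho>))"])
    show "AE z in circle_measure. (\<lambda>n. f (of_real R * z) * \<kappa> (Suc n) (of_real R * z) * z powi k) \<longlonglongrightarrow> 0"
      using AE_circle_norm
    proof eventually_elim
      case (elim z)
      have "(\<lambda>n. - ((of_real \<rho> * z) ^ Suc n) / (1 - (of_real \<rho> * z) ^ Suc n)) \<longlonglongrightarrow> - 0 / (1 - 0)"
        by (intro tendsto_intros pow0) (use elim \<rho> in \<open>auto simp: norm_mult\<close>)
      then have "(\<lambda>n. f (of_real R * z) * \<kappa> (Suc n) (of_real R * z) * z powi k) \<longlonglongrightarrow> f (of_real R * z) * (- 0 / (1 - 0)) * z powi k"
        unfolding inner by (intro tendsto_mult tendsto_const)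
      then show ?case by simp
    qed
    show "AE z in circle_measure. norm (f (of_real R * z) * \<kappa> (Suc n) (of_real R * z) * z powi k) \<le> norm (f (of_real R * z)) * (1 / (1 - \<rho>))" for n
      using AE_circle_norm
    proof eventually_elim
      case (elim z)
      have "norm (\<kappa> (Suc n) (of_real R * z)) \<le> 1 / (1 - \<rho>)"
        unfolding inner using elim \<rho> by (intro bound) (auto simp: norm_mult)
      then show ?case
        using elim by (simp only: norm_mult norm_powi_circle mult_1_right) (intro mult_left_mono; simp)
    qed
    show "(\<lambda>z. f (of_real R * z) * \<kappa> (Suc n) (of_real R * z) * z powi k) \<in> borel_measurable circle_measure" for n
      using integrable_circle_powi[OF integrable_boundaryD(2)[OF integrable_L_two_L_infinity[OF \<kappa>_Linf f2]], of "Suc n" k] by auto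
  qed (use fi in auto)
  have "(LINT z|circle_measure. f z * z powi k) = 0" for k
  proof -
    have "(\<lambda>n. LINT z|circle_measure. f z * \<kappa> (Suc n) z * z powi k) \<longlonglongrightarrow> of_real R powi k * (LINT z|circle_measure. 0)"
      unfolding zero[OF zero_less_Suc] by (intro tendsto_mult tendsto_const lim_inner)
    from LIMSEQ_unique[OF lim_outer this] show ?thesis by simp
  qed
  then have "AE z in circle_measure. f z = 0"
    by (intro Fourier_uniqueness fi)
  then show ?thesis
    by (intro cauchy_class_zero_one_circle[OF f]) simp
qed

end

section \<open>Zero products of Toeplitz operators\<close>

context annulus_radius
begin

text \<open>Replaces explicit approximation by a computation of the orthogonal complement.\<close>

lemma closed_subspace_eq_L_two:
  assumes S: "closed_subspace \<sigma> S"
    and dense: "\<And>v. v \<in> L_two \<sigma> \<Longrightarrow> (\<And>s. s \<in> S \<Longrightarrow> L_two_inner \<sigma> v s = 0) \<Longrightarrow> AE z in \<sigma>. v z = 0"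
    and u: "u \<in> L_two \<sigma>"
  shows "u \<in> S"
proof -
  obtain g where g: "g \<in> S" "\<forall>h\<in>S. L_two_inner \<sigma> (\<lambda>z. u z - g z) h = 0"
    using boundary.orthogonal_projection_exists[OF S u] by blast
  have "AE z in \<sigma>. u z - g z = 0"
    using g by (intro dense L_two_diff u closed_subspaceD(1)[OF S]) auto
  then have "L_two_norm \<sigma> (\<lambda>z. u z - g z) = 0"
    by (rule L_two_norm_zero_AE)
  with g(1) have "\<exists>g\<in>S. L_two_norm \<sigma> (\<lambda>z. u z - g z) < e" if "e > 0" for e
    using that by (intro bexI[of _ g]) simp_all
  then show ?thesis by (rule closed_subspaceD(5)[OF S u])
qed

text \<open>By Pythagoras: \<open>f - h\<close> is the sum of the orthogonal functions \<open>f - P f\<close> and \<open>P f - h\<close>.\<close>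

lemma Hardy_projection_best:
  assumes f: "f \<in> L_two \<sigma>" and h: "h \<in> Hardy_two R"
  shows "L_two_norm \<sigma> (\<lambda>z. f z - Hardy_projection R f z) \<le> L_two_norm \<sigma> (\<lambda>z. f z - h z)"
proof -
  define p where "p = Hardy_projection R f"
  define u where "u z = f z - p z" for z
  note H2 = closed_subspaceD(1)[OF closed_subspace_Hardy_two]
  have p: "p \<in> Hardy_two R" and orth: "\<And>h. h \<in> Hardy_two R \<Longrightarrow> L_two_inner \<sigma> u h = 0"
    using Hardy_projection_props[OF f] by (auto simp: p_def u_def[abs_def])
  have u2: "u \<in> L_two \<sigma>" unfolding u_def by (rule L_two_diff[OF f H2[OF p]])
  have k: "(\<lambda>z. u z - 1 * (h z - p z)) \<in> L_two \<sigma>"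
    using L_two_diff[OF u2 L_two_diff[OF H2[OF h] H2[OF p]]] by simp
  have hp: "(\<lambda>z. h z - p z) \<in> Hardy_two R"
    using closed_subspaceD(3)[OF closed_subspace_Hardy_two h closed_subspaceD(4)[OF closed_subspace_Hardy_two p, of "- 1"]] by simp
  have "(L_two_norm \<sigma> u)\<^sup>2 \<le> (L_two_norm \<sigma> (\<lambda>z. u z - 1 * (h z - p z)))\<^sup>2"
    unfolding L_two_norm_diff_cmult_power2[OF u2 H2[OF hp]] using orth[OF hp] by simp
  then have "L_two_norm \<sigma> u \<le> L_two_norm \<sigma> (\<lambda>z. u z - 1 * (h z - p z))"
    by (rule power2_le_imp_le) (rule L_two_norm_nonneg)
  then show ?thesis by (simp add: u_def[abs_def] p_def)
qed

subsection \<open>The symbols have product zero\<close>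

text \<open>
  In this part \<open>w\<close> is \<open>z\<close> or \<open>R / z\<close>: a unit of the algebra of rational functions whose modulus is
  \<open>1\<close> on one boundary circle and \<open>R\<close> on the other one.  Multiplication by high powers of \<open>w\<close> pushes
  every function into the Hardy space asymptotically: it kills what lives on the second circle, and
  on the first circle trigonometric polynomials become traces of Laurent polynomials.
\<close>

lemma asymptotically_Hardy:
  assumes w: "continuous_on (annulus_boundary R) w"
    and le1: "\<And>z. z \<in> annulus_boundary R \<Longrightarrow> norm (w z) \<le> 1"
    and Hardy: "\<And>n k. (\<lambda>z. w z ^ n * z powi k) \<in> Hardy_two R"
    and E: "(\<forall>z. norm z = 1 \<longrightarrow> norm (w (of_real R * z)) = R) \<or> (\<forall>z. norm z = 1 \<longrightarrow> norm (w z) = R)"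
    and u: "u \<in> L_two \<sigma>" and e: "e > 0"
  shows "\<exists>N. \<forall>n\<ge>N. \<exists>h\<in>Hardy_two R. L_two_norm \<sigma> (\<lambda>z. w z ^ n * u z - h z) < e"
proof -
  note HS = closed_subspace_Hardy_two
  note H2 = closed_subspaceD(1)[OF HS]
  \<comment> \<open>The functions with the desired property form a closed subspace with trivial orthogonal complement.\<close>
  define S where "S = {u \<in> L_two \<sigma>. \<forall>e>0. \<exists>N. \<forall>n\<ge>N. \<exists>h\<in>Hardy_two R. L_two_norm \<sigma> (\<lambda>z. w z ^ n * u z - h z) < e}"
  have wn: "(\<lambda>z. w z ^ n) \<in> L_infinity \<sigma>" for n
    by (intro continuous_on_boundary_L_infinity continuous_intros w)
  have wu: "(\<lambda>z. w z ^ n * f z) \<in> L_two \<sigma>" if "f \<in> L_two \<sigma>" for f n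
    by (rule L_two_L_infinity_mult[OF wn that])
  have wn1: "AE z in \<sigma>. norm (w z ^ n) \<le> 1" for n
    by (rule AE_I2) (simp add: space_boundary norm_power le1 power_le_one)
  have wle: "L_two_norm \<sigma> (\<lambda>z. w z ^ n * f z) \<le> L_two_norm \<sigma> f" if f: "f \<in> L_two \<sigma>" for f n
    using wn1[of n]
    by (intro L_two_norm_le_mono(2)[OF L_twoD(1)[OF wu[OF f]] f]) (auto simp: norm_mult elim!: eventually_mono intro: mult_left_le_one_le)
  have S: "closed_subspace \<sigma> S"
    unfolding closed_subspace_def
  proof (intro conjI ballI allI impI)
    show "S \<subseteq> L_two \<sigma>" by (auto simp: S_def)
    show "(\<lambda>z. 0) \<in> S"
      unfolding S_def using closed_subspaceD(2)[OF HS]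
      by (auto simp: L_two_zero L_two_norm_def intro!: bexI[of _ "\<lambda>z. 0"])
  next
    fix f g assume f: "f \<in> S" and g: "g \<in> S"
    have f2: "f \<in> L_two \<sigma>" and g2: "g \<in> L_two \<sigma>" using f g by (auto simp: S_def)
    show "(\<lambda>z. f z + g z) \<in> S"
      unfolding S_def
    proof (intro CollectI conjI allI impI)
      show "(\<lambda>z. f z + g z) \<in> L_two \<sigma>" by (rule L_two_add[OF f2 g2])
      fix e :: real assume "e > 0"
      then have e: "e / 2 > 0" by simp
      obtain N where N: "\<forall>n\<ge>N. \<exists>h\<in>Hardy_two R. L_two_norm \<sigma> (\<lambda>z. w z ^ n * f z - h z) < e/2"
        using f e unfolding S_def by blast
      obtain N' where N': "\<forall>n\<ge>N'. \<exists>h\<in>Hardy_two R. L_two_norm \<sigma> (\<lambda>z. w z ^ n * g z - h z) < e/2"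
        using g e unfolding S_def by blast
      show "\<exists>N. \<forall>n\<ge>N. \<exists>h\<in>Hardy_two R. L_two_norm \<sigma> (\<lambda>z. w z ^ n * (f z + g z) - h z) < e"
      proof (intro exI[of _ "max N N'"] allI impI)
        fix n assume n: "n \<ge> max N N'"
        obtain h where h: "h \<in> Hardy_two R" "L_two_norm \<sigma> (\<lambda>z. w z ^ n * f z - h z) < e/2"
          using N n by auto
        obtain h' where h': "h' \<in> Hardy_two R" "L_two_norm \<sigma> (\<lambda>z. w z ^ n * g z - h' z) < e/2"
          using N' n by auto
        have "L_two_norm \<sigma> (\<lambda>z. (w z ^ n * f z - h z) + (w z ^ n * g z - h' z)) < e"
          using L_two_norm_triangle[OF L_two_diff[OF wu[OF f2] H2[OF h(1)]] L_two_diff[OF wu[OF g2] H2[OF h'(1)]], of n n] h(2) h'(2)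
          by linarith
        then show "\<exists>h\<in>Hardy_two R. L_two_norm \<sigma> (\<lambda>z. w z ^ n * (f z + g z) - h z) < e"
          by (intro bexI[OF _ closed_subspaceD(3)[OF HS h(1) h'(1)]]) (simp add: algebra_simps)
      qed
    qed
  next
    fix f c assume f: "f \<in> S"
    have f2: "f \<in> L_two \<sigma>" using f by (auto simp: S_def)
    show "(\<lambda>z. c * f z) \<in> S"
      unfolding S_def
    proof (intro CollectI conjI allI impI)
      show "(\<lambda>z. c * f z) \<in> L_two \<sigma>" by (rule L_two_cmult[OF f2])
      fix e :: real assume e: "e > 0"
      then have "e / (norm c + 1) > 0" by (simp add: add_nonneg_pos)
      then obtain N where N: "\<forall>n\<ge>N. \<exists>h\<in>Hardy_two R. L_two_norm \<sigma> (\<lambda>z. w z ^ n * f z - h z) < e / (norm c + 1)"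
        using f unfolding S_def by blast
      show "\<exists>N. \<forall>n\<ge>N. \<exists>h\<in>Hardy_two R. L_two_norm \<sigma> (\<lambda>z. w z ^ n * (c * f z) - h z) < e"
      proof (intro exI[of _ N] allI impI)
        fix n assume "n \<ge> N"
        then obtain h where h: "h \<in> Hardy_two R" "L_two_norm \<sigma> (\<lambda>z. w z ^ n * f z - h z) < e / (norm c + 1)"
          using N by auto
        have "L_two_norm \<sigma> (\<lambda>z. c * (w z ^ n * f z - h z)) \<le> norm c * (e / (norm c + 1))"
          unfolding L_two_norm_cmult using h by (intro mult_left_mono) auto
        also have "\<dots> < e" using e by (simp add: field_simps add_pos_nonneg)
        finally show "\<exists>h\<in>Hardy_two R. L_two_norm \<sigma> (\<lambda>z. w z ^ n * (c * f z) - h z) < e"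
          by (intro bexI[OF _ closed_subspaceD(4)[OF HS h(1), of c]]) (simp add: algebra_simps)
      qed
    qed
  next
    fix f assume f2: "f \<in> L_two \<sigma>" and ap: "\<forall>e>0. \<exists>g\<in>S. L_two_norm \<sigma> (\<lambda>z. f z - g z) < e"
    show "f \<in> S"
      unfolding S_def
    proof (intro CollectI conjI allI impI f2)
      fix e :: real assume "e > 0"
      then have e: "e / 2 > 0" by simp
      obtain g where g: "g \<in> S" "L_two_norm \<sigma> (\<lambda>z. f z - g z) < e/2" using ap e by meson
      have g2: "g \<in> L_two \<sigma>" using g by (auto simp: S_def)
      obtain N where N: "\<forall>n\<ge>N. \<exists>h\<in>Hardy_two R. L_two_norm \<sigma> (\<lambda>z. w z ^ n * g z - h z) < e/2"
        using g(1) e unfolding S_def by blast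
      show "\<exists>N. \<forall>n\<ge>N. \<exists>h\<in>Hardy_two R. L_two_norm \<sigma> (\<lambda>z. w z ^ n * f z - h z) < e"
      proof (intro exI[of _ N] allI impI)
        fix n assume "n \<ge> N"
        then obtain h where h: "h \<in> Hardy_two R" "L_two_norm \<sigma> (\<lambda>z. w z ^ n * g z - h z) < e/2"
          using N by auto
        have "L_two_norm \<sigma> (\<lambda>z. w z ^ n * f z - h z) \<le> L_two_norm \<sigma> (\<lambda>z. w z ^ n * f z - w z ^ n * g z) + L_two_norm \<sigma> (\<lambda>z. w z ^ n * g z - h z)"
          by (rule L_two_norm_triangle_diff[OF wu[OF f2] wu[OF g2] H2[OF h(1)]])
        also have "L_two_norm \<sigma> (\<lambda>z. w z ^ n * f z - w z ^ n * g z) \<le> L_two_norm \<sigma> (\<lambda>z. f z - g z)"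
          using wle[OF L_two_diff[OF f2 g2], of n] by (simp add: right_diff_distrib)
        finally show "\<exists>h\<in>Hardy_two R. L_two_norm \<sigma> (\<lambda>z. w z ^ n * f z - h z) < e"
          using g(2) h by (intro bexI[OF _ h(1)]) linarith
      qed
    qed
  qed
  have powi_S: "(\<lambda>z. z powi k) \<in> S" for k
    unfolding S_def
  proof (intro CollectI conjI allI impI exI)
    show "(\<lambda>z. z powi k) \<in> L_two \<sigma>" by (rule boundary.L_infinity_L_two[OF powi_L_infinity])
    show "\<exists>h\<in>Hardy_two R. L_two_norm \<sigma> (\<lambda>z. w z ^ n * z powi k - h z) < e" if "e > 0" for e n
      using that by (intro bexI[OF _ Hardy[of n k]]) (simp add: L_two_norm_def)
  qed
  have small_S: "f \<in> S" if f: "f \<in> L_two \<sigma>" and ae: "AE z in \<sigma>. f z = 0 \<or> norm (w z) = R" for f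
    unfolding S_def
  proof (intro CollectI conjI allI impI f)
    fix e :: real assume e: "e > 0"
    have "(\<lambda>n. R ^ n * L_two_norm \<sigma> f) \<longlonglongrightarrow> 0 * L_two_norm \<sigma> f"
      using R by (intro tendsto_mult tendsto_const LIMSEQ_realpow_zero) auto
    then have "\<forall>\<^sub>F n in sequentially. R ^ n * L_two_norm \<sigma> f < e"
      using e by (intro order_tendstoD(2)) auto
    then obtain N where N: "\<And>n. n \<ge> N \<Longrightarrow> R ^ n * L_two_norm \<sigma> f < e"
      by (auto simp: eventually_sequentially)
    have "L_two_norm \<sigma> (\<lambda>z. w z ^ n * f z) \<le> L_two_norm \<sigma> (\<lambda>z. of_real (R ^ n) * f z)" for n
    proof (rule L_two_norm_le_mono(2)[OF L_twoD(1)[OF wu[OF f]] L_two_cmult[OF f]])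
      show "AE z in \<sigma>. norm (w z ^ n * f z) \<le> norm (of_real (R ^ n) * f z)"
        using ae by eventually_elim (use R in \<open>auto simp: norm_mult norm_power\<close>)
    qed
    also have "L_two_norm \<sigma> (\<lambda>z. of_real (R ^ n) * f z) = R ^ n * L_two_norm \<sigma> f" for n
      using R by (subst L_two_norm_cmult) (simp add: norm_power)
    finally have "L_two_norm \<sigma> (\<lambda>z. w z ^ n * f z) \<le> R ^ n * L_two_norm \<sigma> f" for n .
    then show "\<exists>N. \<forall>n\<ge>N. \<exists>h\<in>Hardy_two R. L_two_norm \<sigma> (\<lambda>z. w z ^ n * f z - h z) < e"
      using N closed_subspaceD(2)[OF HS] by (intro exI[of _ N] allI impI bexI[of _ "\<lambda>z. 0"]) (auto intro: le_less_trans)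
  qed
  have "u \<in> S"
  proof (rule closed_subspace_eq_L_two[OF S _ u])
    fix v assume v: "v \<in> L_two \<sigma>" and orth: "\<And>s. s \<in> S \<Longrightarrow> L_two_inner \<sigma> v s = 0"
    note vi = integrable_boundaryD[OF L_two_integrable[OF v]]
    have "Measurable.pred \<sigma> (\<lambda>z. norm (w z) = R)"
      using measurable_boundary_continuous[OF w] by measurable
    then have ind: "(\<lambda>z. if norm (w z) = R then 1 else 0 :: complex) \<in> borel_measurable \<sigma>"
      by measurable
    define v' where "v' z = (if norm (w z) = R then 1 else 0) * v z" for z
    have v': "v' \<in> L_two \<sigma>"
      unfolding v'_def by (rule L_two_bounded_mult[OF v ind, where B = 1]) auto
    have "L_two_inner \<sigma> v v' = 0"
      by (intro orth small_S v') (simp add: v'_def)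
    moreover have "v z * cnj (v' z) = of_real ((norm (v' z))\<^sup>2)" for z
      by (simp add: v'_def complex_norm_square[symmetric])
    ultimately have "(LINT z|\<sigma>. (norm (v' z))\<^sup>2) = 0"
      by (simp add: L_two_inner_def flip: of_real_power)
    then have "AE z in \<sigma>. v' z = 0"
      using integral_nonneg_eq_0_iff_AE[OF L_twoD(2)[OF v']] by simp
    then have off: "AE z in \<sigma>. norm (w z) = R \<longrightarrow> v z = 0"
      by eventually_elim (auto simp: v'_def)
    have coef: "(LINT z|circle_measure. v z * z powi k) + of_real R powi (- k) * (LINT z|circle_measure. v (of_real R * z) * z powi k) = 0" for k
    proof -
      have "L_two_inner \<sigma> v (\<lambda>z. z powi (- k)) = 0"
        by (rule orth[OF powi_S])
      also have "L_two_inner \<sigma> v (\<lambda>z. z powi (- k)) = (LINT z|circle_measure. v z * cnj (z powi (- k)))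
          + (LINT z|circle_measure. v (of_real R * z) * cnj ((of_real R * z) powi (- k)))"
        unfolding L_two_inner_def
        by (intro integral_boundary integrable_L_two_mult v L_two_cnj boundary.L_infinity_L_two powi_L_infinity)
      also have "(LINT z|circle_measure. v z * cnj (z powi (- k))) = (LINT z|circle_measure. v z * z powi k)"
        by (rule Bochner_Integration.integral_cong) (auto simp: space_circle_measure cnj_powi_circle simp del: complex_cnj_power_int)
      also have "(LINT z|circle_measure. v (of_real R * z) * cnj ((of_real R * z) powi (- k)))
          = (LINT z|circle_measure. of_real R powi (- k) * (v (of_real R * z) * z powi k))"
      proof (rule Bochner_Integration.integral_cong[OF refl])
        fix z assume "z \<in> space circle_measure"
        then have z: "norm z = 1" by (simp add: space_circle_measure)
        have "cnj ((of_real R * z) powi (- k)) = of_real R powi (- k) * cnj (z powi (- k))"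
          by (simp add: power_int_mult_distrib)
        then show "v (of_real R * z) * cnj ((of_real R * z) powi (- k)) = of_real R powi (- k) * (v (of_real R * z) * z powi k)"
          unfolding cnj_powi_circle[OF z] minus_minus by (simp add: mult_ac)
      qed
      finally show ?thesis by simp
    qed
    have "(AE z in circle_measure. v z = 0) \<and> (AE z in circle_measure. v (of_real R * z) = 0)"
      using E
    proof
      assume inner: "\<forall>z. norm z = 1 \<longrightarrow> norm (w (of_real R * z)) = R"
      have a: "AE z in circle_measure. v (of_real R * z) = 0"
        using AE_boundaryD(2)[OF off] AE_circle_norm by eventually_elim (simp add: inner)
      then have "AE z in circle_measure. v z = 0"
        using coef Fourier_zero[OF a] by (intro Fourier_uniqueness vi) simp
      with a show ?thesis by simp
    next
      assume outer: "\<forall>z. norm z = 1 \<longrightarrow> norm (w z) = R"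
      have a: "AE z in circle_measure. v z = 0"
        using AE_boundaryD(1)[OF off] AE_circle_norm by eventually_elim (simp add: outer)
      then have "AE z in circle_measure. v (of_real R * z) = 0"
        using coef Fourier_zero[OF a] R by (intro Fourier_uniqueness vi) (simp add: power_int_eq_0_iff)
      with a show ?thesis by simp
    qed
    then show "AE z in \<sigma>. v z = 0" using AE_boundary_zero_iff[OF L_twoD(1)[OF v]] by simp
  qed
  then show ?thesis using e by (simp add: S_def)
qed

lemma Toeplitz_product_zero_inner:
  assumes \<phi>: "\<phi> \<in> L_infinity \<sigma>" and \<psi>: "\<psi> \<in> L_infinity \<sigma>"
    and zero: "\<forall>h\<in>Hardy_two R. AE z in \<sigma>. Toeplitz R \<phi> (Toeplitz R \<psi> h) z = 0"
    and h: "h \<in> Hardy_two R" and h': "h' \<in> Hardy_two R"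
  shows "(LINT z|\<sigma>. \<phi> z * Hardy_projection R (\<lambda>z. \<psi> z * h z) z * cnj (h' z)) = 0"
proof -
  note H2 = closed_subspaceD(1)[OF closed_subspace_Hardy_two]
  define g where "g = Hardy_projection R (\<lambda>z. \<psi> z * h z)"
  have g: "g \<in> Hardy_two R"
    unfolding g_def by (rule Hardy_projection_props(1)[OF L_two_L_infinity_mult[OF \<psi> H2[OF h]]])
  define F where "F z = \<phi> z * g z" for z
  have F: "F \<in> L_two \<sigma>" unfolding F_def by (rule L_two_L_infinity_mult[OF \<phi> H2[OF g]])
  have "AE z in \<sigma>. Hardy_projection R F z = 0"
    using zero h by (simp add: Toeplitz_def g_def F_def[abs_def])
  then have "AE z in \<sigma>. F z * cnj (h' z) = (F z - Hardy_projection R F z) * cnj (h' z)"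
    by eventually_elim simp
  then have "(LINT z|\<sigma>. F z * cnj (h' z)) = (LINT z|\<sigma>. (F z - Hardy_projection R F z) * cnj (h' z))"
    using integrable_L_two_mult[OF F L_two_cnj[OF H2[OF h']]]
      integrable_L_two_mult[OF L_two_diff[OF F H2[OF Hardy_projection_props(1)[OF F]]] L_two_cnj[OF H2[OF h']]]
    by (intro integral_cong_AE) auto
  also have "\<dots> = 0"
    using Hardy_projection_props(2)[OF F h'] by (simp add: L_two_inner_def)
  finally show ?thesis by (simp add: F_def g_def)
qed

text \<open>
  The integral is \<open>\<langle>\<phi>\<psi>w\<^sup>n, w\<^sup>n z\<^sup>k\<rangle>\<close>.  Replacing \<open>\<psi>w\<^sup>n\<close> by its Hardy projection changes it by a quantity
  that tends to \<open>0\<close>, and after the replacement it vanishes because \<open>w\<^sup>n\<close> and \<open>w\<^sup>n z\<^sup>k\<close> are Hardy functions.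
\<close>

lemma product_moments_tendsto_0:
  assumes \<phi>: "\<phi> \<in> L_infinity \<sigma>" and \<psi>: "\<psi> \<in> L_infinity \<sigma>"
    and zero: "\<forall>h\<in>Hardy_two R. AE z in \<sigma>. Toeplitz R \<phi> (Toeplitz R \<psi> h) z = 0"
    and w: "continuous_on (annulus_boundary R) w"
    and le1: "\<And>z. z \<in> annulus_boundary R \<Longrightarrow> norm (w z) \<le> 1"
    and Hardy: "\<And>n k. (\<lambda>z. w z ^ n * z powi k) \<in> Hardy_two R"
    and E: "(\<forall>z. norm z = 1 \<longrightarrow> norm (w (of_real R * z)) = R) \<or> (\<forall>z. norm z = 1 \<longrightarrow> norm (w z) = R)"
  shows "(\<lambda>n. LINT z|\<sigma>. \<phi> z * \<psi> z * of_real (norm (w z) ^ (2 * n)) * cnj (z powi k)) \<longlonglongrightarrow> 0"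
proof (rule LIMSEQ_I)
  fix r :: real assume r: "r > 0"
  note H2 = closed_subspaceD(1)[OF closed_subspace_Hardy_two]
  obtain B where B: "\<phi> \<in> borel_measurable \<sigma>" "AE z in \<sigma>. norm (\<phi> z) \<le> B" using L_infinityD[OF \<phi>] .
  define B' where "B' = max B 1"
  have B': "B' > 0" "AE z in \<sigma>. norm (\<phi> z) \<le> B'"
    using B(2) by (auto simp: B'_def elim!: eventually_mono)
  define K where "K = L_two_norm \<sigma> (\<lambda>z. z powi k) + 1"
  have K: "K > 0" by (simp add: K_def L_two_norm_nonneg add_nonneg_pos)
  have \<psi>2: "\<psi> \<in> L_two \<sigma>" by (rule boundary.L_infinity_L_two[OF \<psi>])
  obtain N where N: "\<And>n. n \<ge> N \<Longrightarrow> \<exists>h\<in>Hardy_two R. L_two_norm \<sigma> (\<lambda>z. w z ^ n * \<psi> z - h z) < r / (B' * K)"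
    using asymptotically_Hardy[OF w le1 Hardy E \<psi>2, of "r / (B' * K)"] r B' K by auto
  show "\<exists>N. \<forall>n\<ge>N. norm ((LINT z|\<sigma>. \<phi> z * \<psi> z * of_real (norm (w z) ^ (2 * n)) * cnj (z powi k)) - 0) < r"
  proof (intro exI[of _ N] allI impI)
    fix n assume n: "n \<ge> N"
    define x where "x z = w z ^ n * z powi k" for z
    have x: "x \<in> Hardy_two R" unfolding x_def by (rule Hardy)
    have w1: "(\<lambda>z. w z ^ n) \<in> Hardy_two R" using Hardy[of n 0] by simp
    define f where "f z = \<psi> z * w z ^ n" for z
    have f: "f \<in> L_two \<sigma>" unfolding f_def by (rule L_two_L_infinity_mult[OF \<psi> H2[OF w1]])
    define p where "p = Hardy_projection R f"
    have p: "p \<in> L_two \<sigma>" unfolding p_def by (rule H2[OF Hardy_projection_props(1)[OF f]])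
    define d where "d z = f z - p z" for z
    have d: "d \<in> L_two \<sigma>" unfolding d_def by (rule L_two_diff[OF f p])
    have pz: "(LINT z|\<sigma>. \<phi> z * p z * cnj (x z)) = 0"
      using Toeplitz_product_zero_inner[OF \<phi> \<psi> zero w1 x] by (simp add: p_def f_def[abs_def])
    have \<phi>f: "(\<lambda>z. \<phi> z * f z) \<in> L_two \<sigma>" and \<phi>p: "(\<lambda>z. \<phi> z * p z) \<in> L_two \<sigma>" and \<phi>d: "(\<lambda>z. \<phi> z * d z) \<in> L_two \<sigma>"
      using L_two_L_infinity_mult[OF \<phi>] f p d by auto
    have "(LINT z|\<sigma>. \<phi> z * \<psi> z * of_real (norm (w z) ^ (2 * n)) * cnj (z powi k)) = (LINT z|\<sigma>. \<phi> z * f z * cnj (x z))"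
    proof (rule Bochner_Integration.integral_cong[OF refl])
      fix z
      have "norm (w z) ^ (2 * n) = (norm (w z ^ n))\<^sup>2"
        by (simp add: norm_power power_even_eq)
      then have "complex_of_real (norm (w z) ^ (2 * n)) = w z ^ n * cnj (w z ^ n)"
        by (simp only: complex_norm_square)
      then show "\<phi> z * \<psi> z * of_real (norm (w z) ^ (2 * n)) * cnj (z powi k) = \<phi> z * f z * cnj (x z)"
        by (simp add: f_def x_def mult_ac)
    qed
    also have "\<dots> = (LINT z|\<sigma>. \<phi> z * d z * cnj (x z))"
      using pz integrable_L_two_mult[OF \<phi>f L_two_cnj[OF H2[OF x]]] integrable_L_two_mult[OF \<phi>p L_two_cnj[OF H2[OF x]]]
      by (simp add: d_def right_diff_distrib left_diff_distrib)
    also have "norm \<dots> \<le> L_two_norm \<sigma> (\<lambda>z. \<phi> z * d z) * L_two_norm \<sigma> (\<lambda>z. cnj (x z))"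
      by (rule L_two_Cauchy_Schwarz[OF \<phi>d L_two_cnj[OF H2[OF x]]])
    also have "\<dots> \<le> (B' * L_two_norm \<sigma> d) * K"
    proof (rule mult_mono)
      have "L_two_norm \<sigma> (\<lambda>z. \<phi> z * d z) \<le> L_two_norm \<sigma> (\<lambda>z. of_real B' * d z)"
        using B' by (intro L_two_norm_le_mono(2)[OF L_twoD(1)[OF \<phi>d] L_two_cmult[OF d]])
          (auto simp: norm_mult elim!: eventually_mono intro!: mult_right_mono)
      then show "L_two_norm \<sigma> (\<lambda>z. \<phi> z * d z) \<le> B' * L_two_norm \<sigma> d"
        unfolding L_two_norm_cmult using B' by simp
      have "AE z in \<sigma>. norm (cnj (x z)) \<le> norm (z powi k)"
        by (rule AE_I2) (auto simp: x_def space_boundary norm_mult norm_power norm_power_int le1 power_le_one intro!: mult_left_le_one_le)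
      then have "L_two_norm \<sigma> (\<lambda>z. cnj (x z)) \<le> L_two_norm \<sigma> (\<lambda>z. z powi k)"
        by (rule L_two_norm_le_mono(2)[OF L_twoD(1)[OF L_two_cnj[OF H2[OF x]]] H2[OF powi_Hardy_two]])
      then show "L_two_norm \<sigma> (\<lambda>z. cnj (x z)) \<le> K" by (simp add: K_def)
    qed (use B' in \<open>auto simp: L_two_norm_nonneg\<close>)
    also have "\<dots> < (B' * (r / (B' * K))) * K"
    proof -
      obtain h where h: "h \<in> Hardy_two R" "L_two_norm \<sigma> (\<lambda>z. w z ^ n * \<psi> z - h z) < r / (B' * K)"
        using N[OF n] by blast
      have "L_two_norm \<sigma> d \<le> L_two_norm \<sigma> (\<lambda>z. f z - h z)"
        unfolding d_def p_def by (rule Hardy_projection_best[OF f h(1)])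
      then have "L_two_norm \<sigma> d < r / (B' * K)"
        using h(2) by (simp add: f_def mult.commute)
      then show ?thesis using B' K by (intro mult_strict_right_mono mult_strict_left_mono)
    qed
    also have "\<dots> = r" using B' K by simp
    finally show "norm ((LINT z|\<sigma>. \<phi> z * \<psi> z * of_real (norm (w z) ^ (2 * n)) * cnj (z powi k)) - 0) < r" by simp
  qed
qed

text \<open>
  In the limit the factor \<open>\<bar>w\<bar>\<^sup>2\<^sup>n\<close> singles out the circle where \<open>\<bar>w\<bar> = 1\<close>: the outer one for \<open>w = z\<close>,
  the inner one for \<open>w = R / z\<close>.
\<close>

lemma symbols_product_zero:
  assumes \<phi>: "\<phi> \<in> L_infinity \<sigma>" and \<psi>: "\<psi> \<in> L_infinity \<sigma>"
    and zero: "\<forall>h\<in>Hardy_two R. AE z in \<sigma>. Toeplitz R \<phi> (Toeplitz R \<psi> h) z = 0"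
  shows "AE z in \<sigma>. \<phi> z * \<psi> z = 0"
proof -
  define x where "x z = \<phi> z * \<psi> z" for z
  have x2: "x \<in> L_two \<sigma>"
    unfolding x_def by (intro boundary.L_infinity_L_two L_infinity_mult \<phi> \<psi>)
  note xi = integrable_boundaryD[OF L_two_integrable[OF x2]]
  define a where "a k = (LINT z|circle_measure. x z * z powi k)" for k
  define b where "b k = (LINT z|circle_measure. x (of_real R * z) * z powi k)" for k
  have split: "(LINT z|\<sigma>. \<phi> z * \<psi> z * of_real (norm (w z) ^ (2 * n)) * cnj (z powi (- k)))
      = of_real (s ^ (2 * n)) * a k + of_real (t ^ (2 * n)) * (of_real R powi (- k) * b k)"
    if w: "continuous_on (annulus_boundary R) w"
      and s: "\<And>z. norm z = 1 \<Longrightarrow> norm (w z) = s" and t: "\<And>z. norm z = 1 \<Longrightarrow> norm (w (of_real R * z)) = t" for w s t n k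
  proof -
    have c: "(\<lambda>z. of_real (norm (w z) ^ (2 * n)) * cnj (z powi (- k))) \<in> L_infinity \<sigma>"
      using nonzero_boundary by (intro continuous_on_boundary_L_infinity continuous_intros w) auto
    have "(LINT z|\<sigma>. \<phi> z * \<psi> z * of_real (norm (w z) ^ (2 * n)) * cnj (z powi (- k)))
      = (LINT z|\<sigma>. x z * (of_real (norm (w z) ^ (2 * n)) * cnj (z powi (- k))))"
      by (simp add: x_def mult.assoc)
    also have "\<dots> = (LINT z|circle_measure. x z * (of_real (norm (w z) ^ (2 * n)) * cnj (z powi (- k))))
      + (LINT z|circle_measure. x (of_real R * z) * (of_real (norm (w (of_real R * z)) ^ (2 * n)) * cnj ((of_real R * z) powi (- k))))"
      by (rule integral_boundary[OF integrable_L_two_L_infinity[OF c x2]])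
    also have "(LINT z|circle_measure. x z * (of_real (norm (w z) ^ (2 * n)) * cnj (z powi (- k))))
      = (LINT z|circle_measure. of_real (s ^ (2 * n)) * (x z * z powi k))"
      by (rule Bochner_Integration.integral_cong) (auto simp: space_circle_measure cnj_powi_circle s simp del: complex_cnj_power_int)
    also have "(LINT z|circle_measure. x (of_real R * z) * (of_real (norm (w (of_real R * z)) ^ (2 * n)) * cnj ((of_real R * z) powi (- k))))
      = (LINT z|circle_measure. (of_real (t ^ (2 * n)) * of_real R powi (- k)) * (x (of_real R * z) * z powi k))"
    proof (rule Bochner_Integration.integral_cong[OF refl])
      fix z assume "z \<in> space circle_measure"
      then have z: "norm z = 1" by (simp add: space_circle_measure)
      have "cnj ((of_real R * z) powi (- k)) = of_real R powi (- k) * cnj (z powi (- k))"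
        by (simp add: power_int_mult_distrib)
      then show "x (of_real R * z) * (of_real (norm (w (of_real R * z)) ^ (2 * n)) * cnj ((of_real R * z) powi (- k)))
        = (of_real (t ^ (2 * n)) * of_real R powi (- k)) * (x (of_real R * z) * z powi k)"
        unfolding cnj_powi_circle[OF z] t[OF z] minus_minus by (simp add: mult_ac)
    qed
    finally show ?thesis by (simp add: a_def b_def)
  qed
  have R2: "(\<lambda>n. of_real (R ^ (2 * n)) :: complex) \<longlonglongrightarrow> 0"
  proof -
    have "(\<lambda>n. (R\<^sup>2) ^ n) \<longlonglongrightarrow> 0"
      using R by (intro LIMSEQ_realpow_zero) (auto simp: power_less_one_iff)
    then have "(\<lambda>n. of_real ((R\<^sup>2) ^ n) :: complex) \<longlonglongrightarrow> of_real 0" by (rule tendsto_of_real)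
    then show ?thesis by (simp add: power_mult)
  qed
  have "a k = 0" for k
  proof -
    have "(\<lambda>n. LINT z|\<sigma>. \<phi> z * \<psi> z * of_real (norm z ^ (2 * n)) * cnj (z powi (- k))) \<longlonglongrightarrow> 0"
    proof (rule product_moments_tendsto_0[OF \<phi> \<psi> zero])
      show "norm z \<le> 1" if "z \<in> annulus_boundary R" for z
        using that R by (auto simp: annulus_boundary_norm)
      show "(\<lambda>z. z ^ n * z powi k) \<in> Hardy_two R" for n k
      proof (rule Hardy_two_cong[OF powi_Hardy_two[of "int n + k"]])
        show "z ^ n * z powi k = z powi (int n + k)" if "z \<in> annulus_boundary R" for z
          using nonzero_boundary[OF that] by (simp add: power_int_add)
      qed (use nonzero_boundary in \<open>auto intro!: continuous_intros\<close>)
    qed (use R in \<open>auto intro!: continuous_intros simp: norm_mult\<close>)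
    moreover have "(\<lambda>n. of_real (1 ^ (2 * n)) * a k + of_real (R ^ (2 * n)) * (of_real R powi (- k) * b k)) \<longlonglongrightarrow> 1 * a k + 0 * (of_real R powi (- k) * b k)"
      by (intro tendsto_add tendsto_mult tendsto_const R2) simp
    moreover have "(LINT z|\<sigma>. \<phi> z * \<psi> z * of_real (norm z ^ (2 * n)) * cnj (z powi (- k)))
      = of_real (1 ^ (2 * n)) * a k + of_real (R ^ (2 * n)) * (of_real R powi (- k) * b k)" for n
      by (rule split) (use R in \<open>auto intro!: continuous_intros simp: norm_mult\<close>)
    ultimately show ?thesis using LIMSEQ_unique by fastforce
  qed
  then have outer: "AE z in circle_measure. x z = 0"
    by (intro Fourier_uniqueness xi) (simp add: a_def)
  have "b k = 0" for k
  proof -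
    have cont: "continuous_on (annulus_boundary R) (\<lambda>z. of_real R / z)"
      using nonzero_boundary by (intro continuous_intros) auto
    have "(\<lambda>n. LINT z|\<sigma>. \<phi> z * \<psi> z * of_real (norm (of_real R / z) ^ (2 * n)) * cnj (z powi (- k))) \<longlonglongrightarrow> 0"
    proof (rule product_moments_tendsto_0[OF \<phi> \<psi> zero cont])
      show "norm (of_real R / z) \<le> 1" if "z \<in> annulus_boundary R" for z
        using that R by (auto simp: annulus_boundary_norm norm_divide)
      show "(\<lambda>z. (of_real R / z) ^ n * z powi k) \<in> Hardy_two R" for n k
      proof (rule Hardy_two_cong[OF closed_subspaceD(4)[OF closed_subspace_Hardy_two powi_Hardy_two[of "k - int n"]]])
        show "(of_real R / z) ^ n * z powi k = of_real R ^ n * z powi (k - int n)" if "z \<in> annulus_boundary R" for z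
          using nonzero_boundary[OF that] by (simp add: power_int_diff power_divide)
      qed (use nonzero_boundary in \<open>auto intro!: continuous_intros\<close>)
      show "(\<forall>z. norm z = 1 \<longrightarrow> norm (of_real R / (of_real R * z)) = R) \<or> (\<forall>z :: complex. norm z = 1 \<longrightarrow> norm (of_real R / z) = R)"
        using R by (auto simp: norm_divide)
    qed
    moreover have "(\<lambda>n. of_real (R ^ (2 * n)) * a k + of_real (1 ^ (2 * n)) * (of_real R powi (- k) * b k)) \<longlonglongrightarrow> 0 * a k + 1 * (of_real R powi (- k) * b k)"
      by (intro tendsto_add tendsto_mult tendsto_const R2) simp
    moreover have "(LINT z|\<sigma>. \<phi> z * \<psi> z * of_real (norm (of_real R / z) ^ (2 * n)) * cnj (z powi (- k)))
      = of_real (R ^ (2 * n)) * a k + of_real (1 ^ (2 * n)) * (of_real R powi (- k) * b k)" for n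
      by (rule split[OF cont]) (use R in \<open>auto simp: norm_mult norm_divide\<close>)
    ultimately have "of_real R powi (- k) * b k = 0" using LIMSEQ_unique by fastforce
    then show ?thesis using R by (simp add: power_int_eq_0_iff)
  qed
  then have "AE z in circle_measure. x (of_real R * z) = 0"
    by (intro Fourier_uniqueness xi) (simp add: b_def)
  with outer show ?thesis
    using AE_boundary_zero_iff[OF L_twoD(1)[OF x2]] by (simp add: x_def)
qed

subsection \<open>One of the symbols vanishes\<close>

text \<open>
  The powers \<open>z\<^sup>k\<close>, for all integers \<open>k\<close>, are Hardy functions, and orthogonality to them becomes the defining
  condition of the Cauchy class after conjugation, as the square of \<open>orientation\<close> is \<open>1\<close>.
\<close>

lemma cauchy_classI_orthogonal:
  assumes u: "u \<in> L_two \<sigma>" and orth: "\<And>h. h \<in> Hardy_two R \<Longrightarrow> L_two_inner \<sigma> u h = 0"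
  shows "(\<lambda>z. orientation z * cnj (u z)) \<in> cauchy_class"
  unfolding cauchy_class_def
proof (intro CollectI conjI allI)
  show "(\<lambda>z. orientation z * cnj (u z)) \<in> L_two \<sigma>"
    by (rule L_two_L_infinity_mult[OF orientation_L_infinity L_two_cnj[OF u]])
  fix k :: int
  have "orientation z * cnj (u z) * (orientation z * z powi k) = (orientation z * orientation z) * cnj (u z * cnj (z powi k))" for z
    by (simp del: orientation_simps add: mult_ac)
  then have "(LINT z|\<sigma>. orientation z * cnj (u z) * (orientation z * z powi k)) = cnj (LINT z|\<sigma>. u z * cnj (z powi k))"
    by (simp only: orientation_simps mult_1 Bochner_Integration.integral_cnj)
  also have "\<dots> = 0"
    using orth[OF powi_Hardy_two[of k]] by (simp add: L_two_inner_def)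
  finally show "(LINT z|\<sigma>. orientation z * cnj (u z) * (orientation z * z powi k)) = 0" .
qed

text \<open>
  In operator terms, \<open>u\<close> below is the image of the constant \<open>1\<close> under the Hankel operator of \<open>\<psi>\<close>, and the
  hypothesis says that the adjoint of the Hankel operator of the conjugate of \<open>\<phi>\<close> kills it.  The
  uniqueness theorem makes that adjoint injective.
\<close>

theorem Toeplitz_zero_product:
  assumes \<phi>: "\<phi> \<in> L_infinity \<sigma>" and \<psi>: "\<psi> \<in> L_infinity \<sigma>"
    and zero: "\<forall>h\<in>Hardy_two R. AE z in \<sigma>. Toeplitz R \<phi> (Toeplitz R \<psi> h) z = 0"
  shows "(AE z in \<sigma>. \<phi> z = 0) \<or> (AE z in \<sigma>. \<psi> z = 0)"
proof (rule ccontr)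
  assume "\<not> ?thesis"
  then have nz: "\<not> (AE z in \<sigma>. \<phi> z = 0)" "\<not> (AE z in \<sigma>. \<psi> z = 0)" by auto
  note H2 = closed_subspaceD(1)[OF closed_subspace_Hardy_two]
  have prod: "AE z in \<sigma>. \<phi> z * \<psi> z = 0"
    by (rule symbols_product_zero[OF \<phi> \<psi> zero])
  have \<phi>0: "\<not> (AE z in \<sigma>. \<phi> z \<noteq> 0)"
  proof
    assume "AE z in \<sigma>. \<phi> z \<noteq> 0"
    with prod have "AE z in \<sigma>. \<psi> z = 0" by eventually_elim simp
    with nz show False by simp
  qed
  have \<psi>0: "\<not> (AE z in \<sigma>. \<psi> z \<noteq> 0)"
  proof
    assume "AE z in \<sigma>. \<psi> z \<noteq> 0"
    with prod have "AE z in \<sigma>. \<phi> z = 0" by eventually_elim simp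
    with nz show False by simp
  qed
  have \<psi>2: "\<psi> \<in> L_two \<sigma>" by (rule boundary.L_infinity_L_two[OF \<psi>])
  define g where "g = Hardy_projection R \<psi>"
  have g: "g \<in> Hardy_two R" unfolding g_def by (rule Hardy_projection_props(1)[OF \<psi>2])
  define u where "u z = \<psi> z - g z" for z
  have u2: "u \<in> L_two \<sigma>" unfolding u_def by (rule L_two_diff[OF \<psi>2 H2[OF g]])
  have u_orth: "L_two_inner \<sigma> u h = 0" if "h \<in> Hardy_two R" for h
    using Hardy_projection_props(2)[OF \<psi>2 that] by (simp add: u_def[abs_def] g_def)
  have \<phi>u2: "(\<lambda>z. \<phi> z * u z) \<in> L_two \<sigma>" and \<phi>g2: "(\<lambda>z. \<phi> z * g z) \<in> L_two \<sigma>"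
    using L_two_L_infinity_mult[OF \<phi>] u2 H2[OF g] by auto
  have \<phi>u_orth: "L_two_inner \<sigma> (\<lambda>z. \<phi> z * u z) h = 0" if h: "h \<in> Hardy_two R" for h
  proof -
    have "AE z in \<sigma>. \<phi> z * u z * cnj (h z) = - (\<phi> z * g z * cnj (h z))"
      using prod by eventually_elim (auto simp: u_def right_diff_distrib)
    then have "(LINT z|\<sigma>. \<phi> z * u z * cnj (h z)) = (LINT z|\<sigma>. - (\<phi> z * g z * cnj (h z)))"
      using integrable_L_two_mult[OF \<phi>u2 L_two_cnj[OF H2[OF h]]] integrable_L_two_mult[OF \<phi>g2 L_two_cnj[OF H2[OF h]]]
      by (intro integral_cong_AE) auto
    also have "\<dots> = 0"
      using Toeplitz_product_zero_inner[OF \<phi> \<psi> zero powi_Hardy_two[of 0] h] by (simp add: g_def)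
    finally show ?thesis by (simp add: L_two_inner_def)
  qed
  have "AE z in \<sigma>. orientation z * cnj (\<phi> z * u z) = 0"
  proof (rule cauchy_class_uniqueness[OF cauchy_classI_orthogonal[OF \<phi>u2 \<phi>u_orth]])
    show "\<not> (AE z in \<sigma>. orientation z * cnj (\<phi> z * u z) \<noteq> 0)"
      using \<phi>0 by (auto elim: eventually_mono)
  qed
  then have \<phi>u: "AE z in \<sigma>. \<phi> z * u z = 0"
    by eventually_elim (auto simp: orientation_def split: if_splits)
  have "AE z in \<sigma>. orientation z * cnj (u z) = 0"
  proof (rule cauchy_class_uniqueness[OF cauchy_classI_orthogonal[OF u2 u_orth]])
    show "\<not> (AE z in \<sigma>. orientation z * cnj (u z) \<noteq> 0)"
    proof
      assume "AE z in \<sigma>. orientation z * cnj (u z) \<noteq> 0"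
      with \<phi>u have "AE z in \<sigma>. \<phi> z = 0" by eventually_elim auto
      with nz show False by simp
    qed
  qed
  then have \<psi>g: "AE z in \<sigma>. \<psi> z = g z"
    by eventually_elim (auto simp: orientation_def u_def split: if_splits)
  have "AE z in \<sigma>. g z = 0"
  proof (rule cauchy_class_uniqueness)
    show "g \<in> cauchy_class" using g Hardy_two_subset_cauchy_class by auto
    show "\<not> (AE z in \<sigma>. g z \<noteq> 0)"
    proof
      assume "AE z in \<sigma>. g z \<noteq> 0"
      with \<psi>g have "AE z in \<sigma>. \<psi> z \<noteq> 0" by eventually_elim simp
      with \<psi>0 show False by simp
    qed
  qed
  with \<psi>g have "AE z in \<sigma>. \<psi> z = 0" by eventually_elim simp
  then show False using nz(2) by simp
qed

end

theorem theorem2p12: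
  fixes R :: real and \<phi> \<psi> :: "complex \<Rightarrow> complex"
  assumes "0 < R" and "R < 1"
    and "\<phi> \<in> L_infinity (boundary_measure R)"
    and "\<psi> \<in> L_infinity (boundary_measure R)"
    and "(outer_part (\<lambda>z. cnj (\<phi> z)) \<in> H_infinity_plus_C \<and>
          inner_part R (\<lambda>z. cnj (\<phi> z)) \<in> H_infinity_plus_C) \<or>
         (outer_part \<psi> \<in> H_infinity_plus_C \<and> inner_part R \<psi> \<in> H_infinity_plus_C)"
    and "\<forall>h \<in> Hardy_two R. AE z in boundary_measure R. Toeplitz R \<phi> (Toeplitz R \<psi> h) z = 0"
  shows "(AE z in boundary_measure R. \<phi> z = 0) \<or> (AE z in boundary_measure R. \<psi> z = 0)"
proof -
  interpret annulus_radius R using assms(1,2) by unfold_locales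
  show ?thesis by (rule Toeplitz_zero_product[OF assms(3,4,6)])
qed

end
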